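(* Let $M$ be a Riemannian $d$-manifold. If $X, Y \in \mathfrak{S}_d(M)$ and $\mathrm{int}(X \cap Y) = \varnothing$, then $\widetilde{X \cup Y} = \widetilde{X} \sqcup \widetilde{Y}$; that is, $\widetilde{X\cup Y} = \widetilde{X}\cup\widetilde{Y}$ and $\widetilde{X}\cap\widetilde{Y}=\varnothing$.
   Context: Manifolds are smooth, and $\langle\cdot,\cdot\rangle$ is the Riemannian metric. For a subset $A$ of a topological space, $\mathrm{ci}(A) := \mathrm{cl}(\mathrm{int}\, A)$ is the closure of its interior. $\sqcup$, $\bigsqcup$ denote disjoint unions. Let $M$ be a Riemannian $d$-manifold, $x\in M$. Put $U_x M := \{v \in T_xM : \langle v,v\rangle = 1\}$, the unit sphere of $T_xM$; for $d \ge 1$ it is a Riemannian $(d-1)$-manifold with the metric induced from the inner product on $T_xM$ (two points if $d=1$), and for $v\in U_xM$ the tangent space $T_v(U_xM)$ is identified with $v^\perp\subset T_xM$. For an arbitrary subset $X\subset M$ put $$U_xX := \{v \in U_xM : v = \gamma'(0) \text{ for some smooth curve } \gamma:[0,\varepsilon_0)\to X \text{ with } \gamma(0)=x\}$$ (smooth as a curve in $M$, for some $\varepsilon_0>0$). For $v\in U_xM$ and $\delta>0$ put $$\mathfrak{c}_{v,\delta} := \{u \in T_xM : (1-\delta)\|u\|\,\|v\| < \langle u,v\rangle < \delta\},$$ and let $\exp_x$ be the Riemannian exponential map at $x$ ($\delta$ is always taken small enough that $\exp_x$ is defined on $\mathfrak{c}_{v,\delta}$). The collection $\mathfrak{S}_d(M)$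 of subsets of $M$ is defined recursively on $d$. For $d=0$ it consists of all subsets of $M$. For $d\ge 1$, $X\subset M$ belongs to $\mathfrak{S}_d(M)$ iff (a) $X = \mathrm{ci}(X)$; (b) for each $x\in X$, the set $$\mathcal{C}_{X,x} := \{v\in U_xM : \exists\,\delta>0\ \ (\exp_x(\mathfrak{c}_{v,\delta})\subset X \ \text{ or }\ \exp_x(\mathfrak{c}_{v,\delta})\subset M\setminus X)\}$$ has dense interior in $U_xM$ (i.e. $\mathrm{int}\,\mathcal{C}_{X,x}$ is dense in $U_xM$); (c) for each $x\in X$, $\mathrm{ci}(U_xX)\in\mathfrak{S}_{d-1}(U_xM)$, with $\mathrm{ci}$ taken in $U_xM$. The rasped representation $\widetilde{X}$ of $X\in\mathfrak{S}_d(M)$ is defined recursively on $d$: $\widetilde{X} := X$ if $d=0$, and $$\widetilde{X} := \bigsqcup_{x\in X}\{x\}\times\widetilde{\mathrm{ci}(U_xX)}$$ if $d>0$, where $\mathrm{ci}(U_xX)$ is regarded as an element of $\mathfrak{S}_{d-1}(U_xM)$. Thus $\widetilde{X}$ is a set of tuples $(x;v_1,\dots,v_d)$ with $x\in M$ and $v_1,\dots,v_d\in T_xM$ orthonormal. The formula is literally meaningful for any subset $X\subset M$, and is applied to $X\cup Y$ in this sense. *)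

theory Defs
  imports "HOL-Analysis.Analysis"
begin

section \<open>Smooth functions in coordinates\<close>

text \<open>Points of $\mathbb{R}^d$ are the sequences vanishing from index $d$ on, i.e.\ the points of
  \<^term>\<open>Euclidean_space d\<close>, so that manifolds of different dimensions have charts of the same type.\<close>

definition part_deriv :: "nat \<Rightarrow> ((nat \<Rightarrow> real) \<Rightarrow> real) \<Rightarrow> (nat \<Rightarrow> real) \<Rightarrow> real" where
  "part_deriv i f y = deriv (\<lambda>t. f (y(i := t))) (y i)"

definition part_derivs :: "nat list \<Rightarrow> ((nat \<Rightarrow> real) \<Rightarrow> real) \<Rightarrow> (nat \<Rightarrow> real) \<Rightarrow> real" where
  "part_derivs is f = foldr part_deriv is f"

definition smooth_fun :: "nat \<Rightarrow> (nat \<Rightarrow> real) set \<Rightarrow> ((nat \<Rightarrow> real) \<Rightarrow> real) \<Rightarrow> bool" where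
  "smooth_fun d V f \<longleftrightarrow>
     (\<forall>is. set is \<subseteq> {..<d} \<longrightarrow>
        continuous_map (subtopology (Euclidean_space d) V) euclideanreal (part_derivs is f) \<and>
        (\<forall>y\<in>V. \<forall>i<d. (\<lambda>t. part_derivs is f (y(i := t))) field_differentiable (at (y i))))"

text \<open>The derivatives are taken within \<open>S\<close>, hence are one-sided at an end point of an
  interval that belongs to it.\<close>

definition smooth_real_on :: "real set \<Rightarrow> (real \<Rightarrow> real) \<Rightarrow> bool" where
  "smooth_real_on S f \<longleftrightarrow>
     (\<exists>D :: nat \<Rightarrow> real \<Rightarrow> real. (\<forall>t\<in>S. D 0 t = f t) \<and>
        (\<forall>k. \<forall>t\<in>S. (D k has_real_derivative D (Suc k) t) (at t within S)))"


section \<open>Riemannian manifolds\<close>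

text \<open>The tangent space at a point is a linear subspace of a real vector space \<open>'v\<close>; every
  chart carries, besides its coordinate map, the differential of that map at each point of its
  domain. The axioms below (the differentials are linear isomorphisms onto $\mathbb{R}^d$ and are
  related by the Jacobian matrices of the transition maps) determine the tangent spaces up to a
  unique isomorphism. This makes room for the identification of $T_v(U_xM)$ with
  $v^\perp \subseteq T_xM$, under which all tangent spaces occurring in iterated unit spheres of
  $M$ lie in the same type.\<close>

record ('p, 'v) chart =
  chart_dom :: "'p set"
  coord :: "'p \<Rightarrow> nat \<Rightarrow> real"
  dcoord :: "'p \<Rightarrow> 'v \<Rightarrow> nat \<Rightarrow> real"

record ('p, 'v) rmanifold =
  mdim :: nat
  mtop :: "'p topology"
  atlas :: "('p, 'v) chart set"
  tangent :: "'p \<Rightarrow> 'v set"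
  met :: "'p \<Rightarrow> 'v \<Rightarrow> 'v \<Rightarrow> real"

abbreviation points :: "('p, 'v) rmanifold \<Rightarrow> 'p set" where
  "points M \<equiv> topspace (mtop M)"

definition chart_inv :: "('p, 'v) chart \<Rightarrow> (nat \<Rightarrow> real) \<Rightarrow> 'p" where
  "chart_inv c = inv_into (chart_dom c) (coord c)"

text \<open>The coordinate vector field $\partial_i$ of a chart.\<close>

definition coord_vec :: "('p, 'v) rmanifold \<Rightarrow> ('p, 'v) chart \<Rightarrow> nat \<Rightarrow> 'p \<Rightarrow> 'v" where
  "coord_vec M c i x = inv_into (tangent M x) (dcoord c x) (\<lambda>j. if j = i then 1 else 0)"

definition met_coeff ::
  "('p, 'v) rmanifold \<Rightarrow> ('p, 'v) chart \<Rightarrow> nat \<Rightarrow> nat \<Rightarrow> (nat \<Rightarrow> real) \<Rightarrow> real" where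
  "met_coeff M c i j y =
     (let x = chart_inv c y in met M x (coord_vec M c i x) (coord_vec M c j x))"

locale smooth_manifold =
  fixes M :: "('p, 'v::real_vector) rmanifold"
  assumes Hausdorff: "Hausdorff_space (mtop M)"
    and second_countable: "second_countable (mtop M)"
    and chart_cover: "(\<Union>c\<in>atlas M. chart_dom c) = points M"
    and chart_dom_open: "c \<in> atlas M \<Longrightarrow> openin (mtop M) (chart_dom c)"
    and chart_image_open:
      "c \<in> atlas M \<Longrightarrow> openin (Euclidean_space (mdim M)) (coord c ` chart_dom c)"
    and chart_homeo:
      "c \<in> atlas M \<Longrightarrow>
         homeomorphic_map (subtopology (mtop M) (chart_dom c))
           (subtopology (Euclidean_space (mdim M)) (coord c ` chart_dom c)) (coord c)"
    and transition_smooth: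
      "\<lbrakk>c \<in> atlas M; c' \<in> atlas M; j < mdim M\<rbrakk> \<Longrightarrow>
         smooth_fun (mdim M) (coord c ` (chart_dom c \<inter> chart_dom c'))
           (\<lambda>y. coord c' (chart_inv c y) j)"
    and tangent_subspace: "x \<in> points M \<Longrightarrow> subspace (tangent M x)"
    and dcoord_bij:
      "\<lbrakk>c \<in> atlas M; x \<in> chart_dom c\<rbrakk> \<Longrightarrow>
         bij_betw (dcoord c x) (tangent M x) (topspace (Euclidean_space (mdim M)))"
    and dcoord_linear:
      "\<lbrakk>c \<in> atlas M; x \<in> chart_dom c; u \<in> tangent M x; w \<in> tangent M x\<rbrakk> \<Longrightarrow>
         dcoord c x (a *\<^sub>R u + b *\<^sub>R w) i = a * dcoord c x u i + b * dcoord c x w i"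
    and dcoord_transition:
      "\<lbrakk>c \<in> atlas M; c' \<in> atlas M; x \<in> chart_dom c \<inter> chart_dom c'; u \<in> tangent M x; j < mdim M\<rbrakk> \<Longrightarrow>
         dcoord c' x u j =
           (\<Sum>i<mdim M. part_deriv i (\<lambda>y. coord c' (chart_inv c y) j) (coord c x) * dcoord c x u i)"

locale riemannian_manifold = smooth_manifold M
  for M :: "('p, 'v::real_vector) rmanifold" +
  assumes met_linear:
      "\<lbrakk>x \<in> points M; u \<in> tangent M x; v \<in> tangent M x; w \<in> tangent M x\<rbrakk> \<Longrightarrow>
         met M x (a *\<^sub>R u + b *\<^sub>R v) w = a * met M x u w + b * met M x v w"
    and met_sym:
      "\<lbrakk>x \<in> points M; u \<in> tangent M x; w \<in> tangent M x\<rbrakk> \<Longrightarrow> met M x u w = met M x w u"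
    and met_pos:
      "\<lbrakk>x \<in> points M; u \<in> tangent M x; u \<noteq> 0\<rbrakk> \<Longrightarrow> met M x u u > 0"
    and met_smooth:
      "\<lbrakk>c \<in> atlas M; i < mdim M; j < mdim M\<rbrakk> \<Longrightarrow>
         smooth_fun (mdim M) (coord c ` chart_dom c) (met_coeff M c i j)"

definition tnorm :: "('p, 'v) rmanifold \<Rightarrow> 'p \<Rightarrow> 'v \<Rightarrow> real" where
  "tnorm M x v = sqrt (met M x v v)"


section \<open>Curves, geodesics and the exponential map\<close>

definition smooth_curve :: "('p, 'v) rmanifold \<Rightarrow> real set \<Rightarrow> (real \<Rightarrow> 'p) \<Rightarrow> bool" where
  "smooth_curve M I \<gamma> \<longleftrightarrow>
     continuous_map (top_of_set I) (mtop M) \<gamma> \<and>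
     (\<forall>c\<in>atlas M. \<forall>i<mdim M.
        smooth_real_on {t\<in>I. \<gamma> t \<in> chart_dom c} (\<lambda>t. coord c (\<gamma> t) i))"

definition has_velocity ::
  "('p, 'v) rmanifold \<Rightarrow> real set \<Rightarrow> (real \<Rightarrow> 'p) \<Rightarrow> real \<Rightarrow> 'v \<Rightarrow> bool" where
  "has_velocity M I \<gamma> t v \<longleftrightarrow>
     v \<in> tangent M (\<gamma> t) \<and>
     (\<forall>c\<in>atlas M. \<gamma> t \<in> chart_dom c \<longrightarrow>
        (\<forall>i<mdim M. ((\<lambda>s. coord c (\<gamma> s) i) has_real_derivative dcoord c (\<gamma> t) v i) (at t within I)))"

text \<open>Christoffel symbols of the first kind, $\Gamma_{l,ij} = g_{lk}\Gamma^k_{ij}$.\<close>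

definition christoffel ::
  "('p, 'v) rmanifold \<Rightarrow> ('p, 'v) chart \<Rightarrow> nat \<Rightarrow> nat \<Rightarrow> nat \<Rightarrow> (nat \<Rightarrow> real) \<Rightarrow> real" where
  "christoffel M c l i j y =
     (part_deriv i (met_coeff M c j l) y + part_deriv j (met_coeff M c i l) y
        - part_deriv l (met_coeff M c i j) y) / 2"

text \<open>The geodesic equation $\ddot y^k + \Gamma^k_{ij}\dot y^i\dot y^j = 0$, with the index
  lowered by the (nonsingular) matrix $(g_{lk})$. The parameter set \<open>I\<close> is meant to be an
  open interval.\<close>

definition geodesic :: "('p, 'v) rmanifold \<Rightarrow> real set \<Rightarrow> (real \<Rightarrow> 'p) \<Rightarrow> bool" where
  "geodesic M I \<gamma> \<longleftrightarrow>
     smooth_curve M I \<gamma> \<and>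
     (\<forall>c\<in>atlas M. \<forall>t\<in>I. \<gamma> t \<in> chart_dom c \<longrightarrow>
        (let y = (\<lambda>k s. coord c (\<gamma> s) k) in
         \<forall>l<mdim M.
           (\<Sum>k<mdim M. met_coeff M c l k (coord c (\<gamma> t)) * deriv (deriv (y k)) t)
           + (\<Sum>i<mdim M. \<Sum>j<mdim M.
                christoffel M c l i j (coord c (\<gamma> t)) * deriv (y i) t * deriv (y j) t) = 0))"

definition exp_curve :: "('p, 'v) rmanifold \<Rightarrow> 'p \<Rightarrow> 'v \<Rightarrow> (real \<Rightarrow> 'p) \<Rightarrow> bool" where
  "exp_curve M x u \<gamma> \<longleftrightarrow>
     (\<exists>a b. a < 0 \<and> 1 < b \<and> geodesic M {a<..<b} \<gamma> \<and>
        \<gamma> 0 = x \<and> has_velocity M {a<..<b} \<gamma> 0 u)"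

definition exp_dom :: "('p, 'v) rmanifold \<Rightarrow> 'p \<Rightarrow> 'v set" where
  "exp_dom M x = {u \<in> tangent M x. \<exists>\<gamma>. exp_curve M x u \<gamma>}"

definition exp_map :: "('p, 'v) rmanifold \<Rightarrow> 'p \<Rightarrow> 'v \<Rightarrow> 'p" where
  "exp_map M x u = (THE y. \<exists>\<gamma>. exp_curve M x u \<gamma> \<and> \<gamma> 1 = y)"


section \<open>The unit sphere of a tangent space as a Riemannian manifold\<close>

definition unit_vectors :: "('p, 'v) rmanifold \<Rightarrow> 'p \<Rightarrow> 'v set" where
  "unit_vectors M x = {v \<in> tangent M x. met M x v v = 1}"

text \<open>\<open>(p, b 0, \<dots>, b (d - 2))\<close> is an orthonormal basis of the tangent space.\<close>

definition sphere_frame :: "('p, 'v) rmanifold \<Rightarrow> 'p \<Rightarrow> 'v \<Rightarrow> (nat \<Rightarrow> 'v) \<Rightarrow> bool" where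
  "sphere_frame M x p b \<longleftrightarrow>
     p \<in> unit_vectors M x \<and>
     (\<forall>i<mdim M - 1. b i \<in> tangent M x \<and> met M x (b i) p = 0 \<and>
        (\<forall>j<mdim M - 1. met M x (b i) (b j) = (if i = j then 1 else 0)))"

text \<open>The chart on the open hemisphere around \<open>p\<close> given by orthogonal projection to the
  hyperplane $p^\perp$. It is the restriction of a linear map, so its differential at \<open>v\<close>
  is the restriction of the same linear map to $v^\perp$.\<close>

definition hemisphere_chart ::
  "('p, 'v) rmanifold \<Rightarrow> 'p \<Rightarrow> 'v \<Rightarrow> (nat \<Rightarrow> 'v) \<Rightarrow> ('v, 'v) chart" where
  "hemisphere_chart M x p b =
     \<lparr> chart_dom = {v \<in> unit_vectors M x. met M x v p > 0},
       coord = (\<lambda>v i. if i < mdim M - 1 then met M x v (b i) else 0),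
       dcoord = (\<lambda>v w i. if i < mdim M - 1 then met M x w (b i) else 0) \<rparr>"

text \<open>The distance below is the norm distance of the tangent space, cut down to the sphere.\<close>

definition unit_sphere :: "('p, 'v::real_vector) rmanifold \<Rightarrow> 'p \<Rightarrow> ('v, 'v) rmanifold" where
  "unit_sphere M x =
     \<lparr> mdim = mdim M - 1,
       mtop = Metric_space.mtopology (unit_vectors M x)
                (\<lambda>v w. if v \<in> unit_vectors M x \<and> w \<in> unit_vectors M x
                        then tnorm M x (v - w) else 0),
       atlas = {hemisphere_chart M x p b | p b. sphere_frame M x p b},
       tangent = (\<lambda>v. {w \<in> tangent M x. met M x v w = 0}),
       met = (\<lambda>v. met M x) \<rparr>"


section \<open>The collection \<open>\<SS>\<^sub>d(M)\<close> and the rasped representation\<close>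

definition ci :: "'a topology \<Rightarrow> 'a set \<Rightarrow> 'a set" where
  "ci T A = T closure_of (T interior_of A)"

definition unit_tangents :: "('p, 'v) rmanifold \<Rightarrow> 'p \<Rightarrow> 'p set \<Rightarrow> 'v set" where
  "unit_tangents M x X =
     {v \<in> unit_vectors M x. \<exists>\<epsilon>>0. \<exists>\<gamma>. smooth_curve M {0..<\<epsilon>} \<gamma> \<and> \<gamma> ` {0..<\<epsilon>} \<subseteq> X \<and>
        \<gamma> 0 = x \<and> has_velocity M {0..<\<epsilon>} \<gamma> 0 v}"

definition cone :: "('p, 'v) rmanifold \<Rightarrow> 'p \<Rightarrow> 'v \<Rightarrow> real \<Rightarrow> 'v set" where
  "cone M x v \<delta> =
     {u \<in> tangent M x. (1 - \<delta>) * tnorm M x u * tnorm M x v < met M x u v \<and> met M x u v < \<delta>}"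

definition conical_dirs :: "('p, 'v) rmanifold \<Rightarrow> 'p set \<Rightarrow> 'p \<Rightarrow> 'v set" where
  "conical_dirs M X x =
     {v \<in> unit_vectors M x. \<exists>\<delta>>0. cone M x v \<delta> \<subseteq> exp_dom M x \<and>
        (exp_map M x ` cone M x v \<delta> \<subseteq> X \<or> exp_map M x ` cone M x v \<delta> \<subseteq> points M - X)}"

text \<open>The recursion on the dimension passes from a manifold with points of type \<open>'p\<close> to
  manifolds with points of type \<open>'v\<close> and stays there. It is therefore set up for \<open>'v\<close>
  first, and the last step is taken separately; the recursion equations in general are
  \<open>SS_rec\<close> and \<open>rasp_rec\<close>.\<close>

definition SS_step ::
  "(('v, 'v) rmanifold \<Rightarrow> 'v set set) \<Rightarrow> ('p, 'v::real_vector) rmanifold \<Rightarrow> 'p set set" where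
  "SS_step F M =
     {X. X \<subseteq> points M \<and> X = ci (mtop M) X \<and>
        (\<forall>x\<in>X. let U = mtop (unit_sphere M x) in
           U closure_of (U interior_of conical_dirs M X x) = topspace U) \<and>
        (\<forall>x\<in>X. ci (mtop (unit_sphere M x)) (unit_tangents M x X) \<in> F (unit_sphere M x))}"

primrec SS_sphere :: "nat \<Rightarrow> ('v, 'v::real_vector) rmanifold \<Rightarrow> 'v set set" where
  "SS_sphere 0 M = Pow (points M)"
| "SS_sphere (Suc d) M = SS_step (SS_sphere d) M"

definition SS :: "nat \<Rightarrow> ('p, 'v::real_vector) rmanifold \<Rightarrow> 'p set set" where
  "SS d M = (case d of 0 \<Rightarrow> Pow (points M) | Suc d' \<Rightarrow> SS_step (SS_sphere d') M)"

lemma SS_rec: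
  fixes M :: "('p, 'v::real_vector) rmanifold"
  shows
  "SS 0 M = Pow (points M)"
  and "SS (Suc d) M = SS_step (SS d) M"
proof -
  have "SS_sphere d = (SS d :: ('v, 'v::real_vector) rmanifold \<Rightarrow> _)" for d
    by (rule ext) (cases d; simp add: SS_def)
  then show "SS (Suc d) M = SS_step (SS d) M"
    by (simp add: SS_def)
qed (simp add: SS_def)

text \<open>A tuple $(x; v_1, \dots, v_d)$ is represented by \<open>(x, [v\<^sub>1, \<dots>, v\<^sub>d])\<close>.\<close>

definition rasp_step ::
  "(('v, 'v) rmanifold \<Rightarrow> 'v set \<Rightarrow> ('v \<times> 'v list) set) \<Rightarrow>
     ('p, 'v::real_vector) rmanifold \<Rightarrow> 'p set \<Rightarrow> ('p \<times> 'v list) set" where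
  "rasp_step F M X =
     {(x, v # vs) | x v vs. x \<in> X \<and>
        (v, vs) \<in> F (unit_sphere M x) (ci (mtop (unit_sphere M x)) (unit_tangents M x X))}"

primrec rasp_sphere ::
  "nat \<Rightarrow> ('v, 'v::real_vector) rmanifold \<Rightarrow> 'v set \<Rightarrow> ('v \<times> 'v list) set" where
  "rasp_sphere 0 M = (\<lambda>X. X \<times> {[]})"
| "rasp_sphere (Suc d) M = rasp_step (rasp_sphere d) M"

definition rasp ::
  "nat \<Rightarrow> ('p, 'v::real_vector) rmanifold \<Rightarrow> 'p set \<Rightarrow> ('p \<times> 'v list) set" where
  "rasp d M X = (case d of 0 \<Rightarrow> X \<times> {[]} | Suc d' \<Rightarrow> rasp_step (rasp_sphere d') M X)"

lemma rasp_rec: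
  fixes M :: "('p, 'v::real_vector) rmanifold"
  shows
  "rasp 0 M X = X \<times> {[]}"
  and "rasp (Suc d) M X = rasp_step (rasp d) M X"
proof -
  have "rasp_sphere d = (rasp d :: ('v, 'v::real_vector) rmanifold \<Rightarrow> _)" for d
    by (intro ext) (cases d; simp add: rasp_def)
  then show "rasp (Suc d) M X = rasp_step (rasp d) M X"
    by (simp add: rasp_def)
qed (simp add: rasp_def)

end

theory Submission
  imports Defs
begin

text \<open>By induction on the dimension, everything reduces to the behaviour of \<open>U\<^sub>xX\<close> at a point
  \<open>x \<in> X \<inter> Y\<close>: with \<open>ci\<close> taken in \<open>U\<^sub>xM\<close>, the set \<open>ci (U\<^sub>x(X \<union> Y))\<close> has to be
  \<open>ci (U\<^sub>xX) \<union> ci (U\<^sub>xY)\<close>, and \<open>ci (U\<^sub>xX) \<inter> ci (U\<^sub>xY)\<close> has to have empty interior. By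
  condition (b), a dense open set of directions \<open>v\<close> has a cone whose exponential image lies
  inside or outside \<open>X\<close>, and likewise for \<open>Y\<close>. If it lies inside, all directions near \<open>v\<close> are
  tangent to \<open>X\<close> because of the radial geodesics; if it lies outside, \<open>v\<close> is not tangent to \<open>X\<close>,
  because a curve with velocity \<open>v\<close> runs into the exponential image of every cone around \<open>v\<close>.
  Finally such an image has nonempty interior, so it cannot lie in both \<open>X\<close> and \<open>Y\<close>.

  The last two facts need \<open>exp\<^sub>x\<close> to be a local homeomorphism in a strong sense at \<open>0\<close>. The cones
  are contained in the domain of \<open>exp\<^sub>x\<close> by definition, so no existence theorem for geodesics is
  involved: for initial velocities of size at most \<open>r\<close> the geodesic equation makes
  \<open>exp\<^sub>x - id\<close> Lipschitz with constant \<open>O(r)\<close> in a chart, and a contraction argument applies.\<close>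

text \<open>In general \<open>ci\<close> does not commute with unions: two sets with empty interior
  can have a union with interior points. The conical directions exclude this, since among them being
  tangent to \<open>X\<close> is an open condition. At a point of \<open>X\<close> outside
  \<open>Y\<close> the union is harmless, because \<open>Y = ci Y\<close> is closed and a curve from
  the point avoids it for a short time. That the two \<open>ci\<close> sets meet in a set without
  interior is exactly the hypothesis one dimension lower, so the induction closes once unit spheres
  satisfy the same axioms. Everything about \<open>exp_map\<close> rests on the geodesic equation
  being quadratic in the velocity. Accelerations are O(r^2) and vary by O(r) times the change of the
  initial data, so the error at distance t along \<open>v\<close> is small against the width of a
  cone around \<open>v\<close>, which is proportional to t. As the dimension varies during the
  induction, coordinates are sequences and estimates are made coordinate by coordinate in the
  maximum norm. The same Lipschitz estimate yields the uniqueness on which the definite description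
  in \<open>exp_map\<close> depends.\<close>

section \<open>Inner products on a subspace\<close>

text \<open>\<open>met M x\<close> is an inner product only on the subspace
  \<open>tangent M x\<close>, and the ambient type carries no norm; the locale supplies norm,
  Cauchy-Schwarz and orthonormal systems relative to \<open>T\<close>.\<close>

locale inner_subspace =
  fixes T :: "'v::real_vector set" and h :: "'v \<Rightarrow> 'v \<Rightarrow> real"
  assumes subspace: "subspace T"
    and linear: "\<lbrakk>u \<in> T; v \<in> T; w \<in> T\<rbrakk> \<Longrightarrow> h (a *\<^sub>R u + b *\<^sub>R v) w = a * h u w + b * h v w"
    and sym: "\<lbrakk>u \<in> T; w \<in> T\<rbrakk> \<Longrightarrow> h u w = h w u"
    and pos: "\<lbrakk>u \<in> T; u \<noteq> 0\<rbrakk> \<Longrightarrow> h u u > 0"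
begin

lemma closed [simp, intro]:
  "0 \<in> T" "u \<in> T \<Longrightarrow> w \<in> T \<Longrightarrow> u + w \<in> T" "u \<in> T \<Longrightarrow> w \<in> T \<Longrightarrow> u - w \<in> T"
  "u \<in> T \<Longrightarrow> a *\<^sub>R u \<in> T" "(\<And>i. i \<in> I \<Longrightarrow> f i \<in> T) \<Longrightarrow> sum f I \<in> T"
  using subspace by (auto intro: subspace_0 subspace_add subspace_diff subspace_scale subspace_sum)

lemma add_left: "\<lbrakk>u \<in> T; v \<in> T; w \<in> T\<rbrakk> \<Longrightarrow> h (u + v) w = h u w + h v w"
  using linear[of u v w 1 1] by simp

lemma diff_left: "\<lbrakk>u \<in> T; v \<in> T; w \<in> T\<rbrakk> \<Longrightarrow> h (u - v) w = h u w - h v w"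
  using linear[of u v w 1 "-1"] by simp

lemma scale_left: "\<lbrakk>u \<in> T; w \<in> T\<rbrakk> \<Longrightarrow> h (a *\<^sub>R u) w = a * h u w"
  using linear[of u u w a 0] by simp

lemma zero_left [simp]: "w \<in> T \<Longrightarrow> h 0 w = 0"
  using scale_left[of 0 w 0] by simp

lemma sum_left: "\<lbrakk>\<And>i. i \<in> I \<Longrightarrow> f i \<in> T; w \<in> T\<rbrakk> \<Longrightarrow> h (sum f I) w = (\<Sum>i\<in>I. h (f i) w)"
  by (induction I rule: infinite_finite_induct) (auto simp: add_left)

lemma add_right: "\<lbrakk>u \<in> T; v \<in> T; w \<in> T\<rbrakk> \<Longrightarrow> h w (u + v) = h w u + h w v"
  by (simp add: sym[of w] add_left)

lemma diff_right: "\<lbrakk>u \<in> T; v \<in> T; w \<in> T\<rbrakk> \<Longrightarrow> h w (u - v) = h w u - h w v"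
  by (simp add: sym[of w] diff_left)

lemma scale_right: "\<lbrakk>u \<in> T; w \<in> T\<rbrakk> \<Longrightarrow> h w (a *\<^sub>R u) = a * h w u"
  by (simp add: sym[of w] scale_left)

lemma zero_right [simp]: "w \<in> T \<Longrightarrow> h w 0 = 0"
  by (simp add: sym[of w])

lemma sum_right: "\<lbrakk>\<And>i. i \<in> I \<Longrightarrow> f i \<in> T; w \<in> T\<rbrakk> \<Longrightarrow> h w (sum f I) = (\<Sum>i\<in>I. h w (f i))"
  by (induction I rule: infinite_finite_induct) (auto simp: add_right)

lemmas expand = add_left diff_left scale_left add_right diff_right scale_right sum_left sum_right

lemma nonneg [simp]: "u \<in> T \<Longrightarrow> h u u \<ge> 0"
  using pos[of u] by (cases "u = 0") auto

lemma self_eq_0_iff: "u \<in> T \<Longrightarrow> h u u = 0 \<longleftrightarrow> u = 0"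
  by (metis closed(1) less_irrefl pos zero_left)

definition nrm :: "'v \<Rightarrow> real" where
  "nrm u = sqrt (h u u)"

lemma nrm_nonneg [simp]: "u \<in> T \<Longrightarrow> nrm u \<ge> 0"
  by (simp add: nrm_def)

lemma nrm_sq: "u \<in> T \<Longrightarrow> (nrm u)\<^sup>2 = h u u"
  by (simp add: nrm_def)

lemma nrm_eq_0_iff: "u \<in> T \<Longrightarrow> nrm u = 0 \<longleftrightarrow> u = 0"
  by (simp add: nrm_def self_eq_0_iff)

lemma Cauchy_Schwarz:
  assumes "u \<in> T" "w \<in> T"
  shows "\<bar>h u w\<bar> \<le> nrm u * nrm w"
proof (cases "w = 0")
  case False
  define a where "a = h u w / h w w"
  have w: "h w w > 0"
    using False assms pos by auto
  have "0 \<le> h (u - a *\<^sub>R w) (u - a *\<^sub>R w)"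
    using assms by (intro nonneg) auto
  also have "\<dots> = h u u - 2 * a * h u w + a * a * h w w"
    using assms by (simp add: expand sym[of w u] algebra_simps)
  also have "\<dots> = h u u - (h u w)\<^sup>2 / h w w"
    using w by (simp add: a_def field_simps power2_eq_square)
  finally have "(h u w)\<^sup>2 \<le> h u u * h w w"
    using w by (simp add: field_simps)
  then have "sqrt ((h u w)\<^sup>2) \<le> sqrt (h u u * h w w)"
    by (rule real_sqrt_le_mono)
  then show ?thesis
    by (simp add: nrm_def real_sqrt_mult)
qed (use assms in \<open>simp add: nrm_def\<close>)

lemma nrm_triangle:
  assumes "u \<in> T" "w \<in> T"
  shows "nrm (u + w) \<le> nrm u + nrm w"
proof (rule power2_le_imp_le)
  have "(nrm (u + w))\<^sup>2 = (nrm u)\<^sup>2 + 2 * h u w + (nrm w)\<^sup>2"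
    using assms by (simp add: nrm_sq expand sym[of w u])
  also have "\<dots> \<le> (nrm u + nrm w)\<^sup>2"
    using Cauchy_Schwarz[OF assms] by (simp add: power2_sum)
  finally show "(nrm (u + w))\<^sup>2 \<le> (nrm u + nrm w)\<^sup>2" .
qed (use assms in simp)

lemma nrm_scale: "u \<in> T \<Longrightarrow> nrm (a *\<^sub>R u) = \<bar>a\<bar> * nrm u"
  by (simp add: nrm_def expand real_sqrt_mult flip: mult.assoc)

lemma nrm_sum: "(\<And>i. i \<in> I \<Longrightarrow> f i \<in> T) \<Longrightarrow> nrm (sum f I) \<le> (\<Sum>i\<in>I. nrm (f i))"
proof (induction I rule: infinite_finite_induct)
  case (insert x F)
  then show ?case
    using nrm_triangle[of "f x" "sum f F"] by fastforce
qed (simp_all add: nrm_def)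

lemma nrm_minus_commute:
  assumes "u \<in> T" "w \<in> T"
  shows "nrm (u - w) = nrm (w - u)"
  using nrm_scale[of "u - w" "-1"] assms by simp

section \<open>Orthonormal sets, Gram-Schmidt, and expansion in an orthonormal basis\<close>

definition orthonormal :: "'v set \<Rightarrow> bool" where
  "orthonormal S \<longleftrightarrow> finite S \<and> S \<subseteq> T \<and> (\<forall>a\<in>S. \<forall>b\<in>S. h a b = (if a = b then 1 else 0))"

lemma orthonormal_coefficient:
  assumes "orthonormal S" "e \<in> S"
  shows "h (\<Sum>b\<in>S. c b *\<^sub>R b) e = c e"
proof -
  have "S \<subseteq> T" "e \<in> T" "finite S"
    using assms by (auto simp: orthonormal_def)
  then have "h (\<Sum>b\<in>S. c b *\<^sub>R b) e = (\<Sum>b\<in>S. c b * h b e)"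
    by (subst sum_left) (auto simp: subset_eq intro!: sum.cong scale_left)
  also have "\<dots> = (\<Sum>b\<in>S. if b = e then c b else 0)"
    using assms by (intro sum.cong) (auto simp: orthonormal_def)
  also have "\<dots> = c e"
    using \<open>finite S\<close> assms by simp
  finally show ?thesis .
qed

lemma orthonormal_independent:
  assumes "orthonormal S"
  shows "independent S"
proof (rule independent_if_scalars_zero)
  fix c e
  assume 0: "(\<Sum>b\<in>S. c b *\<^sub>R b) = 0" and e: "e \<in> S"
  then have "e \<in> T"
    using assms by (auto simp: orthonormal_def)
  then show "c e = 0"
    using orthonormal_coefficient[OF assms e, of c] 0 by simp
qed (use assms in \<open>simp add: orthonormal_def\<close>)

text \<open>Gram-Schmidt: subtracting the projection onto \<open>span S\<close> leaves a vector
  that, if nonzero, can be normalised and added to \<open>S\<close>.\<close>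

lemma orthonormal_residual:
  assumes "orthonormal S" "u \<in> T"
  defines "w \<equiv> u - (\<Sum>b\<in>S. h u b *\<^sub>R b)"
  shows "w \<in> T" "\<And>e. e \<in> S \<Longrightarrow> h w e = 0"
proof -
  have S: "S \<subseteq> T"
    using assms by (auto simp: orthonormal_def)
  then have sum: "(\<Sum>b\<in>S. h u b *\<^sub>R b) \<in> T"
    by blast
  then show "w \<in> T"
    using assms by auto
  fix e assume "e \<in> S"
  then show "h w e = 0"
    using S sum assms(2) orthonormal_coefficient[OF assms(1) \<open>e \<in> S\<close>, of "h u"]
    by (auto simp: w_def diff_left)
qed

lemma orthonormal_insert:
  assumes "orthonormal S" "w \<in> T" "w \<noteq> 0" "\<And>e. e \<in> S \<Longrightarrow> h w e = 0"
  defines "e \<equiv> (1 / nrm w) *\<^sub>R w"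
  shows "orthonormal (insert e S)" "e \<notin> S"
proof -
  have n: "nrm w > 0"
    using assms(2,3) nrm_eq_0_iff[of w] nrm_nonneg[of w] by linarith
  have "e \<in> T" "nrm e = 1"
    using assms(2) n by (auto simp: e_def nrm_scale)
  then have e: "e \<in> T" "h e e = 1"
    using nrm_sq[of e] by auto
  have S: "S \<subseteq> T"
    using assms(1) by (auto simp: orthonormal_def)
  have "h e b = 0" "h b e = 0" if "b \<in> S" for b
    using that S assms(2,4) by (auto simp: e_def expand sym[of b w] subset_eq)
  then show "orthonormal (insert e S)" "e \<notin> S"
    using e S assms(1) by (auto simp: orthonormal_def)
qed

end

locale finite_inner_subspace = inner_subspace T h
  for T :: "'v::real_vector set" and h :: "'v \<Rightarrow> 'v \<Rightarrow> real" +
  fixes n :: nat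
  assumes basis: "\<exists>B. finite B \<and> independent B \<and> span B = T \<and> card B = n"
begin

lemma orthonormal_card:
  assumes "orthonormal S"
  shows "card S \<le> n"
proof -
  obtain B where "finite B" "span B = T" "card B = n"
    using basis by blast
  then show ?thesis
    using independent_span_bound[of B S] orthonormal_independent[OF assms] assms
    by (auto simp: orthonormal_def)
qed

text \<open>A nonzero residual, normalised, would give an orthonormal set with \<open>n + 1\<close>
  elements, against \<open>orthonormal_card\<close>.\<close>

lemma orthonormal_complete:
  assumes "orthonormal S" "card S = n" "u \<in> T"
  shows "(\<Sum>b\<in>S. h u b *\<^sub>R b) = u"
proof (rule ccontr)
  define w where "w = u - (\<Sum>b\<in>S. h u b *\<^sub>R b)"
  assume "\<not> ?thesis"
  then have "w \<noteq> 0"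
    by (auto simp: w_def)
  moreover have "w \<in> T" "\<And>e. e \<in> S \<Longrightarrow> h w e = 0"
    using orthonormal_residual[OF assms(1,3)] by (auto simp: w_def)
  ultimately have "orthonormal (insert ((1 / nrm w) *\<^sub>R w) S)" "(1 / nrm w) *\<^sub>R w \<notin> S"
    using orthonormal_insert[OF assms(1)] by auto
  then show False
    using orthonormal_card[of "insert ((1 / nrm w) *\<^sub>R w) S"] assms(1,2)
    by (simp add: orthonormal_def)
qed

text \<open>While \<open>card S < n\<close>, the exchange lemma forbids that a basis of
  \<open>n\<close> vectors lies in \<open>span S\<close>; a basis vector outside has a nonzero
  residual, which extends \<open>S\<close>.\<close>

lemma orthonormal_extend:
  assumes "orthonormal S"
  shows "\<exists>S'. S \<subseteq> S' \<and> orthonormal S' \<and> card S' = n"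
  using assms
proof (induction "n - card S" arbitrary: S)
  case 0
  then show ?case
    using orthonormal_card[of S] by auto
next
  case (Suc m)
  obtain B where B: "finite B" "independent B" "span B = T" "card B = n"
    using basis by blast
  have "\<not> B \<subseteq> span S"
    using independent_span_bound[of S B] B Suc by (auto simp: orthonormal_def)
  then obtain u where u: "u \<in> B" "u \<notin> span S"
    by blast
  define w where "w = u - (\<Sum>b\<in>S. h u b *\<^sub>R b)"
  have "(\<Sum>b\<in>S. h u b *\<^sub>R b) \<in> span S"
    by (intro span_sum span_scale span_base)
  then have "w \<noteq> 0"
    using u by (auto simp: w_def)
  moreover have "w \<in> T" "\<And>e. e \<in> S \<Longrightarrow> h w e = 0"
    using orthonormal_residual[OF Suc.prems, of u] u B(3) span_base[of u B] by (auto simp: w_def)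
  ultimately have i: "orthonormal (insert ((1 / nrm w) *\<^sub>R w) S)" "(1 / nrm w) *\<^sub>R w \<notin> S"
    using orthonormal_insert[OF Suc.prems] by auto
  have "m = n - card (insert ((1 / nrm w) *\<^sub>R w) S)"
    using Suc i by (simp add: orthonormal_def)
  from Suc.hyps(1)[OF this i(1)] show ?case
    by blast
qed

text \<open>Expansion in an orthonormal basis and Cauchy-Schwarz. Applied to the coordinate
  functionals of a chart, this bounds coordinates by the norm.\<close>

lemma functional_bounded:
  assumes "\<And>u w a b. u \<in> T \<Longrightarrow> w \<in> T \<Longrightarrow> f (a *\<^sub>R u + b *\<^sub>R w) = a * f u + b * (f w :: real)"
  shows "\<exists>C\<ge>0. \<forall>u\<in>T. \<bar>f u\<bar> \<le> C * nrm u"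
proof -
  obtain S where S: "orthonormal S" "card S = n"
    using orthonormal_extend[of "{}"] by (auto simp: orthonormal_def)
  have ST: "S \<subseteq> T"
    using S by (auto simp: orthonormal_def)
  have f_sum: "f (\<Sum>b\<in>S'. c b *\<^sub>R b) = (\<Sum>b\<in>S'. c b * f b)" if "S' \<subseteq> T" "finite S'" for c S'
    using that(2,1)
  proof (induction S')
    case empty
    then show ?case
      using assms[of 0 0 0 0] by simp
  next
    case (insert x F)
    then have "(\<Sum>b\<in>F. c b *\<^sub>R b) \<in> T"
      by auto
    then show ?case
      using insert assms[of x "\<Sum>b\<in>F. c b *\<^sub>R b" "c x" 1] by auto
  qed
  have "\<bar>f u\<bar> \<le> (\<Sum>b\<in>S. \<bar>f b\<bar>) * nrm u" if u: "u \<in> T" for u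
  proof -
    have "f u = (\<Sum>b\<in>S. h u b * f b)"
      using f_sum[OF ST, of "h u"] orthonormal_complete[OF S u] S by (simp add: orthonormal_def)
    also have "\<bar>\<dots>\<bar> \<le> (\<Sum>b\<in>S. nrm u * \<bar>f b\<bar>)"
    proof (rule order_trans[OF sum_abs sum_mono])
      fix b assume b: "b \<in> S"
      then have "b \<in> T" "nrm b = 1"
        using S by (auto simp: orthonormal_def nrm_def)
      then show "\<bar>h u b * f b\<bar> \<le> nrm u * \<bar>f b\<bar>"
        using Cauchy_Schwarz[of u b] u by (auto simp: abs_mult intro!: mult_right_mono)
    qed
    finally show ?thesis
      by (simp add: sum_distrib_left mult.commute)
  qed
  then show ?thesis
    by (intro exI[of _ "\<Sum>b\<in>S. \<bar>f b\<bar>"]) (auto intro: sum_nonneg)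
qed

end

section \<open>Cubes and smooth functions\<close>

text \<open>Closed balls of the maximum norm, inside the sequences vanishing from \<open>d\<close>
  on. They are compact, and estimates on them can be made one coordinate at a time.\<close>

definition cube :: "nat \<Rightarrow> (nat \<Rightarrow> real) \<Rightarrow> real \<Rightarrow> (nat \<Rightarrow> real) set" where
  "cube d a r = {y. (\<forall>i<d. \<bar>y i - a i\<bar> \<le> r) \<and> (\<forall>i\<ge>d. y i = 0)}"

lemma Euclidean_space_top_of_set: "Euclidean_space d = top_of_set {y. \<forall>i\<ge>d. y i = 0}"
  by (simp add: Euclidean_space_def euclidean_product_topology)

lemma cube_mono: "r \<le> r' \<Longrightarrow> cube d a r \<subseteq> cube d a r'"
  by (auto simp: cube_def intro: order_trans)

lemma open_cube_openin:
  "openin (Euclidean_space d) {y. (\<forall>i<d. \<bar>y i - a i\<bar> < r) \<and> (\<forall>i\<ge>d. y i = 0)}"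
proof -
  define P where "P = (\<Pi>\<^sub>E i\<in>UNIV. if i < d then {a i - r<..<a i + r} else UNIV)"
  have "open P"
    unfolding P_def by (rule open_PiE) (auto intro: finite_subset[of _ "{..<d}"])
  have mem: "y \<in> P \<longleftrightarrow> (\<forall>i<d. \<bar>y i - a i\<bar> < r)" for y
  proof -
    have "y i \<in> (if i < d then {a i - r<..<a i + r} else UNIV) \<longleftrightarrow> (i < d \<longrightarrow> \<bar>y i - a i\<bar> < r)" for i
      by (auto simp: abs_less_iff)
    then show ?thesis
      by (simp add: P_def PiE_UNIV_domain Pi_iff)
  qed
  have "{y. (\<forall>i<d. \<bar>y i - a i\<bar> < r) \<and> (\<forall>i\<ge>d. y i = 0)} = {y. \<forall>i\<ge>d. y i = 0} \<inter> P"
    unfolding set_eq_iff Int_iff mem mem_Collect_eq by (simp add: conj_commute)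
  then show ?thesis
    using \<open>open P\<close> by (simp add: Euclidean_space_top_of_set openin_open_Int)
qed

lemma cube_subset_openin:
  assumes "openin (Euclidean_space d) V" "a \<in> V"
  shows "\<exists>r>0. cube d a r \<subseteq> V"
proof -
  obtain U where U: "open U" "V = U \<inter> {y. \<forall>i\<ge>d. y i = 0}"
    using assms(1) unfolding Euclidean_space_top_of_set openin_open by blast
  then obtain X where X: "a \<in> Pi\<^sub>E UNIV X" "\<And>i. open (X i)" "Pi\<^sub>E UNIV X \<subseteq> U"
    using product_topology_open_contains_basis[of "\<lambda>i::nat. euclideanreal" UNIV U a] assms(2)
    by (auto simp: open_fun_def)
  have "\<forall>i. \<exists>e>0. cball (a i) e \<subseteq> X i"
    using X by (intro allI) (auto simp: open_contains_cball PiE_UNIV_domain)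
  then obtain e where e: "\<And>i. e i > 0" "\<And>i. cball (a i) (e i) \<subseteq> X i"
    by metis
  \<comment> \<open>Coordinates from \<open>d\<close> on are fixed to 0 and impose no condition on
    \<open>r\<close>; the 1 keeps the minimum defined for \<open>d = 0\<close>.\<close>
  define r where "r = Min (insert 1 (e ` {..<d}))"
  have "r > 0" "\<And>i. i < d \<Longrightarrow> r \<le> e i"
    using e(1) by (auto simp: r_def)
  moreover have "cube d a r \<subseteq> V"
  proof
    fix y assume y: "y \<in> cube d a r"
    have "y i \<in> X i" for i
    proof (cases "i < d")
      case True
      then have "\<bar>y i - a i\<bar> \<le> e i"
        using y calculation(2)[of i] by (auto simp: cube_def intro: order_trans)
      then show ?thesis
        using e(2)[of i] by (auto simp: dist_real_def abs_minus_commute)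
    next
      case False
      then have "y i = a i"
        using y assms U by (auto simp: cube_def)
      then show ?thesis
        using X(1) by auto
    qed
    then show "y \<in> V"
      using X U y by (auto simp: cube_def)
  qed
  ultimately show ?thesis
    by blast
qed

lemma compactin_cube: "compactin (Euclidean_space d) (cube d a r)"
proof -
  have "compactin (powertop_real UNIV) (\<Pi>\<^sub>E i\<in>UNIV. if i < d then {a i - r..a i + r} else {0})"
    by (auto simp: compactin_PiE)
  moreover have "cube d a r = (\<Pi>\<^sub>E i\<in>UNIV. if i < d then {a i - r..a i + r} else {0})"
  proof -
    have *: "y i \<in> (if i < d then {a i - r..a i + r} else {0}) \<longleftrightarrow>
        (i < d \<longrightarrow> \<bar>y i - a i\<bar> \<le> r) \<and> (i \<ge> d \<longrightarrow> y i = 0)" for i and y :: "nat \<Rightarrow> real"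
      by (auto simp: abs_le_iff)
    show ?thesis
      unfolding PiE_UNIV_domain Pi_iff cube_def set_eq_iff * by blast
  qed
  ultimately show ?thesis
    by (auto simp: Euclidean_space_def compactin_subtopology cube_def)
qed

section \<open>Local bounds and Lipschitz constants for smooth functions\<close>

lemma smooth_fun_continuous:
  "smooth_fun d V f \<Longrightarrow> continuous_map (subtopology (Euclidean_space d) V) euclideanreal f"
  unfolding smooth_fun_def by (metis empty_iff empty_subsetI foldr_Nil id_apply list.set(1) part_derivs_def)

lemma smooth_fun_part_deriv:
  assumes "smooth_fun d V f" "i < d"
  shows "smooth_fun d V (part_deriv i f)"
proof -
  have "part_derivs is (part_deriv i f) = part_derivs (is @ [i]) f" for "is"
    by (simp add: part_derivs_def)
  then show ?thesis
    using assms by (auto simp: smooth_fun_def)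
qed

lemma smooth_fun_has_derivative:
  assumes "smooth_fun d V f" "y \<in> V" "i < d"
  shows "((\<lambda>t. f (y(i := t))) has_real_derivative part_deriv i f y) (at (y i))"
proof -
  have "(\<lambda>t. part_derivs [] f (y(i := t))) field_differentiable (at (y i))"
    using assms unfolding smooth_fun_def by (metis empty_subsetI list.set(1))
  then show ?thesis
    by (simp add: part_derivs_def part_deriv_def DERIV_deriv_iff_field_differentiable)
qed

lemma continuous_locally_close:
  assumes "continuous_map (subtopology (Euclidean_space d) V) euclideanreal f"
    and "openin (Euclidean_space d) V" "a \<in> V" "e > 0"
  shows "\<exists>r>0. cube d a r \<subseteq> V \<and> (\<forall>y\<in>cube d a r. \<bar>f y - f a\<bar> < e)"
proof -
  have V: "V \<subseteq> topspace (Euclidean_space d)"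
    using assms(2) openin_subset by blast
  have "openin (subtopology (Euclidean_space d) V)
      {y \<in> topspace (subtopology (Euclidean_space d) V). f y \<in> ball (f a) e}"
    using assms(1) by (rule openin_continuous_map_preimage) auto
  then have "openin (Euclidean_space d) {y \<in> V. \<bar>f y - f a\<bar> < e}"
    using V assms(2)
    by (simp add: openin_open_subtopology dist_real_def abs_minus_commute Int_absorb1 flip: Int_iff)
  from cube_subset_openin[OF this, of a] show ?thesis
    using assms by (auto simp: subset_eq)
qed

text \<open>From \<open>y\<close> to \<open>z\<close> one coordinate is changed at a time. The
  \<open>d\<close> axis-parallel segments stay in the cube, and on each of them the mean value
  theorem gives a change of at most \<open>C * m\<close>.\<close>

lemma cube_Lipschitz:
  assumes f: "smooth_fun d V f" and V: "cube d a r \<subseteq> V"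
    and C: "\<And>y i. \<lbrakk>y \<in> cube d a r; i < d\<rbrakk> \<Longrightarrow> \<bar>part_deriv i f y\<bar> \<le> C"
    and y: "y \<in> cube d a r" "z \<in> cube d a r" and m: "\<And>i. i < d \<Longrightarrow> \<bar>z i - y i\<bar> \<le> m"
  shows "\<bar>f z - f y\<bar> \<le> d * (C * m)"
proof -
  define w where "w k = (\<lambda>i. if i < k then z i else y i)" for k
  have w_upd: "w (Suc k) = (w k)(k := z k)" "w k = (w k)(k := y k)" for k
    by (auto simp: w_def)
  have "\<bar>f (w k) - f y\<bar> \<le> k * (C * m)" if "k \<le> d" for k
    using that
  proof (induction k)
    case 0
    then show ?case
      by (simp add: w_def)
  next
    case (Suc k)
    then have k: "k < d"
      by simp
    have "norm (f ((w k)(k := z k)) - f ((w k)(k := y k))) \<le> C * norm (z k - y k)"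
    proof (rule field_differentiable_bound)
      fix t assume t: "t \<in> closed_segment (z k) (y k)"
      have "\<bar>t - a k\<bar> \<le> r"
        using t y k by (auto simp: cube_def closed_segment_eq_real_ivl split: if_splits)
          (smt (verit))+
      then have c: "(w k)(k := t) \<in> cube d a r"
        using y k by (auto simp: cube_def w_def)
      then show "norm (part_deriv k f ((w k)(k := t))) \<le> C"
        using C k by auto
      show "((\<lambda>t. f ((w k)(k := t))) has_real_derivative part_deriv k f ((w k)(k := t)))
          (at t within closed_segment (z k) (y k))"
        using smooth_fun_has_derivative[OF f _ k, of "(w k)(k := t)"] c V
        by (auto intro: has_field_derivative_at_within)
    qed auto
    also have "\<dots> \<le> C * m"
      using m[OF k] C[OF y(1) k] by (intro mult_left_mono) auto
    finally have "\<bar>f (w (Suc k)) - f (w k)\<bar> \<le> C * m"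
      using w_upd[of k] by (metis real_norm_def)
    moreover have "\<bar>f (w k) - f y\<bar> \<le> k * (C * m)"
      using Suc by simp
    ultimately show ?case
      by (simp add: algebra_simps)
  qed
  moreover have "w d = z"
    using y by (auto simp: w_def cube_def)
  ultimately show ?thesis
    by (metis order_refl)
qed

text \<open>By continuity the first partial derivatives near \<open>a\<close> differ by less than 1
  from their values at \<open>a\<close>, which gives the bound for \<open>cube_Lipschitz\<close>. A
  single \<open>L\<close> serves as bound and as Lipschitz constant, so that later estimates carry
  only one constant.\<close>

lemma smooth_fun_locally_Lipschitz:
  assumes f: "smooth_fun d V f" and V: "openin (Euclidean_space d) V" "a \<in> V"
  shows "\<exists>r>0. \<exists>L\<ge>0. cube d a r \<subseteq> V \<and> (\<forall>y\<in>cube d a r. \<bar>f y\<bar> \<le> L \<and>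
    (\<forall>z\<in>cube d a r. \<forall>m\<ge>0. (\<forall>i<d. \<bar>z i - y i\<bar> \<le> m) \<longrightarrow> \<bar>f z - f y\<bar> \<le> L * m))"
proof -
  obtain r0 where r0: "r0 > 0" "cube d a r0 \<subseteq> V" "\<And>y. y \<in> cube d a r0 \<Longrightarrow> \<bar>f y - f a\<bar> < 1"
    using continuous_locally_close[OF smooth_fun_continuous[OF f] V, of 1] by auto
  have "\<forall>i\<in>{..<d}. \<exists>r>0. \<forall>y\<in>cube d a r. \<bar>part_deriv i f y - part_deriv i f a\<bar> < 1"
    using continuous_locally_close[OF smooth_fun_continuous[OF smooth_fun_part_deriv[OF f]] V, of _ 1]
    by simp blast
  then obtain r1 where r1: "\<And>i. i < d \<Longrightarrow> r1 i > 0"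
    "\<And>i y. \<lbrakk>i < d; y \<in> cube d a (r1 i)\<rbrakk> \<Longrightarrow> \<bar>part_deriv i f y - part_deriv i f a\<bar> < 1"
    by (metis lessThan_iff)
  define r where "r = Min (insert r0 (r1 ` {..<d}))"
  have r: "r > 0" "r \<le> r0" "\<And>i. i < d \<Longrightarrow> r \<le> r1 i"
    using r0(1) r1(1) by (auto simp: r_def)
  define C where "C = 1 + (\<Sum>i<d. \<bar>part_deriv i f a\<bar>)"
  have C: "\<bar>part_deriv i f y\<bar> \<le> C" if "y \<in> cube d a r" "i < d" for y i
  proof -
    have "\<bar>part_deriv i f y - part_deriv i f a\<bar> < 1"
      using that r1(2) cube_mono[OF r(3)] by blast
    moreover have "\<bar>part_deriv i f a\<bar> \<le> (\<Sum>i<d. \<bar>part_deriv i f a\<bar>)"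
      using that by (intro member_le_sum) auto
    ultimately show ?thesis
      by (simp add: C_def)
  qed
  have C0: "C \<ge> 0"
    by (auto simp: C_def intro!: add_nonneg_nonneg sum_nonneg)
  define L where "L = d * C + (1 + \<bar>f a\<bar>)"
  have L: "L \<ge> 0" "d * C \<le> L"
    using C0 by (auto simp: L_def)
  have V': "cube d a r \<subseteq> V"
    using r0 cube_mono[OF r(2)] by blast
  show ?thesis
  proof (intro exI conjI ballI allI impI)
    fix y assume y: "y \<in> cube d a r"
    have "\<bar>f y - f a\<bar> < 1"
      using y r0(3) cube_mono[OF r(2)] by blast
    moreover have "0 \<le> d * C"
      using C0 by simp
    ultimately show "\<bar>f y\<bar> \<le> L"
      unfolding L_def by linarith
    fix z and m :: real assume z: "z \<in> cube d a r" and m0: "m \<ge> 0" and m: "\<forall>i<d. \<bar>z i - y i\<bar> \<le> m"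
    have *: "\<bar>f z - f y\<bar> \<le> d * (C * m)"
      using m by (intro cube_Lipschitz[OF f V' C y z]) auto
    show "\<bar>f z - f y\<bar> \<le> L * m"
      using * mult_right_mono[OF L(2) m0] by (simp add: mult.assoc)
  qed (use r L V' in auto)
qed

section \<open>Estimates for the geodesic equation\<close>

lemma mean_value_bound:
  fixes f :: "real \<Rightarrow> real"
  assumes "\<And>t. t \<in> {0..T} \<Longrightarrow> (f has_real_derivative f' t) (at t within {0..T})"
    and "\<And>t. t \<in> {0..T} \<Longrightarrow> \<bar>f' t\<bar> \<le> K" and "t \<in> {0..T}"
  shows "\<bar>f t - f 0\<bar> \<le> K * t"
  using field_differentiable_bound[of "{0..T}" f f' K t 0] assms by auto

text \<open>The geodesic equation in one chart, stripped of the manifold: \<open>g\<close> stands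
  for \<open>met_coeff\<close>, \<open>G\<close> for \<open>christoffel\<close>. The uniform
  positive definiteness \<open>coercive\<close> replaces the inverse matrix of \<open>g\<close>, so
  the index never has to be raised.\<close>

locale geodesic_system =
  fixes d :: nat and B :: "(nat \<Rightarrow> real) set"
    and g :: "nat \<Rightarrow> nat \<Rightarrow> (nat \<Rightarrow> real) \<Rightarrow> real"
    and G :: "nat \<Rightarrow> nat \<Rightarrow> nat \<Rightarrow> (nat \<Rightarrow> real) \<Rightarrow> real" and L lam :: real
  assumes L_nonneg: "L \<ge> 0" and lam_pos: "lam > 0"
    and g_Lipschitz: "\<lbrakk>y \<in> B; z \<in> B; m \<ge> 0; \<forall>i<d. \<bar>z i - y i\<bar> \<le> m; l < d; k < d\<rbrakk> \<Longrightarrow>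
      \<bar>g l k z - g l k y\<bar> \<le> L * m"
    and G_bound: "\<lbrakk>y \<in> B; l < d; i < d; j < d\<rbrakk> \<Longrightarrow> \<bar>G l i j y\<bar> \<le> L"
    and G_Lipschitz: "\<lbrakk>y \<in> B; z \<in> B; m \<ge> 0; \<forall>i<d. \<bar>z i - y i\<bar> \<le> m; l < d; i < d; j < d\<rbrakk> \<Longrightarrow>
      \<bar>G l i j z - G l i j y\<bar> \<le> L * m"
    and coercive: "y \<in> B \<Longrightarrow>
      lam * (\<Sum>k<d. (q k)\<^sup>2) \<le> (\<Sum>l<d. \<Sum>k<d. g l k y * q l * q k)"
begin

definition geo_eq :: "(nat \<Rightarrow> real) \<Rightarrow> (nat \<Rightarrow> real) \<Rightarrow> (nat \<Rightarrow> real) \<Rightarrow> bool" where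
  "geo_eq y p q \<longleftrightarrow>
     (\<forall>l<d. (\<Sum>k<d. g l k y * q k) + (\<Sum>i<d. \<Sum>j<d. G l i j y * p i * p j) = 0)"

text \<open>The vector \<open>g q\<close> is tested against \<open>q\<close> itself: with
  \<open>S\<close> the sum of the \<open>\<bar>q l\<bar>\<close>, coercivity and Cauchy-Schwarz give
  \<open>lam * S^2 \<le> S * R * d\<close>, and one factor \<open>S\<close> cancels.\<close>

lemma solve_bound:
  assumes "y \<in> B" and R: "\<And>l. l < d \<Longrightarrow> \<bar>\<Sum>k<d. g l k y * q k\<bar> \<le> R" and "k < d"
  shows "\<bar>q k\<bar> \<le> d / lam * R"
proof -
  define S where "S = (\<Sum>l<d. \<bar>q l\<bar>)"
  have S: "0 \<le> S" "\<bar>q k\<bar> \<le> S"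
    unfolding S_def using \<open>k < d\<close> by (auto intro!: sum_nonneg member_le_sum)
  have R0: "R \<ge> 0"
    using R[OF \<open>k < d\<close>] by linarith
  have "lam * (\<Sum>k<d. (q k)\<^sup>2) \<le> (\<Sum>l<d. q l * (\<Sum>k<d. g l k y * q k))"
    using coercive[OF assms(1), of q] by (simp add: sum_distrib_left mult_ac)
  also have "\<dots> \<le> (\<Sum>l<d. \<bar>q l\<bar> * R)"
  proof (rule sum_mono)
    fix l assume "l \<in> {..<d}"
    have "q l * (\<Sum>k<d. g l k y * q k) \<le> \<bar>q l\<bar> * \<bar>\<Sum>k<d. g l k y * q k\<bar>"
      by (metis abs_ge_self abs_mult)
    also have "\<dots> \<le> \<bar>q l\<bar> * R"
      using R \<open>l \<in> {..<d}\<close> by (intro mult_left_mono) auto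
    finally show "q l * (\<Sum>k<d. g l k y * q k) \<le> \<bar>q l\<bar> * R" .
  qed
  also have "\<dots> = S * R"
    by (simp add: S_def sum_distrib_right)
  finally have 1: "lam * (\<Sum>k<d. (q k)\<^sup>2) \<le> S * R" .
  have "S\<^sup>2 \<le> (\<Sum>k<d. (q k)\<^sup>2) * d"
    using sum_squared_le_sum_of_squares[of "\<lambda>l. \<bar>q l\<bar>" "{..<d}"] by (simp add: S_def)
  then have "lam * S\<^sup>2 \<le> lam * ((\<Sum>k<d. (q k)\<^sup>2) * d)"
    using lam_pos by simp
  also have "\<dots> \<le> S * R * d"
    using mult_right_mono[OF 1, of "real d"] by (simp add: mult_ac)
  finally have 2: "S * (lam * S) \<le> S * (d * R)"
    by (simp add: power2_eq_square mult_ac)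
  have "S \<le> d / lam * R"
  proof (cases "S = 0")
    case True
    then show ?thesis
      using R0 lam_pos by simp
  next
    case False
    then have "lam * S \<le> d * R"
      using 2 S(1) by simp
    then show ?thesis
      using lam_pos by (simp add: field_simps)
  qed
  then show ?thesis
    using S by linarith
qed

text \<open>The quadratic part of the geodesic equation consists of \<open>d * d\<close> products of
  size at most \<open>L * P^2\<close>; \<open>solve_bound\<close> turns this into the acceleration
  bound \<open>K1 * P^2\<close>.\<close>

definition K1 :: real where "K1 = d / lam * (d * (d * L))"

text \<open>In the difference of two equations each product \<open>G * p * p\<close> can vary in any
  of its three factors, hence \<open>3 * L\<close>; the summand with \<open>L * K1\<close> is the
  variation of \<open>g\<close>, multiplied by an acceleration bounded through
  \<open>K1\<close>.\<close>

definition K2 :: real where "K2 = d / lam * (d * (d * (3 * L)) + d * (L * K1))"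

lemma K_nonneg: "K1 \<ge> 0" "K2 \<ge> 0"
  using L_nonneg lam_pos by (auto simp: K1_def K2_def)

lemma double_sum_bound:
  fixes f :: "nat \<Rightarrow> nat \<Rightarrow> real" and R :: real
  assumes "\<And>i j. \<lbrakk>i < d; j < d\<rbrakk> \<Longrightarrow> \<bar>f i j\<bar> \<le> R"
  shows "\<bar>\<Sum>i<d. \<Sum>j<d. f i j\<bar> \<le> d * (d * R)"
proof -
  have "\<bar>\<Sum>j<d. f i j\<bar> \<le> d * R" if "i < d" for i
    using sum_norm_bound[of "{..<d}" "f i" R] assms[OF that] by simp
  then show ?thesis
    using sum_norm_bound[of "{..<d}" "\<lambda>i. \<Sum>j<d. f i j" "d * R"] by simp
qed

lemma acceleration_bound:
  assumes "geo_eq y p q" "y \<in> B" "P \<ge> 0" and p: "\<And>i. i < d \<Longrightarrow> \<bar>p i\<bar> \<le> P" and "k < d"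
  shows "\<bar>q k\<bar> \<le> K1 * P\<^sup>2"
proof -
  have "\<bar>\<Sum>k<d. g l k y * q k\<bar> \<le> d * (d * (L * P\<^sup>2))" if "l < d" for l
  proof -
    have "\<bar>G l i j y * p i * p j\<bar> \<le> L * P * P" if "i < d" "j < d" for i j
      unfolding abs_mult using G_bound[OF \<open>y \<in> B\<close> \<open>l < d\<close> that] p that \<open>P \<ge> 0\<close> L_nonneg
      by (intro mult_mono) auto
    then have "\<bar>\<Sum>i<d. \<Sum>j<d. G l i j y * p i * p j\<bar> \<le> d * (d * (L * P * P))"
      by (rule double_sum_bound)
    moreover have "(\<Sum>k<d. g l k y * q k) = - (\<Sum>i<d. \<Sum>j<d. G l i j y * p i * p j)"
      using assms(1) that by (simp add: geo_eq_def add_eq_0_iff2)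
    ultimately show ?thesis
      by (simp add: power2_eq_square mult.assoc)
  qed
  from solve_bound[OF \<open>y \<in> B\<close> this \<open>k < d\<close>] show ?thesis
    by (simp add: K1_def mult.assoc)
qed

text \<open>Every term of the difference keeps at least one factor bounded by \<open>P\<close>,
  because the equation is quadratic in the velocity. This factor later makes \<open>exp_map\<close>
  minus the identity contractive near 0.\<close>

lemma acceleration_Lipschitz:
  assumes eq: "geo_eq y p q" "geo_eq y' p' q'" and B: "y \<in> B" "y' \<in> B" and P: "0 \<le> P" "P \<le> 1"
    and p: "\<And>i. i < d \<Longrightarrow> \<bar>p i\<bar> \<le> P" "\<And>i. i < d \<Longrightarrow> \<bar>p' i\<bar> \<le> P" and m: "m \<ge> 0"
    and y: "\<And>i. i < d \<Longrightarrow> \<bar>y i - y' i\<bar> \<le> m" and pp: "\<And>i. i < d \<Longrightarrow> \<bar>p i - p' i\<bar> \<le> m"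
    and "k < d"
  shows "\<bar>q k - q' k\<bar> \<le> K2 * P * m"
proof -
  have PP: "P * P \<le> P"
    using P by (simp add: mult_left_le)
  have "\<bar>\<Sum>k<d. g l k y * (q k - q' k)\<bar> \<le> d * (d * (3 * L * P * m)) + d * (L * K1 * P * m)"
    if l: "l < d" for l
  proof -
    have 1: "\<bar>G l i j y * p i * p j - G l i j y' * p' i * p' j\<bar> \<le> 3 * L * P * m"
      if ij: "i < d" "j < d" for i j
    proof -
      have "G l i j y * p i * p j - G l i j y' * p' i * p' j =
          (G l i j y - G l i j y') * p i * p j + G l i j y' * p i * (p j - p' j)
            + G l i j y' * (p i - p' i) * p' j"
        by (simp add: algebra_simps)
      then have "\<bar>G l i j y * p i * p j - G l i j y' * p' i * p' j\<bar> \<le> \<bar>(G l i j y - G l i j y') * p i * p j\<bar> + \<bar>G l i j y' * p i * (p j - p' j)\<bar>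
            + \<bar>G l i j y' * (p i - p' i) * p' j\<bar>"
        by linarith
      also have "\<dots> \<le> (L * m) * P * P + L * P * m + L * m * P"
        unfolding abs_mult
        using ij l p pp G_bound[OF B(2) l ij] G_Lipschitz[OF B(2,1) m _ l ij] y P m L_nonneg
        by (intro add_mono mult_mono) auto
      also have "\<dots> \<le> 3 * L * P * m"
        using mult_left_mono[OF PP, of "L * m"] L_nonneg m by (simp add: algebra_simps)
      finally show ?thesis .
    qed
    have 2: "\<bar>(g l k y' - g l k y) * q' k\<bar> \<le> L * K1 * P * m" if k: "k < d" for k
    proof -
      have "\<bar>(g l k y' - g l k y) * q' k\<bar> \<le> (L * m) * (K1 * P\<^sup>2)"
        unfolding abs_mult
        using g_Lipschitz[OF B m _ l k] y acceleration_bound[OF eq(2) B(2) P(1) p(2) k] L_nonneg m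
        by (intro mult_mono) (auto simp: abs_minus_commute)
      also have "\<dots> \<le> (L * m) * (K1 * P)"
        using PP K_nonneg L_nonneg m by (intro mult_left_mono) (auto simp: power2_eq_square)
      finally show ?thesis
        by (simp add: mult_ac)
    qed
    \<comment> \<open>The matrix is frozen at \<open>y\<close>, so that \<open>solve_bound\<close>
      applies to the vector \<open>q - q'\<close>; the price is the last sum.\<close>
    have "(\<Sum>k<d. g l k y * (q k - q' k)) =
        (\<Sum>k<d. g l k y * q k) - (\<Sum>k<d. g l k y' * q' k) + (\<Sum>k<d. (g l k y' - g l k y) * q' k)"
      by (simp add: algebra_simps sum.distrib sum_subtractf)
    also have "\<dots> = - (\<Sum>i<d. \<Sum>j<d. G l i j y * p i * p j - G l i j y' * p' i * p' j)
        + (\<Sum>k<d. (g l k y' - g l k y) * q' k)"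
      using eq l by (simp add: geo_eq_def add_eq_0_iff2 sum_subtractf)
    finally have "\<bar>\<Sum>k<d. g l k y * (q k - q' k)\<bar> \<le> \<bar>\<Sum>i<d. \<Sum>j<d. G l i j y * p i * p j - G l i j y' * p' i * p' j\<bar>
        + \<bar>\<Sum>k<d. (g l k y' - g l k y) * q' k\<bar>"
      by linarith
    also have "\<dots> \<le> d * (d * (3 * L * P * m)) + d * (L * K1 * P * m)"
      using double_sum_bound[OF 1] sum_norm_bound[of "{..<d}" "\<lambda>k. (g l k y' - g l k y) * q' k"] 2
      by (intro add_mono) auto
    finally show ?thesis .
  qed
  from solve_bound[OF B(1) this \<open>k < d\<close>] show ?thesis
    by (simp add: K2_def algebra_simps)
qed

text \<open>\<open>c\<close>, \<open>c1\<close>, \<open>c2\<close> are position, velocity and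
  acceleration. Confinement to \<open>B\<close> and the speed bound \<open>P\<close> belong to the
  notion; for exponential curves they are established in \<open>exp_curve_solution\<close>.\<close>

definition solution ::
  "real \<Rightarrow> real \<Rightarrow> (nat \<Rightarrow> real \<Rightarrow> real) \<Rightarrow> (nat \<Rightarrow> real \<Rightarrow> real) \<Rightarrow> (nat \<Rightarrow> real \<Rightarrow> real) \<Rightarrow> bool" where
  "solution T P c c1 c2 \<longleftrightarrow> (\<forall>t\<in>{0..T}. (\<lambda>i. c i t) \<in> B \<and>
     (\<forall>i<d. \<bar>c1 i t\<bar> \<le> P \<and> (c i has_real_derivative c1 i t) (at t within {0..T}) \<and>
       (c1 i has_real_derivative c2 i t) (at t within {0..T})) \<and>
     geo_eq (\<lambda>i. c i t) (\<lambda>i. c1 i t) (\<lambda>i. c2 i t))"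

lemma solution_velocity:
  assumes "solution T P c c1 c2" "P \<ge> 0" "T \<le> 1" "t \<in> {0..T}" "i < d"
  shows "\<bar>c1 i t - c1 i 0\<bar> \<le> K1 * P\<^sup>2"
proof -
  have "\<bar>c1 i t - c1 i 0\<bar> \<le> K1 * P\<^sup>2 * t"
  proof (rule mean_value_bound)
    fix t assume t: "t \<in> {0..T}"
    then show "(c1 i has_real_derivative c2 i t) (at t within {0..T})"
      using assms by (auto simp: solution_def)
    have "geo_eq (\<lambda>i. c i t) (\<lambda>i. c1 i t) (\<lambda>i. c2 i t)" "(\<lambda>i. c i t) \<in> B"
      "\<And>i. i < d \<Longrightarrow> \<bar>c1 i t\<bar> \<le> P"
      using assms t by (auto simp: solution_def)
    from acceleration_bound[OF this(1,2) \<open>P \<ge> 0\<close> this(3) \<open>i < d\<close>] show "\<bar>c2 i t\<bar> \<le> K1 * P\<^sup>2" .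
  qed fact
  also have "\<dots> \<le> K1 * P\<^sup>2"
    using K_nonneg assms by (intro mult_left_le) auto
  finally show ?thesis .
qed

lemma solution_position:
  assumes "solution T P c c1 c2" "t \<in> {0..T}" "i < d"
  shows "\<bar>c i t - c i 0\<bar> \<le> P * t"
  using assms by (intro mean_value_bound[of T _ "c1 i"]) (auto simp: solution_def)

text \<open>Comparison with uniform motion, since the velocity deviates from its initial value by at
  most \<open>K1 * P^2\<close>. For exponential curves this makes \<open>exp_map\<close> a
  translation in coordinates up to a quadratic error.\<close>

lemma solution_endpoint:
  assumes "solution 1 P c c1 c2" "P \<ge> 0" "i < d"
  shows "\<bar>c i 1 - c i 0 - c1 i 0\<bar> \<le> K1 * P\<^sup>2"
proof -
  have "\<bar>(c i 1 - c1 i 0 * 1) - (c i 0 - c1 i 0 * 0)\<bar> \<le> K1 * P\<^sup>2 * 1"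
  proof (rule mean_value_bound)
    fix t :: real assume t: "t \<in> {0..1}"
    then show "((\<lambda>t. c i t - c1 i 0 * t) has_real_derivative c1 i t - c1 i 0) (at t within {0..1})"
      using assms by (auto simp: solution_def intro!: derivative_eq_intros)
    show "\<bar>c1 i t - c1 i 0\<bar> \<le> K1 * P\<^sup>2"
      using solution_velocity[OF assms(1,2) _ t assms(3)] by simp
  qed simp
  then show ?thesis
    by (simp add: algebra_simps)
qed

text \<open>Absorption in place of a Gronwall argument: with \<open>D\<close> the supremum of the
  velocity differences, positions also differ by at most \<open>D\<close>, as they start equal and
  run for time 1. Hence \<open>D \<le> m + K2 * P * D \<le> m + D / 2\<close>, so
  \<open>D \<le> 2 * m\<close>. In terms of \<open>exp_map\<close>: its difference from the identity
  has Lipschitz constant \<open>2 * K2 * P\<close>.\<close>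

lemma solution_difference:
  assumes sol: "solution 1 P c c1 c2" "solution 1 P e e1 e2"
    and P: "0 \<le> P" "P \<le> 1" "K2 * P \<le> 1 / 2"
    and init: "\<And>i. i < d \<Longrightarrow> c i 0 = e i 0" "\<And>i. i < d \<Longrightarrow> \<bar>c1 i 0 - e1 i 0\<bar> \<le> m"
    and "i < d"
  shows "\<bar>(c i 1 - e i 1) - (c1 i 0 - e1 i 0)\<bar> \<le> 2 * K2 * P * m"
proof -
  define Z where "Z = (\<lambda>(i, t). \<bar>c1 i t - e1 i t\<bar>) ` ({..<d} \<times> {0..1})"
  define D where "D = Sup Z"
  have Z: "\<exists>i t. i < d \<and> t \<in> {0..1} \<and> x = \<bar>c1 i t - e1 i t\<bar>" if "x \<in> Z" for x
    using that by (fastforce simp: Z_def)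
  have "x \<le> 2 * P" if x: "x \<in> Z" for x
  proof -
    obtain i t where x: "i < d" "t \<in> {0..1}" "x = \<bar>c1 i t - e1 i t\<bar>"
      using Z[OF x] by blast
    then have "\<bar>c1 i t\<bar> \<le> P" "\<bar>e1 i t\<bar> \<le> P"
      using sol by (auto simp: solution_def)
    then show ?thesis
      using x by linarith
  qed
  then have "bdd_above Z"
    by (rule bdd_aboveI)
  then have D: "\<bar>c1 i t - e1 i t\<bar> \<le> D" if "i < d" "t \<in> {0..1}" for i t
    unfolding D_def using that by (intro cSup_upper) (auto simp: Z_def)
  have D0: "D \<ge> 0"
    using D[OF \<open>i < d\<close>, of 0] by auto
  have pos: "\<bar>c i t - e i t\<bar> \<le> D" if i: "i < d" and t: "t \<in> {0..1}" for i t
  proof -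
    have "\<bar>(c i t - e i t) - (c i 0 - e i 0)\<bar> \<le> D * t"
      using sol D i t by (intro mean_value_bound[of 1 _ "\<lambda>t. c1 i t - e1 i t"])
        (auto simp: solution_def intro!: derivative_eq_intros)
    also have "\<dots> \<le> D"
      using D0 t by (intro mult_left_le) auto
    finally show ?thesis
      using init i by simp
  qed
  have vel: "\<bar>(c1 i t - e1 i t) - (c1 i 0 - e1 i 0)\<bar> \<le> K2 * P * D" if i: "i < d" and t: "t \<in> {0..1}" for i t
  proof -
    have "\<bar>(c1 i t - e1 i t) - (c1 i 0 - e1 i 0)\<bar> \<le> K2 * P * D * t"
    proof (rule mean_value_bound)
      fix t :: real assume t: "t \<in> {0..1}"
      then show "((\<lambda>t. c1 i t - e1 i t) has_real_derivative c2 i t - e2 i t) (at t within {0..1})"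
        using sol i by (auto simp: solution_def intro!: derivative_eq_intros)
      show "\<bar>c2 i t - e2 i t\<bar> \<le> K2 * P * D"
        using sol t D0 D[OF _ t] pos[OF _ t] i
        by (intro acceleration_Lipschitz[OF _ _ _ _ P(1,2), of "\<lambda>i. c i t" "\<lambda>i. c1 i t" _ "\<lambda>i. e i t" "\<lambda>i. e1 i t"])
          (auto simp: solution_def)
    qed fact
    also have "\<dots> \<le> K2 * P * D"
      using K_nonneg P D0 t by (intro mult_left_le) auto
    finally show ?thesis .
  qed
  have "D \<le> m + K2 * P * D"
    unfolding D_def
  proof (rule cSup_least)
    show "Z \<noteq> {}"
      using \<open>i < d\<close> by (auto simp: Z_def)
    fix x assume "x \<in> Z"
    then obtain i t where x: "i < d" "t \<in> {0..1}" "x = \<bar>c1 i t - e1 i t\<bar>"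
      using Z by blast
    then show "x \<le> m + K2 * P * Sup Z"
      using vel[of i t] init(2)[of i] unfolding D_def by linarith
  qed
  moreover have "K2 * P * D \<le> 1 / 2 * D"
    using P D0 by (intro mult_right_mono) auto
  ultimately have Dm: "D \<le> 2 * m"
    by linarith
  have "\<bar>((c i 1 - e i 1) - (c1 i 0 - e1 i 0) * 1) - ((c i 0 - e i 0) - (c1 i 0 - e1 i 0) * 0)\<bar>
      \<le> K2 * P * D * 1"
  proof (rule mean_value_bound)
    fix t :: real assume t: "t \<in> {0..1}"
    then show "((\<lambda>t. (c i t - e i t) - (c1 i 0 - e1 i 0) * t) has_real_derivative
        (c1 i t - e1 i t) - (c1 i 0 - e1 i 0)) (at t within {0..1})"
      using sol \<open>i < d\<close> by (auto simp: solution_def intro!: derivative_eq_intros)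
  qed (use vel \<open>i < d\<close> in auto)
  also have "\<dots> \<le> K2 * P * (2 * m)"
    using mult_left_mono[OF Dm, of "K2 * P"] K_nonneg P by simp
  finally show ?thesis
    using init(1)[OF \<open>i < d\<close>] by (simp add: mult_ac)
qed

end

text \<open>Banach's fixed point iteration for \<open>F z = y - (E z - z)\<close>, whose fixed
  points solve \<open>E z = y\<close>; convergence is obtained in each of the finitely many
  coordinates separately.\<close>

lemma perturbed_identity_onto:
  fixes E :: "(nat \<Rightarrow> real) \<Rightarrow> nat \<Rightarrow> real"
  assumes Lip: "\<And>z w m i. \<lbrakk>z \<in> cube d a R; w \<in> cube d a R; m \<ge> 0; \<forall>j<d. \<bar>z j - w j\<bar> \<le> m; i < d\<rbrakk>
      \<Longrightarrow> \<bar>(E z i - z i) - (E w i - w i)\<bar> \<le> m / 2"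
    and "R \<ge> 0" and a: "\<And>i. i \<ge> d \<Longrightarrow> a i = 0" and y: "\<And>i. i < d \<Longrightarrow> \<bar>y i - E a i\<bar> \<le> R / 2"
  shows "\<exists>z\<in>cube d a R. \<forall>i<d. E z i = y i"
proof -
  define F where "F z = (\<lambda>i. if i < d then y i - (E z i - z i) else 0)" for z
  define z where "z n = (F ^^ n) a" for n
  have z0: "z 0 = a" and zS: "z (Suc n) = F (z n)" for n
    by (simp_all add: z_def)
  \<comment> \<open>The first step has length at most \<open>R / 2\<close> and the bound halves with
    each further step; the geometric sum keeps the whole iteration in the cube on which
    \<open>Lip\<close> is available.\<close>
  have main: "z n \<in> cube d a (R * (1 - (1/2)^n)) \<and> (\<forall>i<d. \<bar>z (Suc n) i - z n i\<bar> \<le> R * (1/2)^Suc n)" for n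
  proof (induction n)
    case 0
    then show ?case
      using y a by (auto simp: z0 zS F_def cube_def)
  next
    case (Suc n)
    have "\<bar>z (Suc n) i - a i\<bar> \<le> R * (1 - (1/2)^Suc n)" if "i < d" for i
    proof -
      have "\<bar>z (Suc n) i - z n i\<bar> \<le> R * (1/2)^Suc n" "\<bar>z n i - a i\<bar> \<le> R * (1 - (1/2)^n)"
        using Suc that by (auto simp: cube_def)
      moreover have "R * (1/2)^Suc n + R * (1 - (1/2)^n) = R * (1 - (1/2)^Suc n)"
        by (simp add: algebra_simps)
      ultimately show ?thesis
        by linarith
    qed
    then have 1: "z (Suc n) \<in> cube d a (R * (1 - (1/2)^Suc n))"
      by (simp add: cube_def zS F_def)
    have sub: "cube d a (R * (1 - (1/2)^n)) \<subseteq> cube d a R" for n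
      using \<open>R \<ge> 0\<close> by (intro cube_mono mult_left_le) auto
    have in_R: "z (Suc n) \<in> cube d a R" "z n \<in> cube d a R"
      using 1 Suc sub by blast+
    have "\<bar>z (Suc (Suc n)) i - z (Suc n) i\<bar> \<le> R * (1/2)^Suc (Suc n)" if "i < d" for i
    proof -
      have "\<bar>z (Suc (Suc n)) i - z (Suc n) i\<bar> =
          \<bar>(E (z (Suc n)) i - z (Suc n) i) - (E (z n) i - z n i)\<bar>"
        using that unfolding zS[of "Suc n"] by (subst (3) zS) (simp add: F_def)
      also have "\<dots> \<le> R * (1/2)^Suc n / 2"
        using in_R Suc that \<open>R \<ge> 0\<close> by (intro Lip) auto
      finally show ?thesis
        by simp
    qed
    then show ?case
      using 1 by blast
  qed
  have zR: "z n \<in> cube d a R" for n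
    using main[of n] cube_mono[of "R * (1 - (1/2)^n)" R d a] mult_left_le[of "1 - (1/2)^n" R] \<open>R \<ge> 0\<close>
    by auto
  have "\<forall>i. \<exists>l. i < d \<longrightarrow> (\<lambda>n. z n i) \<longlonglongrightarrow> l"
  proof (intro allI)
    fix i
    show "\<exists>l. i < d \<longrightarrow> (\<lambda>n. z n i) \<longlonglongrightarrow> l"
    proof (cases "i < d")
      case True
      have "summable (\<lambda>n. R * (1/2)^Suc n)"
        using summable_Suc_iff[of "\<lambda>n. (1/2::real)^n"] by (intro summable_mult) (simp add: summable_geometric)
      then have "summable (\<lambda>n. z (Suc n) i - z n i)"
      proof (rule summable_comparison_test')
        show "norm (z (Suc n) i - z n i) \<le> R * (1/2)^Suc n" for n
          using main[of n] True unfolding real_norm_def by blast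
      qed
      then have "convergent (\<lambda>n. \<Sum>k<n. z (Suc k) i - z k i)"
        by (simp add: summable_iff_convergent)
      then have "convergent (\<lambda>n. (z n i - z 0 i) + z 0 i)"
        unfolding sum_lessThan_telescope[of "\<lambda>n. z n i"] by (intro convergent_add convergent_const)
      then show ?thesis
        by (simp add: convergent_def)
    qed simp
  qed
  then obtain l where l: "\<And>i. i < d \<Longrightarrow> (\<lambda>n. z n i) \<longlonglongrightarrow> l i"
    by metis
  define w where "w = (\<lambda>i. if i < d then l i else 0)"
  have w: "(\<lambda>n. z n i) \<longlonglongrightarrow> w i" if "i < d" for i
    using l that by (simp add: w_def)
  have wR: "w \<in> cube d a R"
  proof -
    have "\<bar>w i - a i\<bar> \<le> R" if "i < d" for i
    proof (rule LIMSEQ_le_const2)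
      show "(\<lambda>n. \<bar>z n i - a i\<bar>) \<longlonglongrightarrow> \<bar>w i - a i\<bar>"
        by (intro tendsto_intros w that)
      show "\<exists>N. \<forall>n\<ge>N. \<bar>z n i - a i\<bar> \<le> R"
        using zR that by (auto simp: cube_def)
    qed
    then show ?thesis
      by (simp add: cube_def w_def)
  qed
  have "E w i = y i" if i: "i < d" for i
  proof -
    have "(\<lambda>n. z (Suc n) i) \<longlonglongrightarrow> F w i"
    proof (rule metric_LIMSEQ_I)
      fix e :: real assume "e > 0"
      have "\<forall>\<^sub>F n in sequentially. \<forall>j\<in>{..<d}. dist (z n j) (w j) < e"
        using w \<open>e > 0\<close> by (intro eventually_ball_finite) (auto dest: tendstoD)
      then obtain N where N: "\<And>n j. \<lbrakk>n \<ge> N; j < d\<rbrakk> \<Longrightarrow> dist (z n j) (w j) < e"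
        by (auto simp: eventually_sequentially)
      have "dist (z (Suc n) i) (F w i) < e" if "n \<ge> N" for n
      proof -
        have "\<bar>(E (z n) i - z n i) - (E w i - w i)\<bar> \<le> e / 2"
          using N that zR wR i \<open>e > 0\<close> by (intro Lip) (auto simp: dist_real_def less_imp_le)
        moreover have "dist (z (Suc n) i) (F w i) = \<bar>(E (z n) i - z n i) - (E w i - w i)\<bar>"
          using i by (simp add: zS F_def dist_real_def abs_if)
        ultimately show ?thesis
          using \<open>e > 0\<close> by simp
      qed
      then show "\<exists>N. \<forall>n\<ge>N. dist (z (Suc n) i) (F w i) < e"
        by blast
    qed
    moreover have "(\<lambda>n. z (Suc n) i) \<longlonglongrightarrow> w i"
      using w[OF i] by (rule LIMSEQ_Suc)
    ultimately have "F w i = w i"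
      by (rule LIMSEQ_unique)
    then show ?thesis
      using i by (simp add: F_def)
  qed
  then show ?thesis
    using wR by blast
qed

section \<open>Geodesics in a chart\<close>

text \<open>The part of the axioms of a Riemannian manifold that the argument uses; it is checked
  directly for the unit spheres of the tangent spaces.\<close>

locale riemannian_atlas =
  fixes M :: "('p, 'v::real_vector) rmanifold"
  assumes Hausdorff: "Hausdorff_space (mtop M)"
    and chart_cover: "(\<Union>c\<in>atlas M. chart_dom c) = points M"
    and chart_dom_open: "c \<in> atlas M \<Longrightarrow> openin (mtop M) (chart_dom c)"
    and chart_image_open:
      "c \<in> atlas M \<Longrightarrow> openin (Euclidean_space (mdim M)) (coord c ` chart_dom c)"
    and chart_homeo:
      "c \<in> atlas M \<Longrightarrow>
         homeomorphic_map (subtopology (mtop M) (chart_dom c))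
           (subtopology (Euclidean_space (mdim M)) (coord c ` chart_dom c)) (coord c)"
    and tangent_subspace: "x \<in> points M \<Longrightarrow> subspace (tangent M x)"
    and dcoord_bij:
      "\<lbrakk>c \<in> atlas M; x \<in> chart_dom c\<rbrakk> \<Longrightarrow>
         bij_betw (dcoord c x) (tangent M x) (topspace (Euclidean_space (mdim M)))"
    and dcoord_linear:
      "\<lbrakk>c \<in> atlas M; x \<in> chart_dom c; u \<in> tangent M x; w \<in> tangent M x\<rbrakk> \<Longrightarrow>
         dcoord c x (a *\<^sub>R u + b *\<^sub>R w) i = a * dcoord c x u i + b * dcoord c x w i"
    and met_linear:
      "\<lbrakk>x \<in> points M; u \<in> tangent M x; v \<in> tangent M x; w \<in> tangent M x\<rbrakk> \<Longrightarrow>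
         met M x (a *\<^sub>R u + b *\<^sub>R v) w = a * met M x u w + b * met M x v w"
    and met_sym:
      "\<lbrakk>x \<in> points M; u \<in> tangent M x; w \<in> tangent M x\<rbrakk> \<Longrightarrow> met M x u w = met M x w u"
    and met_pos:
      "\<lbrakk>x \<in> points M; u \<in> tangent M x; u \<noteq> 0\<rbrakk> \<Longrightarrow> met M x u u > 0"
    and met_smooth:
      "\<lbrakk>c \<in> atlas M; i < mdim M; j < mdim M\<rbrakk> \<Longrightarrow>
         smooth_fun (mdim M) (coord c ` chart_dom c) (met_coeff M c i j)"

lemma (in riemannian_manifold) riemannian_atlas: "riemannian_atlas M"
  by (intro riemannian_atlas.intro Hausdorff chart_cover chart_dom_open chart_image_open chart_homeo
      tangent_subspace dcoord_bij dcoord_linear met_linear met_sym met_pos met_smooth)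

context riemannian_atlas
begin

section \<open>Topology of charts, and tangent vectors in coordinates\<close>

lemma chart_dom_points: "c \<in> atlas M \<Longrightarrow> x \<in> chart_dom c \<Longrightarrow> x \<in> points M"
  using chart_cover by blast

lemma coord_inj_on: "c \<in> atlas M \<Longrightarrow> inj_on (coord c) (chart_dom c)"
  using homeomorphic_imp_injective_map[OF chart_homeo[of c]] openin_subset[OF chart_dom_open[of c]]
  by (simp add: Int_absorb1)

lemma chart_inv_coord: "c \<in> atlas M \<Longrightarrow> x \<in> chart_dom c \<Longrightarrow> chart_inv c (coord c x) = x"
  unfolding chart_inv_def using coord_inj_on by (rule inv_into_f_f)

lemma coord_ge_dim:
  assumes "c \<in> atlas M" "x \<in> chart_dom c" "i \<ge> mdim M"
  shows "coord c x i = 0"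
  using openin_subset[OF chart_image_open[OF assms(1)]] assms by (auto simp: topspace_Euclidean_space)

lemma coord_continuous:
  assumes "c \<in> atlas M"
  shows "continuous_map (subtopology (mtop M) (chart_dom c)) (Euclidean_space (mdim M)) (coord c)"
  using homeomorphic_imp_continuous_map[OF chart_homeo[OF assms]] by (simp add: continuous_map_in_subtopology)

lemma chart_inv_continuous:
  assumes "c \<in> atlas M"
  shows "continuous_map (subtopology (Euclidean_space (mdim M)) (coord c ` chart_dom c)) (mtop M) (chart_inv c)"
proof -
  obtain f where f: "homeomorphic_maps (subtopology (mtop M) (chart_dom c))
      (subtopology (Euclidean_space (mdim M)) (coord c ` chart_dom c)) (coord c) f"
    using chart_homeo[OF assms] by (auto simp: homeomorphic_map_maps)
  have dom: "chart_dom c \<subseteq> points M"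
    using chart_dom_points assms by blast
  have "continuous_map (subtopology (Euclidean_space (mdim M)) (coord c ` chart_dom c)) (mtop M) f"
    using f by (simp add: homeomorphic_maps_def continuous_map_in_subtopology)
  moreover have "f y = chart_inv c y"
    if y: "y \<in> topspace (subtopology (Euclidean_space (mdim M)) (coord c ` chart_dom c))" for y
  proof -
    obtain x where x: "x \<in> chart_dom c" "y = coord c x"
      using y by auto
    have "\<forall>x\<in>topspace (subtopology (mtop M) (chart_dom c)). f (coord c x) = x"
      using f by (simp add: homeomorphic_maps_def)
    then have "f (coord c x) = x"
      using x(1) dom by auto
    then show ?thesis
      using x chart_inv_coord[OF assms] by simp
  qed
  ultimately show ?thesis
    by (rule continuous_map_eq)
qed

lemma open_chart_cube:
  assumes "c \<in> atlas M"
  shows "openin (mtop M) {p \<in> chart_dom c. \<forall>i<mdim M. \<bar>coord c p i - a i\<bar> < r}"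
proof -
  have "openin (subtopology (mtop M) (chart_dom c)) {p \<in> topspace (subtopology (mtop M) (chart_dom c)).
      coord c p \<in> {y. (\<forall>i<mdim M. \<bar>y i - a i\<bar> < r) \<and> (\<forall>i\<ge>mdim M. y i = 0)}}"
    using coord_continuous[OF assms] open_cube_openin by (rule openin_continuous_map_preimage)
  then have "openin (mtop M) {p \<in> topspace (subtopology (mtop M) (chart_dom c)).
      coord c p \<in> {y. (\<forall>i<mdim M. \<bar>y i - a i\<bar> < r) \<and> (\<forall>i\<ge>mdim M. y i = 0)}}"
    using chart_dom_open[OF assms] by (simp add: openin_open_subtopology)
  moreover have "{p \<in> topspace (subtopology (mtop M) (chart_dom c)).
      coord c p \<in> {y. (\<forall>i<mdim M. \<bar>y i - a i\<bar> < r) \<and> (\<forall>i\<ge>mdim M. y i = 0)}} =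
      {p \<in> chart_dom c. \<forall>i<mdim M. \<bar>coord c p i - a i\<bar> < r}"
    using assms coord_ge_dim chart_dom_points by auto
  ultimately show ?thesis
    by simp
qed

text \<open>The cube is compact and the manifold is Hausdorff. Closedness in all of
  \<open>M\<close>, not only in the chart domain, is what prevents a geodesic from leaving the chart
  at a limit time in \<open>exp_curve_solution\<close>.\<close>

lemma closed_chart_cube:
  assumes "c \<in> atlas M" "cube (mdim M) a r \<subseteq> coord c ` chart_dom c"
  shows "closedin (mtop M) {p \<in> chart_dom c. coord c p \<in> cube (mdim M) a r}"
proof -
  have "compactin (mtop M) (chart_inv c ` cube (mdim M) a r)"
    using assms compactin_cube by (intro image_compactin[OF _ chart_inv_continuous]) (auto simp: compactin_subtopology)
  moreover have "chart_inv c ` cube (mdim M) a r = {p \<in> chart_dom c. coord c p \<in> cube (mdim M) a r}"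
    using assms chart_inv_coord by (auto simp: image_iff subset_eq) metis+
  ultimately show ?thesis
    using compactin_imp_closedin[OF Hausdorff] by simp
qed

definition tangent_vec :: "('p, 'v) chart \<Rightarrow> 'p \<Rightarrow> (nat \<Rightarrow> real) \<Rightarrow> 'v" where
  "tangent_vec c x z = (\<Sum>i<mdim M. z i *\<^sub>R coord_vec M c i x)"

lemma dcoord_ge_dim: "\<lbrakk>c \<in> atlas M; x \<in> chart_dom c; u \<in> tangent M x; i \<ge> mdim M\<rbrakk> \<Longrightarrow> dcoord c x u i = 0"
  using dcoord_bij[of c x] by (auto simp: bij_betw_def topspace_Euclidean_space)

lemma dcoord_add:
  "\<lbrakk>c \<in> atlas M; x \<in> chart_dom c; u \<in> tangent M x; w \<in> tangent M x\<rbrakk> \<Longrightarrow>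
    dcoord c x (u + w) i = dcoord c x u i + dcoord c x w i"
  using dcoord_linear[of c x u w 1 1 i] by simp

lemma dcoord_diff:
  "\<lbrakk>c \<in> atlas M; x \<in> chart_dom c; u \<in> tangent M x; w \<in> tangent M x\<rbrakk> \<Longrightarrow>
    dcoord c x (u - w) i = dcoord c x u i - dcoord c x w i"
  using dcoord_linear[of c x u w 1 "-1" i] by simp

lemma dcoord_scale:
  "\<lbrakk>c \<in> atlas M; x \<in> chart_dom c; u \<in> tangent M x\<rbrakk> \<Longrightarrow>
    dcoord c x (a *\<^sub>R u) i = a * dcoord c x u i"
  using dcoord_linear[of c x u u a 0 i] by simp

context
  fixes c x
  assumes c: "c \<in> atlas M" and x: "x \<in> chart_dom c"
begin

lemma x_point: "x \<in> points M"
  using chart_dom_points c x by blast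

interpretation inner_subspace "tangent M x" "met M x"
  by unfold_locales (use x_point tangent_subspace met_linear met_sym met_pos in auto)

lemma coord_vec:
  assumes "i < mdim M"
  shows "coord_vec M c i x \<in> tangent M x" "dcoord c x (coord_vec M c i x) j = (if j = i then 1 else 0)"
proof -
  have *: "(\<lambda>j. if j = i then 1 else 0) \<in> dcoord c x ` tangent M x"
    using dcoord_bij[OF c x] assms by (auto simp: bij_betw_def topspace_Euclidean_space)
  show "coord_vec M c i x \<in> tangent M x" "dcoord c x (coord_vec M c i x) j = (if j = i then 1 else 0)"
    using inv_into_into[OF *] f_inv_into_f[OF *] by (auto simp: coord_vec_def)
qed

lemma dcoord_sum:
  assumes "\<And>i. i \<in> I \<Longrightarrow> f i \<in> tangent M x"
  shows "dcoord c x (\<Sum>i\<in>I. f i) j = (\<Sum>i\<in>I. dcoord c x (f i) j)"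
  using assms
proof (induction I rule: infinite_finite_induct)
  case (insert i I)
  then have "sum f I \<in> tangent M x"
    by auto
  then show ?case
    using insert by (simp add: dcoord_add c x)
qed (use dcoord_scale[OF c x, of 0 0] in auto)

lemma tangent_vec [simp]: "tangent_vec c x z \<in> tangent M x"
  using coord_vec by (auto simp: tangent_vec_def)

lemma dcoord_tangent_vec:
  assumes "j < mdim M"
  shows "dcoord c x (tangent_vec c x z) j = z j"
proof -
  have "dcoord c x (tangent_vec c x z) j = (\<Sum>i<mdim M. z i * (if j = i then 1 else 0))"
    unfolding tangent_vec_def by (subst dcoord_sum) (auto simp: dcoord_scale c x coord_vec)
  also have "\<dots> = z j"
    using assms by (simp add: if_distrib cong: if_cong)
  finally show ?thesis .
qed

lemma dcoord_inject:
  assumes "u \<in> tangent M x" "w \<in> tangent M x" "\<And>i. i < mdim M \<Longrightarrow> dcoord c x u i = dcoord c x w i"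
  shows "u = w"
proof -
  have "dcoord c x u i = dcoord c x w i" for i
    using assms dcoord_ge_dim[OF c x] by (cases "i < mdim M") auto
  then have "dcoord c x u = dcoord c x w"
    by blast
  then show ?thesis
    using dcoord_bij[OF c x] assms by (auto simp: bij_betw_def dest: inj_onD)
qed

lemma tangent_vec_dcoord: "u \<in> tangent M x \<Longrightarrow> tangent_vec c x (dcoord c x u) = u"
  by (rule dcoord_inject) (auto simp: dcoord_tangent_vec)

text \<open>The coordinate vectors at \<open>x\<close> form such a \<open>B\<close>; this provides
  the assumption \<open>basis\<close> of \<open>finite_inner_subspace\<close>.\<close>

lemma tangent_basis:
  "\<exists>B. finite B \<and> independent B \<and> span B = tangent M x \<and> card B = mdim M"
proof -
  define B where "B = (\<lambda>i. coord_vec M c i x) ` {..<mdim M}"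
  have inj: "inj_on (\<lambda>i. coord_vec M c i x) {..<mdim M}"
  proof (rule inj_onI)
    fix i j assume "i \<in> {..<mdim M}" "j \<in> {..<mdim M}" "coord_vec M c i x = coord_vec M c j x"
    then show "i = j"
      using coord_vec(2)[of i i] coord_vec(2)[of j i] by (auto split: if_splits)
  qed
  have "independent B"
  proof (rule independent_if_scalars_zero)
    fix f b assume 0: "(\<Sum>b\<in>B. f b *\<^sub>R b) = 0" and "b \<in> B"
    then obtain j where j: "j < mdim M" "b = coord_vec M c j x"
      by (auto simp: B_def)
    have "tangent_vec c x (\<lambda>i. f (coord_vec M c i x)) = 0"
      using 0 inj by (simp add: B_def sum.reindex tangent_vec_def)
    then show "f b = 0"
      using dcoord_tangent_vec[OF j(1), of "\<lambda>i. f (coord_vec M c i x)"] j dcoord_scale[OF c x, of 0 0 j]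
      by simp
  qed (simp add: B_def)
  moreover have "span B = tangent M x"
  proof
    show "span B \<subseteq> tangent M x"
      using coord_vec subspace by (intro span_minimal) (auto simp: B_def)
    show "tangent M x \<subseteq> span B"
    proof
      fix u assume u: "u \<in> tangent M x"
      have "tangent_vec c x (dcoord c x u) \<in> span B"
        unfolding tangent_vec_def by (intro span_sum span_scale span_base) (auto simp: B_def)
      then show "u \<in> span B"
        using tangent_vec_dcoord[OF u] by simp
    qed
  qed
  ultimately show ?thesis
    using inj by (intro exI[of _ B]) (auto simp: B_def card_image)
qed

end

lemma finite_inner_subspace:
  assumes "x \<in> points M"
  shows "finite_inner_subspace (tangent M x) (met M x) (mdim M)"
proof -
  obtain c where "c \<in> atlas M" "x \<in> chart_dom c"
    using assms chart_cover by blast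
  from tangent_basis[OF this] show ?thesis
    by unfold_locales (use assms tangent_subspace met_linear met_sym met_pos in auto)
qed

lemma nrm_eq_tnorm:
  assumes "x \<in> points M"
  shows "inner_subspace.nrm (met M x) u = tnorm M x u"
proof -
  interpret finite_inner_subspace "tangent M x" "met M x" "mdim M"
    using finite_inner_subspace[OF assms] .
  show ?thesis
    by (simp add: nrm_def tnorm_def)
qed

context
  fixes c x
  assumes c: "c \<in> atlas M" and x: "x \<in> chart_dom c"
begin

interpretation finite_inner_subspace "tangent M x" "met M x" "mdim M"
  using finite_inner_subspace[OF chart_dom_points[OF c x]] .

text \<open>Together with \<open>nrm_bounded\<close> this is the equivalence of the metric norm and
  the maximum norm of the chart coordinates, which allows cone conditions to be checked in the
  chart.\<close>

lemma dcoord_bounded: "\<exists>C\<ge>0. \<forall>u\<in>tangent M x. \<forall>i<mdim M. \<bar>dcoord c x u i\<bar> \<le> C * nrm u"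
proof -
  have "\<forall>i. \<exists>C\<ge>0. \<forall>u\<in>tangent M x. \<bar>dcoord c x u i\<bar> \<le> C * nrm u"
    by (intro allI functional_bounded) (simp add: dcoord_linear c x)
  then obtain C where C: "\<And>i. C i \<ge> 0" "\<And>i u. u \<in> tangent M x \<Longrightarrow> \<bar>dcoord c x u i\<bar> \<le> C i * nrm u"
    by metis
  have "\<bar>dcoord c x u i\<bar> \<le> (\<Sum>i<mdim M. C i) * nrm u" if "u \<in> tangent M x" "i < mdim M" for u i
  proof -
    have "C i \<le> (\<Sum>i<mdim M. C i)"
      using C that by (intro member_le_sum) auto
    then show ?thesis
      using C(2)[OF that(1), of i] that mult_right_mono[OF _ nrm_nonneg] by fastforce
  qed
  then show ?thesis
    using C by (intro exI[of _ "\<Sum>i<mdim M. C i"]) (auto intro: sum_nonneg)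
qed

lemma nrm_bounded: "\<exists>C\<ge>0. \<forall>u\<in>tangent M x. \<forall>e. (\<forall>i<mdim M. \<bar>dcoord c x u i\<bar> \<le> e) \<longrightarrow> nrm u \<le> C * e"
proof -
  have "nrm u \<le> (\<Sum>i<mdim M. nrm (coord_vec M c i x)) * e"
    if "u \<in> tangent M x" "\<forall>i<mdim M. \<bar>dcoord c x u i\<bar> \<le> e" for u e
  proof -
    have "nrm u = nrm (\<Sum>i<mdim M. dcoord c x u i *\<^sub>R coord_vec M c i x)"
      using tangent_vec_dcoord[OF c x that(1)] by (simp add: tangent_vec_def)
    also have "\<dots> \<le> (\<Sum>i<mdim M. nrm (dcoord c x u i *\<^sub>R coord_vec M c i x))"
      by (rule nrm_sum) (simp add: coord_vec c x)
    also have "\<dots> \<le> (\<Sum>i<mdim M. e * nrm (coord_vec M c i x))"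
      using that by (intro sum_mono) (auto simp: nrm_scale coord_vec c x intro!: mult_right_mono)
    finally show ?thesis
      by (simp add: sum_distrib_left mult.commute)
  qed
  then show ?thesis
    by (intro exI[of _ "\<Sum>i<mdim M. nrm (coord_vec M c i x)"]) (auto intro!: sum_nonneg simp: coord_vec c x)
qed

text \<open>The quadratic form is \<open>met M x u u\<close> for the vector \<open>u\<close> with
  coordinates \<open>q\<close>, and each coordinate is at most \<open>C * nrm u\<close>. Summing the
  squares gives the constant \<open>1 / A\<close>; the 1 added in \<open>A\<close> keeps it
  positive.\<close>

lemma met_coeff_coercive:
  "\<exists>lam>0. \<forall>q. lam * (\<Sum>k<mdim M. (q k)\<^sup>2) \<le>
     (\<Sum>l<mdim M. \<Sum>k<mdim M. met_coeff M c l k (coord c x) * q l * q k)"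
proof -
  obtain C where C: "C \<ge> 0" "\<And>u i. \<lbrakk>u \<in> tangent M x; i < mdim M\<rbrakk> \<Longrightarrow> \<bar>dcoord c x u i\<bar> \<le> C * nrm u"
    using dcoord_bounded by blast
  define A where "A = mdim M * C\<^sup>2 + 1"
  have A: "A > 0"
    using C by (auto simp: A_def intro: add_nonneg_pos)
  have "1 / A * (\<Sum>k<mdim M. (q k)\<^sup>2) \<le>
     (\<Sum>l<mdim M. \<Sum>k<mdim M. met_coeff M c l k (coord c x) * q l * q k)" for q
  proof -
    define u where "u = tangent_vec c x q"
    have u: "u \<in> tangent M x"
      using tangent_vec[OF c x] by (simp add: u_def)
    have "(q k)\<^sup>2 \<le> C\<^sup>2 * h_uu" if "k < mdim M" "h_uu = met M x u u" for k h_uu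
    proof -
      have "\<bar>q k\<bar> \<le> C * nrm u"
        using C(2)[OF u that(1)] dcoord_tangent_vec[OF c x that(1)] by (simp add: u_def)
      then have "\<bar>q k\<bar>\<^sup>2 \<le> (C * nrm u)\<^sup>2"
        by (intro power_mono) auto
      then show ?thesis
        using that by (simp add: power_mult_distrib nrm_sq[OF u])
    qed
    then have "(\<Sum>k<mdim M. (q k)\<^sup>2) \<le> (\<Sum>k<mdim M. C\<^sup>2 * met M x u u)"
      by (intro sum_mono) auto
    also have "\<dots> \<le> A * met M x u u"
      using u by (simp add: A_def algebra_simps)
    finally have "1 / A * (\<Sum>k<mdim M. (q k)\<^sup>2) \<le> met M x u u"
      using A by (simp add: field_simps)
    also have "met M x u u = (\<Sum>l<mdim M. q l * met M x (coord_vec M c l x) u)"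
      unfolding u_def by (subst (1) tangent_vec_def, subst sum_left)
        (auto simp: scale_left coord_vec[OF c x] tangent_vec[OF c x])
    also have "\<dots> = (\<Sum>l<mdim M. q l * (\<Sum>k<mdim M. q k * met M x (coord_vec M c l x) (coord_vec M c k x)))"
      unfolding u_def tangent_vec_def
      by (intro sum.cong refl arg_cong2[where f = "(*)"], subst sum_right)
        (auto simp: scale_right coord_vec[OF c x])
    also have "\<dots> = (\<Sum>l<mdim M. \<Sum>k<mdim M. met_coeff M c l k (coord c x) * q l * q k)"
      by (simp add: c x met_coeff_def chart_inv_coord sum_distrib_left mult_ac)
    finally show ?thesis .
  qed
  then show ?thesis
    using A by (intro exI[of _ "1 / A"]) auto
qed

end

definition Lipschitz_near :: "nat \<Rightarrow> (nat \<Rightarrow> real) \<Rightarrow> real \<Rightarrow> real \<Rightarrow> ((nat \<Rightarrow> real) \<Rightarrow> real) \<Rightarrow> bool" where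
  "Lipschitz_near d a r L f \<longleftrightarrow> (\<forall>y\<in>cube d a r. \<bar>f y\<bar> \<le> L \<and>
    (\<forall>z\<in>cube d a r. \<forall>m\<ge>0. (\<forall>i<d. \<bar>z i - y i\<bar> \<le> m) \<longrightarrow> \<bar>f z - f y\<bar> \<le> L * m))"

lemma Lipschitz_near_mono:
  assumes "Lipschitz_near d a r L f" "r' \<le> r" "L \<le> L'"
  shows "Lipschitz_near d a r' L' f"
  unfolding Lipschitz_near_def
proof (intro ballI conjI allI impI)
  fix y assume "y \<in> cube d a r'"
  then have y: "y \<in> cube d a r"
    using cube_mono[OF assms(2)] by blast
  then show "\<bar>f y\<bar> \<le> L'"
    using assms by (force simp: Lipschitz_near_def)
  fix z and m :: real assume "z \<in> cube d a r'" and m: "m \<ge> 0" "\<forall>i<d. \<bar>z i - y i\<bar> \<le> m"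
  then have "z \<in> cube d a r"
    using cube_mono[OF assms(2)] by blast
  then have "\<bar>f z - f y\<bar> \<le> L * m"
    using assms(1) y m by (simp add: Lipschitz_near_def)
  also have "\<dots> \<le> L' * m"
    using assms m by (intro mult_right_mono)
  finally show "\<bar>f z - f y\<bar> \<le> L' * m" .
qed

lemma Lipschitz_near_finite:
  assumes "finite I" "\<forall>i\<in>I. \<exists>r>0. \<exists>L\<ge>0. Lipschitz_near d a r L (f i)"
  shows "\<exists>r>0. \<exists>L\<ge>0. \<forall>i\<in>I. Lipschitz_near d a r L (f i)"
  using assms
proof (induction I)
  case empty
  then show ?case
    by (auto intro: exI[of _ 1])
next
  case (insert i I)
  then obtain r L where 1: "r > 0" "L \<ge> 0" "\<forall>i\<in>I. Lipschitz_near d a r L (f i)"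
    by auto
  obtain r' L' where 2: "r' > 0" "L' \<ge> 0" "Lipschitz_near d a r' L' (f i)"
    using insert by auto
  show ?case
    by (rule exI[of _ "min r r'"], rule conjI, use 1 2 in simp, rule exI[of _ "max L L'"])
      (use 1 2 in \<open>auto intro: Lipschitz_near_mono\<close>)
qed

lemma geodesic_system_at:
  assumes c: "c \<in> atlas M" and x: "x \<in> chart_dom c"
  shows "\<exists>\<rho>>0. \<exists>L lam. cube (mdim M) (coord c x) \<rho> \<subseteq> coord c ` chart_dom c \<and>
    geodesic_system (mdim M) (cube (mdim M) (coord c x) \<rho>) (met_coeff M c) (christoffel M c) L lam"
proof -
  define d a V where "d = mdim M" and "a = coord c x" and "V = coord c ` chart_dom c"
  have V: "openin (Euclidean_space d) V" "a \<in> V"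
    using chart_image_open[OF c] x by (auto simp: d_def a_def V_def)
  have g: "smooth_fun d V (met_coeff M c i j)" if "i < d" "j < d" for i j
    using met_smooth[OF c] that by (simp add: d_def V_def)
  have 1: "\<exists>r>0. \<exists>L\<ge>0. Lipschitz_near d a r L (met_coeff M c i j)" if "i < d" "j < d" for i j
    using smooth_fun_locally_Lipschitz[OF g[OF that] V] by (auto simp: Lipschitz_near_def)
  have "\<exists>r>0. \<exists>L\<ge>0. \<forall>p\<in>{..<d}\<times>{..<d}. Lipschitz_near d a r L (met_coeff M c (fst p) (snd p))"
    using 1 by (intro Lipschitz_near_finite) auto
  then obtain r1 L1 where g_Lip: "r1 > 0" "L1 \<ge> 0"
    "\<And>i j. \<lbrakk>i < d; j < d\<rbrakk> \<Longrightarrow> Lipschitz_near d a r1 L1 (met_coeff M c i j)"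
    by force
  have 2: "\<exists>r>0. \<exists>L\<ge>0. Lipschitz_near d a r L (part_deriv l (met_coeff M c i j))"
    if "l < d" "i < d" "j < d" for l i j
    using smooth_fun_locally_Lipschitz[OF smooth_fun_part_deriv[OF g[OF that(2,3)] that(1)] V]
    by (auto simp: Lipschitz_near_def)
  have "\<exists>r>0. \<exists>L\<ge>0. \<forall>p\<in>{..<d}\<times>{..<d}\<times>{..<d}.
      Lipschitz_near d a r L (part_deriv (fst p) (met_coeff M c (fst (snd p)) (snd (snd p))))"
    using 2 by (intro Lipschitz_near_finite) auto
  then obtain r2 L2 where dg_Lip: "r2 > 0" "L2 \<ge> 0"
    "\<And>l i j. \<lbrakk>l < d; i < d; j < d\<rbrakk> \<Longrightarrow> Lipschitz_near d a r2 L2 (part_deriv l (met_coeff M c i j))"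
    by force
  obtain lam where lam: "lam > 0" "\<And>q. lam * (\<Sum>k<d. (q k)\<^sup>2) \<le> (\<Sum>l<d. \<Sum>k<d. met_coeff M c l k a * q l * q k)"
    using met_coeff_coercive[OF c x] by (auto simp: d_def a_def)
  obtain r3 where r3: "r3 > 0" "cube d a r3 \<subseteq> V"
    using cube_subset_openin[OF V] by blast
  \<comment> \<open>At distance \<open>\<eta>\<close> from the centre the coefficients change by at
    most \<open>L1 * \<eta>\<close>, which costs at most
    \<open>d * L1 * \<eta> \<le> lam / 2\<close> of the coercivity at the centre; half of it
    survives.\<close>
  define \<eta> where "\<eta> = lam / (2 * (d * L1 + 1))"
  have \<eta>: "\<eta> > 0"
    using lam g_Lip by (auto simp: \<eta>_def intro!: divide_pos_pos add_nonneg_pos)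
  define r where "r = Min {r1, r2, r3, \<eta>}"
  have r: "r > 0" "r \<le> r1" "r \<le> r2" "r \<le> r3" "r \<le> \<eta>"
    using g_Lip dg_Lip r3 \<eta> by (auto simp: r_def)
  \<comment> \<open>A Christoffel symbol is half of a sum of three derivatives, hence at most
    \<open>3 / 2 * L2\<close>; \<open>L1\<close> is the Lipschitz constant of the metric
    coefficients themselves.\<close>
  define L where "L = L1 + 2 * L2"
  have L: "L \<ge> 0" "L1 \<le> L"
    using g_Lip dg_Lip by (auto simp: L_def)
  have a: "a \<in> cube d a r"
    using r c x coord_ge_dim by (auto simp: cube_def a_def d_def)
  have g_r: "Lipschitz_near d a r L1 (met_coeff M c i j)" if "i < d" "j < d" for i j
    using Lipschitz_near_mono[OF g_Lip(3)[OF that] r(2)] by simp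
  have dg_r: "Lipschitz_near d a r L2 (part_deriv l (met_coeff M c i j))" if "l < d" "i < d" "j < d" for l i j
    using Lipschitz_near_mono[OF dg_Lip(3)[OF that] r(3)] by simp
  have "geodesic_system d (cube d a r) (met_coeff M c) (christoffel M c) L (lam / 2)"
  proof
    fix y z and m :: real and l k
    assume y: "y \<in> cube d a r" "z \<in> cube d a r" "m \<ge> 0" "\<forall>i<d. \<bar>z i - y i\<bar> \<le> m" "l < d" "k < d"
    have "\<bar>met_coeff M c l k z - met_coeff M c l k y\<bar> \<le> L1 * m"
      using g_r[OF y(5,6)] y by (simp add: Lipschitz_near_def)
    also have "\<dots> \<le> L * m"
      using L y by (intro mult_right_mono)
    finally show "\<bar>met_coeff M c l k z - met_coeff M c l k y\<bar> \<le> L * m" .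
  next
    fix y l i j
    assume y: "y \<in> cube d a r" and "l < d" "i < d" "j < d"
    then have "\<bar>part_deriv i (met_coeff M c j l) y\<bar> \<le> L2" "\<bar>part_deriv j (met_coeff M c i l) y\<bar> \<le> L2"
      "\<bar>part_deriv l (met_coeff M c i j) y\<bar> \<le> L2"
      using dg_r by (auto simp: Lipschitz_near_def)
    then show "\<bar>christoffel M c l i j y\<bar> \<le> L"
      using g_Lip(2) dg_Lip(2) by (simp add: christoffel_def L_def abs_le_iff)
  next
    fix y z and m :: real and l i j
    assume y: "y \<in> cube d a r" "z \<in> cube d a r" "m \<ge> 0" "\<forall>i<d. \<bar>z i - y i\<bar> \<le> m"
      and ij: "l < d" "i < d" "j < d"
    have "\<bar>part_deriv i (met_coeff M c j l) z - part_deriv i (met_coeff M c j l) y\<bar> \<le> L2 * m"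
      "\<bar>part_deriv j (met_coeff M c i l) z - part_deriv j (met_coeff M c i l) y\<bar> \<le> L2 * m"
      "\<bar>part_deriv l (met_coeff M c i j) z - part_deriv l (met_coeff M c i j) y\<bar> \<le> L2 * m"
      using dg_r ij y by (simp_all add: Lipschitz_near_def)
    moreover have "L * m = L1 * m + 2 * (L2 * m)" "L1 * m \<ge> 0" "L2 * m \<ge> 0"
      using y g_Lip dg_Lip by (simp_all add: L_def algebra_simps)
    ultimately show "\<bar>christoffel M c l i j z - christoffel M c l i j y\<bar> \<le> L * m"
      unfolding christoffel_def abs_le_iff diff_divide_distrib add_divide_distrib
      by (intro conjI) linarith+
  next
    fix y and q :: "nat \<Rightarrow> real"
    assume y: "y \<in> cube d a r"
    define S where "S = (\<Sum>l<d. \<bar>q l\<bar>)"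
    have "\<forall>i<d. \<bar>a i - y i\<bar> \<le> \<eta>"
      using y r(5) by (auto simp: cube_def abs_minus_commute intro: order_trans)
    then have close: "\<bar>met_coeff M c l k a - met_coeff M c l k y\<bar> \<le> L1 * \<eta>" if "l < d" "k < d" for l k
      using g_r[OF that] y a \<eta> unfolding Lipschitz_near_def by (simp add: less_imp_le)
    have "met_coeff M c l k a * q l * q k - met_coeff M c l k y * q l * q k \<le> L1 * \<eta> * \<bar>q l\<bar> * \<bar>q k\<bar>"
      if "l < d" "k < d" for l k
    proof -
      have "met_coeff M c l k a * q l * q k - met_coeff M c l k y * q l * q k
          \<le> \<bar>(met_coeff M c l k a - met_coeff M c l k y) * q l * q k\<bar>"
        by (simp add: left_diff_distrib[symmetric])
      also have "\<dots> \<le> L1 * \<eta> * \<bar>q l\<bar> * \<bar>q k\<bar>"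
        unfolding abs_mult using close[OF that] by (intro mult_right_mono) auto
      finally show ?thesis .
    qed
    then have "(\<Sum>l<d. \<Sum>k<d. met_coeff M c l k a * q l * q k - met_coeff M c l k y * q l * q k)
        \<le> (\<Sum>l<d. \<Sum>k<d. L1 * \<eta> * \<bar>q l\<bar> * \<bar>q k\<bar>)"
      by (intro sum_mono) auto
    also have "\<dots> = L1 * \<eta> * S\<^sup>2"
      by (simp add: S_def power2_eq_square sum_distrib_left sum_distrib_right mult_ac)
    also have "\<dots> \<le> L1 * \<eta> * ((\<Sum>k<d. (q k)\<^sup>2) * d)"
      using sum_squared_le_sum_of_squares[of "\<lambda>l. \<bar>q l\<bar>" "{..<d}"] g_Lip \<eta>
      by (intro mult_left_mono) (auto simp: S_def)
    also have "\<dots> = (d * L1 * \<eta>) * (\<Sum>k<d. (q k)\<^sup>2)"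
      by (simp add: mult_ac)
    also have "\<dots> \<le> (lam / 2) * (\<Sum>k<d. (q k)\<^sup>2)"
    proof (rule mult_right_mono)
      have "0 \<le> d * L1"
        using g_Lip by simp
      then show "d * L1 * \<eta> \<le> lam / 2"
        using lam by (simp add: \<eta>_def field_simps)
    qed (simp add: sum_nonneg)
    finally show "lam / 2 * (\<Sum>k<d. (q k)\<^sup>2) \<le> (\<Sum>l<d. \<Sum>k<d. met_coeff M c l k y * q l * q k)"
      using lam(2)[of q] by (simp add: sum_subtractf field_simps)
  qed (use L lam in auto)
  moreover have "cube d a r \<subseteq> V"
    using r3 cube_mono[OF r(4)] by blast
  ultimately show ?thesis
    using r(1) unfolding d_def a_def V_def by blast
qed

end

section \<open>The exponential map near the origin\<close>

text \<open>\<open>smooth_real_on\<close> provides a tower of derivatives within \<open>S\<close>,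
  whereas \<open>geodesic\<close> speaks of \<open>deriv\<close>; on an open set the two
  agree.\<close>

lemma smooth_real_on_open:
  assumes "smooth_real_on S f" "open S" "t \<in> S"
  shows "(f has_real_derivative deriv f t) (at t)"
    and "(deriv f has_real_derivative deriv (deriv f) t) (at t)"
proof -
  obtain D where D: "\<And>t. t \<in> S \<Longrightarrow> D 0 t = f t"
    "\<And>k t. t \<in> S \<Longrightarrow> (D k has_real_derivative D (Suc k) t) (at t)"
    using assms(1,2) by (auto simp: smooth_real_on_def at_within_open[OF _ assms(2)])
  have f: "(f has_real_derivative D (Suc 0) s) (at s)" if "s \<in> S" for s
    using D(2)[OF that, of 0] assms(2) that D(1) by (rule has_field_derivative_transform_within_open)
  have f1: "deriv f s = D (Suc 0) s" if "s \<in> S" for s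
    using f[OF that] by (rule DERIV_imp_deriv)
  then show "(f has_real_derivative deriv f t) (at t)"
    using f assms(3) by simp
  have f': "(deriv f has_real_derivative D (Suc (Suc 0)) t) (at t)"
    using D(2)[OF assms(3), of "Suc 0"] assms(2,3) f1[symmetric]
    by (rule has_field_derivative_transform_within_open)
  then show "(deriv f has_real_derivative deriv (deriv f) t) (at t)"
    using DERIV_imp_deriv by metis
qed

lemma has_derivative_scale:
  fixes f :: "real \<Rightarrow> real"
  assumes "(f has_real_derivative D) (at (\<tau> * s) within J)" "(\<lambda>s. \<tau> * s) ` I \<subseteq> J"
  shows "((\<lambda>s. f (\<tau> * s)) has_real_derivative \<tau> * D) (at s within I)"
proof -
  have "((\<lambda>s. \<tau> * s) has_real_derivative \<tau>) (at s within I)"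
    by (auto intro!: derivative_eq_intros)
  from DERIV_image_chain[OF DERIV_subset[OF assms] this] show ?thesis
    by (simp add: o_def mult.commute)
qed

text \<open>Continuity method on the unit interval: with \<open>m\<close> the supremum of the times
  up to which \<open>P\<close> holds, \<open>closed\<close> gives \<open>P m\<close>, and
  \<open>forward\<close> rules out \<open>m < 1\<close>.\<close>

lemma interval_induct:
  fixes P :: "real \<Rightarrow> bool"
  assumes zero: "P 0"
    and forward: "\<And>t. \<lbrakk>0 \<le> t; t < 1; \<forall>s\<in>{0..t}. P s\<rbrakk> \<Longrightarrow> \<exists>e>0. \<forall>s. t < s \<and> s < t + e \<longrightarrow> P s"
    and closed: "\<And>t. \<lbrakk>0 < t; t \<le> 1; \<forall>s\<in>{0..<t}. P s\<rbrakk> \<Longrightarrow> P t"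
    and t: "t \<in> {0..1}"
  shows "P t"
proof -
  define S where "S = {t\<in>{0..1}. \<forall>s\<in>{0..t}. P s}"
  define m where "m = Sup S"
  have S: "0 \<in> S" "bdd_above S"
    using zero by (auto simp: S_def intro: bdd_aboveI[of _ 1])
  have "0 \<le> m"
    unfolding m_def using S by (rule cSup_upper)
  moreover have "m \<le> 1"
  proof (unfold m_def, rule cSup_least)
    show "S \<noteq> {}"
      using S by blast
  qed (simp add: S_def)
  ultimately have m: "0 \<le> m" "m \<le> 1" .
  have below: "P s" if s: "s \<in> {0..<m}" for s
  proof -
    have "S \<noteq> {}"
      using S by blast
    then obtain r where "r \<in> S" "s < r"
      using s S less_cSup_iff[of S s] by (auto simp: m_def)
    then show ?thesis
      using s by (auto simp: S_def)
  qed
  have Pm: "P m"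
    using zero closed[of m] below m by (cases "m = 0") auto
  have "m = 1"
  proof (rule ccontr)
    assume "m \<noteq> 1"
    then have "m < 1"
      using m by simp
    moreover have "\<forall>s\<in>{0..m}. P s"
      using below Pm by (auto simp: le_less)
    ultimately obtain e where e: "e > 0" "\<And>s. m < s \<Longrightarrow> s < m + e \<Longrightarrow> P s"
      using forward[of m] m by blast
    define r where "r = min 1 (m + e / 2)"
    have r: "m < r" "r \<le> 1" "r < m + e"
      using e(1) \<open>m < 1\<close> by (auto simp: r_def)
    have "P s" if "s \<in> {0..r}" for s
      using that below[of s] Pm e(2)[of s] r by (cases s m rule: linorder_cases) auto
    then have "r \<in> S"
      using m r by (auto simp: S_def)
    then show False
      using cSup_upper[OF _ S(2)] r(1) by (fastforce simp: m_def)
  qed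
  then show ?thesis
    using below[of t] Pm t by (cases "t = m") auto
qed

context riemannian_atlas
begin

lemma geodesic_in_chart:
  assumes c: "c \<in> atlas M" and geo: "geodesic M {a<..<b} \<gamma>"
  defines "Y \<equiv> \<lambda>i t. coord c (\<gamma> t) i" and "S \<equiv> {t \<in> {a<..<b}. \<gamma> t \<in> chart_dom c}"
  shows "openin (mtop M) U \<Longrightarrow> open {t \<in> {a<..<b}. \<gamma> t \<in> U}"
    and "\<lbrakk>t \<in> S; i < mdim M\<rbrakk> \<Longrightarrow> (Y i has_real_derivative deriv (Y i) t) (at t)"
    and "\<lbrakk>t \<in> S; i < mdim M\<rbrakk> \<Longrightarrow> (deriv (Y i) has_real_derivative deriv (deriv (Y i)) t) (at t)"
    and "\<lbrakk>t \<in> S; l < mdim M\<rbrakk> \<Longrightarrow>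
      (\<Sum>k<mdim M. met_coeff M c l k (coord c (\<gamma> t)) * deriv (deriv (Y k)) t)
           + (\<Sum>i<mdim M. \<Sum>j<mdim M.
                christoffel M c l i j (coord c (\<gamma> t)) * deriv (Y i) t * deriv (Y j) t) = 0"
proof -
  have sm: "smooth_curve M {a<..<b} \<gamma>"
    using geo by (simp add: geodesic_def)
  then have cont: "continuous_map (top_of_set {a<..<b}) (mtop M) \<gamma>"
    by (simp add: smooth_curve_def)
  have op: "open {t \<in> {a<..<b}. \<gamma> t \<in> U}" if "openin (mtop M) U" for U
    using openin_continuous_map_preimage[OF cont that] by (simp add: openin_open_eq)
  then show "openin (mtop M) U \<Longrightarrow> open {t \<in> {a<..<b}. \<gamma> t \<in> U}" .
  have "open S"
    unfolding S_def using op chart_dom_open[OF c] .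
  moreover have "smooth_real_on S (Y i)" if "i < mdim M" for i
    using sm c that by (simp add: smooth_curve_def S_def Y_def)
  ultimately show "\<lbrakk>t \<in> S; i < mdim M\<rbrakk> \<Longrightarrow> (Y i has_real_derivative deriv (Y i) t) (at t)"
    "\<lbrakk>t \<in> S; i < mdim M\<rbrakk> \<Longrightarrow> (deriv (Y i) has_real_derivative deriv (deriv (Y i)) t) (at t)"
    using smooth_real_on_open by blast+
  show "\<lbrakk>t \<in> S; l < mdim M\<rbrakk> \<Longrightarrow>
      (\<Sum>k<mdim M. met_coeff M c l k (coord c (\<gamma> t)) * deriv (deriv (Y k)) t)
           + (\<Sum>i<mdim M. \<Sum>j<mdim M.
                christoffel M c l i j (coord c (\<gamma> t)) * deriv (Y i) t * deriv (Y j) t) = 0"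
    using geo c by (simp add: geodesic_def S_def Y_def Let_def)
qed

context
  fixes c x
  assumes c: "c \<in> atlas M" and x: "x \<in> chart_dom c"
begin

text \<open>A short initial velocity keeps the geodesic in the chart up to time 1: as long as the
  coordinate speed is at most \<open>2r\<close>, the acceleration is \<open>O(r\<^sup>2)\<close>, so that the speed stays
  below \<open>2r\<close>.\<close>

lemma exp_curve_solution:
  assumes sys: "geodesic_system (mdim M) (cube (mdim M) (coord c x) \<rho>) (met_coeff M c) (christoffel M c) L lam"
    and sub: "cube (mdim M) (coord c x) \<rho> \<subseteq> coord c ` chart_dom c"
    and r: "0 < r" "2 * r < \<rho>" "geodesic_system.K1 (mdim M) L lam * (2 * r)\<^sup>2 < r"
    and u: "\<And>i. i < mdim M \<Longrightarrow> \<bar>dcoord c x u i\<bar> \<le> r"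
    and ex: "exp_curve M x u \<gamma>"
  defines "Y \<equiv> \<lambda>i t. coord c (\<gamma> t) i"
  shows "geodesic_system.solution (mdim M) (cube (mdim M) (coord c x) \<rho>) (met_coeff M c) (christoffel M c)
      1 (2 * r) Y (\<lambda>i. deriv (Y i)) (\<lambda>i. deriv (deriv (Y i)))"
    and "\<gamma> 1 \<in> chart_dom c" and "i < mdim M \<Longrightarrow> Y i 0 = coord c x i" and "i < mdim M \<Longrightarrow> deriv (Y i) 0 = dcoord c x u i"
proof -
  define d B where "d = mdim M" and "B = cube d (coord c x) \<rho>"
  interpret geodesic_system d B "met_coeff M c" "christoffel M c" L lam
    using sys by (simp add: d_def B_def)
  obtain a b where ab: "a < 0" "1 < b" "geodesic M {a<..<b} \<gamma>" "\<gamma> 0 = x" "has_velocity M {a<..<b} \<gamma> 0 u"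
    using ex by (auto simp: exp_curve_def)
  define S where "S = {t \<in> {a<..<b}. \<gamma> t \<in> chart_dom c}"
  note chart = geodesic_in_chart[OF c ab(3)]
  have Y1: "(Y i has_real_derivative deriv (Y i) t) (at t)"
    and Y2: "(deriv (Y i) has_real_derivative deriv (deriv (Y i)) t) (at t)" if "t \<in> S" "i < d" for t i
    using chart(2,3)[of t i] that unfolding Y_def S_def d_def by auto
  have Yeq: "geo_eq (\<lambda>i. Y i t) (\<lambda>i. deriv (Y i) t) (\<lambda>i. deriv (deriv (Y i)) t)" if "t \<in> S" for t
    unfolding geo_eq_def using chart(4)[of t] that unfolding Y_def S_def d_def by auto
  have Y_eq: "(\<lambda>i. Y i t) = coord c (\<gamma> t)" for t
    by (simp add: Y_def)
  have openS: "open S"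
    unfolding S_def using chart(1) chart_dom_open[OF c] .
  have S0: "0 \<in> S"
    using ab x by (auto simp: S_def)
  have init: "Y i 0 = coord c x i" if "i < d" for i
    using ab(4) by (simp add: Y_def)
  have init1: "deriv (Y i) 0 = dcoord c x u i" if "i < d" for i
  proof -
    have "(Y i has_real_derivative dcoord c x u i) (at 0 within {a<..<b})"
      using ab(4,5) c x that by (auto simp: has_velocity_def Y_def d_def)
    then have "(Y i has_real_derivative dcoord c x u i) (at 0)"
      using ab(1,2) at_within_open[of 0 "{a<..<b}"] by simp
    then show ?thesis
      by (rule DERIV_imp_deriv)
  qed
  define P where "P t \<longleftrightarrow> \<gamma> t \<in> chart_dom c \<and> coord c (\<gamma> t) \<in> B \<and> (\<forall>i<d. \<bar>deriv (Y i) t\<bar> \<le> 2 * r)" for t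
  have x_B: "coord c x \<in> B"
    using r coord_ge_dim[OF c x] by (auto simp: B_def cube_def d_def)
  have sol: "solution t (2 * r) Y (\<lambda>i. deriv (Y i)) (\<lambda>i. deriv (deriv (Y i)))"
    if "0 \<le> t" "t \<le> 1" "\<forall>s\<in>{0..t}. P s" for t
  proof -
    have "s \<in> S" if "s \<in> {0..t}" for s
      using that \<open>t \<le> 1\<close> \<open>\<forall>s\<in>{0..t}. P s\<close> ab by (auto simp: P_def S_def)
    then show ?thesis
      using that Y1 Y2 Yeq unfolding solution_def by (auto simp: P_def Y_eq intro: has_field_derivative_at_within)
  qed
  have P: "P t" if "t \<in> {0..1}" for t
  proof (rule interval_induct[of P, OF _ _ _ that])
    show "P 0"
      using ab(4) x x_B init1 u r(1) by (force simp: P_def d_def)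
  next
    \<comment> \<open>Up to time \<open>t\<close> the estimates for solutions give strict
      inequalities: displacement at most \<open>2 * r < \<rho>\<close>, speed at most
      \<open>r + K1 * (2 * r)^2 < 2 * r\<close>. Strict inequalities persist for a short
      time.\<close>
    fix t :: real assume t: "0 \<le> t" "t < 1" and Pt: "\<forall>s\<in>{0..t}. P s"
    have sol_t: "solution t (2 * r) Y (\<lambda>i. deriv (Y i)) (\<lambda>i. deriv (deriv (Y i)))"
      using sol t Pt by simp
    have tS: "t \<in> S"
      using t Pt ab by (auto simp: P_def S_def)
    define U where "U = {p \<in> chart_dom c. \<forall>i<mdim M. \<bar>coord c p i - coord c x i\<bar> < \<rho>}"
    have "\<bar>Y i t - coord c x i\<bar> < \<rho>" if "i < d" for i
    proof -
      have "\<bar>Y i t - Y i 0\<bar> \<le> 2 * r * t"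
        using solution_position[OF sol_t _ that, of t] t by auto
      also have "\<dots> \<le> 2 * r"
        using t r(1) by (intro mult_left_le) auto
      finally show ?thesis
        using init[OF that] r by simp
    qed
    then have tU: "t \<in> {t \<in> {a<..<b}. \<gamma> t \<in> U}"
      using tS by (auto simp: U_def S_def Y_def d_def)
    have "open {t \<in> {a<..<b}. \<gamma> t \<in> U}"
      unfolding U_def by (intro chart(1) open_chart_cube c)
    then obtain e where e: "e > 0" "ball t e \<subseteq> {t \<in> {a<..<b}. \<gamma> t \<in> U}"
      using tU by (meson openE)
    have "\<forall>i\<in>{..<d}. \<forall>\<^sub>F s in at t. \<bar>deriv (Y i) s\<bar> < 2 * r"
    proof
      fix i assume i: "i \<in> {..<d}"
      have "\<bar>deriv (Y i) t - deriv (Y i) 0\<bar> \<le> K1 * (2 * r)\<^sup>2"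
        using solution_velocity[OF sol_t, of t i] t i r by auto
      moreover have "\<bar>deriv (Y i) 0\<bar> \<le> r"
        using i init1 u by (auto simp: d_def)
      ultimately have "\<bar>deriv (Y i) t\<bar> < 2 * r"
        using r(3) by (simp add: d_def)
      moreover have "((\<lambda>s. \<bar>deriv (Y i) s\<bar>) \<longlongrightarrow> \<bar>deriv (Y i) t\<bar>) (at t)"
        using DERIV_isCont[OF Y2[OF tS]] i by (intro tendsto_rabs) (auto simp: isCont_def)
      ultimately show "\<forall>\<^sub>F s in at t. \<bar>deriv (Y i) s\<bar> < 2 * r"
        by (simp add: order_tendstoD(2))
    qed
    then have "\<forall>\<^sub>F s in at t. \<forall>i\<in>{..<d}. \<bar>deriv (Y i) s\<bar> < 2 * r"
      by (simp add: eventually_ball_finite)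
    then obtain e' where e': "e' > 0" "\<And>s i. \<lbrakk>s \<noteq> t; dist s t < e'; i < d\<rbrakk> \<Longrightarrow> \<bar>deriv (Y i) s\<bar> < 2 * r"
      by (auto simp: eventually_at)
    have "P s" if s: "t < s \<and> s < t + min e e'" for s
    proof -
      have "\<gamma> s \<in> U"
        using e(2) s by (auto simp: subset_eq dist_real_def)
      then have "\<gamma> s \<in> chart_dom c" "coord c (\<gamma> s) \<in> B"
        using coord_ge_dim[OF c] by (auto simp: U_def B_def cube_def d_def less_imp_le)
      moreover have "\<bar>deriv (Y i) s\<bar> \<le> 2 * r" if "i < d" for i
        using e'(2)[of s i] s that by (auto simp: dist_real_def min_def split: if_splits)
      ultimately show ?thesis
        by (simp add: P_def)
    qed
    then show "\<exists>e>0. \<forall>s. t < s \<and> s < t + e \<longrightarrow> P s"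
      using e e' by (intro exI[of _ "min e e'"]) auto
  next
    fix t :: real assume t: "0 < t" "t \<le> 1" and Pt: "\<forall>s\<in>{0..<t}. P s"
    define K where "K = {p \<in> chart_dom c. coord c p \<in> cube (mdim M) (coord c x) \<rho>}"
    have approach: "\<exists>s\<in>{0..<t}. s \<in> W" if W: "open W" "t \<in> W" for W
    proof -
      obtain e where "e > 0" "ball t e \<subseteq> W"
        using W by (meson openE)
      then show ?thesis
        using t by (intro bexI[of _ "max 0 (t - e / 2)"]) (auto simp: subset_eq dist_real_def)
    qed
    \<comment> \<open>All earlier positions lie in \<open>K\<close>, which is closed in
      \<open>M\<close>, so the position at time \<open>t\<close> does too. Only after that is
      \<open>t\<close> known to belong to \<open>S\<close>, where the velocity in coordinates is
      continuous.\<close>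
    have tK: "\<gamma> t \<in> K"
    proof (rule ccontr)
      assume "\<gamma> t \<notin> K"
      have "\<gamma> t \<in> points M"
        using ab(3) t ab(1,2) continuous_map_image_subset_topspace[of "top_of_set {a<..<b}" "mtop M" \<gamma>]
        by (auto simp: geodesic_def smooth_curve_def)
      then have "t \<in> {t \<in> {a<..<b}. \<gamma> t \<in> points M - K}"
        using \<open>\<gamma> t \<notin> K\<close> t ab by auto
      moreover have "open {t \<in> {a<..<b}. \<gamma> t \<in> points M - K}"
        using closed_chart_cube[OF c sub] by (intro chart(1)) (auto simp: K_def closedin_def)
      ultimately obtain s where "s \<in> {0..<t}" "\<gamma> s \<notin> K"
        using approach by blast
      then show False
        using Pt by (auto simp: P_def K_def B_def d_def)
    qed
    then have tS: "t \<in> S"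
      using t ab by (auto simp: K_def S_def)
    have "\<bar>deriv (Y i) t\<bar> \<le> 2 * r" if "i < d" for i
    proof (rule ccontr)
      assume no: "\<not> ?thesis"
      have "continuous_on S (\<lambda>s. \<bar>deriv (Y i) s\<bar>)"
        using Y2 that by (intro continuous_on_rabs continuous_at_imp_continuous_on) (auto intro: DERIV_isCont)
      then have "open (S \<inter> (\<lambda>s. \<bar>deriv (Y i) s\<bar>) -` {2 * r<..})"
        using openS by (rule continuous_open_preimage) auto
      then obtain s where "s \<in> {0..<t}" "\<bar>deriv (Y i) s\<bar> > 2 * r"
        using approach[of "S \<inter> (\<lambda>s. \<bar>deriv (Y i) s\<bar>) -` {2 * r<..}"] tS no by auto
      moreover from this(1) have "P s"
        using Pt by blast
      ultimately show False
        using that by (force simp: P_def)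
    qed
    then show "P t"
      using tK by (auto simp: P_def K_def B_def d_def)
  qed
  show "geodesic_system.solution (mdim M) (cube (mdim M) (coord c x) \<rho>) (met_coeff M c) (christoffel M c)
      1 (2 * r) Y (\<lambda>i. deriv (Y i)) (\<lambda>i. deriv (deriv (Y i)))"
    using sol[of 1] P by (simp add: d_def B_def)
  show "\<gamma> 1 \<in> chart_dom c"
    using P[of 1] by (simp add: P_def)
  show "i < mdim M \<Longrightarrow> Y i 0 = coord c x i" "i < mdim M \<Longrightarrow> deriv (Y i) 0 = dcoord c x u i"
    using init init1 by (simp_all add: d_def)
qed

text \<open>As \<open>exp_map\<close> is a definite description, its value has to be pinned down
  first: two geodesics with the same short initial vector have the same endpoint, by the difference
  estimate with \<open>m = 0\<close>. The last two estimates are \<open>solution_endpoint\<close>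
  and \<open>solution_difference\<close> for the speed bound \<open>P = 2 * r\<close>.\<close>

lemma exp_map_estimates:
  obtains r0 K where "r0 > 0" "K \<ge> 0"
    "\<And>u \<gamma>. \<lbrakk>exp_curve M x u \<gamma>; \<And>i. i < mdim M \<Longrightarrow> \<bar>dcoord c x u i\<bar> \<le> r0\<rbrakk> \<Longrightarrow> exp_map M x u = \<gamma> 1"
    "\<And>u. \<lbrakk>u \<in> exp_dom M x; \<And>i. i < mdim M \<Longrightarrow> \<bar>dcoord c x u i\<bar> \<le> r0\<rbrakk> \<Longrightarrow> exp_map M x u \<in> chart_dom c"
    "\<And>r u i. \<lbrakk>0 < r; r \<le> r0; u \<in> exp_dom M x; \<And>i. i < mdim M \<Longrightarrow> \<bar>dcoord c x u i\<bar> \<le> r; i < mdim M\<rbrakk>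
      \<Longrightarrow> \<bar>coord c (exp_map M x u) i - coord c x i - dcoord c x u i\<bar> \<le> K * r\<^sup>2"
    "\<And>r u w m i. \<lbrakk>0 < r; r \<le> r0; u \<in> exp_dom M x; \<And>i. i < mdim M \<Longrightarrow> \<bar>dcoord c x u i\<bar> \<le> r;
        w \<in> exp_dom M x; \<And>i. i < mdim M \<Longrightarrow> \<bar>dcoord c x w i\<bar> \<le> r;
        \<And>i. i < mdim M \<Longrightarrow> \<bar>dcoord c x u i - dcoord c x w i\<bar> \<le> m; i < mdim M\<rbrakk>
      \<Longrightarrow> \<bar>(coord c (exp_map M x u) i - dcoord c x u i) - (coord c (exp_map M x w) i - dcoord c x w i)\<bar>
            \<le> K * r * m"
proof -
  define d where "d = mdim M"
  obtain \<rho> L lam where \<rho>: "\<rho> > 0" "cube d (coord c x) \<rho> \<subseteq> coord c ` chart_dom c"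
    and sys: "geodesic_system d (cube d (coord c x) \<rho>) (met_coeff M c) (christoffel M c) L lam"
    using geodesic_system_at[OF c x] unfolding d_def by blast
  define B where "B = cube d (coord c x) \<rho>"
  interpret geodesic_system d B "met_coeff M c" "christoffel M c" L lam
    using sys by (simp add: B_def)
  \<comment> \<open>In this order the four bounds secure \<open>2 * r < \<rho>\<close>,
    \<open>2 * r \<le> 1\<close>, the absorption condition \<open>K2 * (2 * r) \<le> 1 / 2\<close>,
    and the condition \<open>K1 * (2 * r)^2 < r\<close> that traps the speed below
    \<open>2 * r\<close>.\<close>
  define r0 where "r0 = Min {\<rho> / 4, 1 / 2, 1 / (4 * K2 + 1), 1 / (4 * K1 + 1) / 2}"
  have "r0 \<le> \<rho> / 4" and r0_half: "r0 \<le> 1 / 2" and r0_K2: "r0 \<le> 1 / (4 * K2 + 1)"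
    and r0_K1: "r0 \<le> 1 / (4 * K1 + 1) / 2"
    by (auto simp: r0_def)
  have r0: "r0 > 0"
    using \<rho>(1) K_nonneg by (auto simp: r0_def intro!: divide_pos_pos add_nonneg_pos)
  have small: "2 * r < \<rho>" "2 * r \<le> 1" "K2 * (2 * r) \<le> 1 / 2" "K1 * (2 * r)\<^sup>2 < r" if r: "0 < r" "r \<le> r0" for r
  proof -
    show "2 * r < \<rho>" "2 * r \<le> 1"
      using r \<open>r0 \<le> \<rho> / 4\<close> r0_half \<rho>(1) by auto
    have "r * (4 * K2 + 1) \<le> 1"
      using order_trans[OF r(2) r0_K2] K_nonneg by (simp add: pos_le_divide_eq add_nonneg_pos)
    then show "K2 * (2 * r) \<le> 1 / 2"
      using r by (simp add: algebra_simps)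
    have "r \<le> 1 / (4 * K1 + 1) / 2"
      using r r0_K1 by simp
    then have "2 * r * (4 * K1 + 1) \<le> 1"
      using K_nonneg by (simp add: field_simps add_nonneg_pos)
    then have "4 * K1 * r \<le> 1 / 2"
      using r by (simp add: algebra_simps)
    then have "(4 * K1 * r) * r \<le> 1 / 2 * r"
      using r by (intro mult_right_mono) auto
    then show "K1 * (2 * r)\<^sup>2 < r"
      using r by (simp add: power2_eq_square algebra_simps)
  qed
  have sol: "solution 1 (2 * r) (\<lambda>i t. coord c (\<gamma> t) i) (\<lambda>i. deriv (\<lambda>t. coord c (\<gamma> t) i))
        (\<lambda>i. deriv (deriv (\<lambda>t. coord c (\<gamma> t) i)))"
      "\<gamma> 1 \<in> chart_dom c" "\<And>i. i < d \<Longrightarrow> coord c (\<gamma> 0) i = coord c x i"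
      "\<And>i. i < d \<Longrightarrow> deriv (\<lambda>t. coord c (\<gamma> t) i) 0 = dcoord c x u i"
    if "0 < r" "r \<le> r0" "\<And>i. i < d \<Longrightarrow> \<bar>dcoord c x u i\<bar> \<le> r" "exp_curve M x u \<gamma>" for r u \<gamma>
    using exp_curve_solution[OF sys[unfolded d_def] \<rho>(2)[unfolded d_def] that(1), of u \<gamma>] small[OF that(1,2)] that
    by (simp_all add: d_def B_def)
  have diff: "\<bar>(coord c (\<gamma> 1) i - coord c (\<eta> 1) i) - (dcoord c x u i - dcoord c x w i)\<bar> \<le> 2 * K2 * (2 * r) * m"
    if r: "0 < r" "r \<le> r0" and u: "\<And>i. i < d \<Longrightarrow> \<bar>dcoord c x u i\<bar> \<le> r" "exp_curve M x u \<gamma>"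
      and w: "\<And>i. i < d \<Longrightarrow> \<bar>dcoord c x w i\<bar> \<le> r" "exp_curve M x w \<eta>"
      and m: "\<And>i. i < d \<Longrightarrow> \<bar>dcoord c x u i - dcoord c x w i\<bar> \<le> m" and "i < d"
    for r u w \<gamma> \<eta> m i
    using solution_difference[OF sol(1)[OF r u] sol(1)[OF r w] _ _ _ _ _ \<open>i < d\<close>, of m]
      sol(3,4)[OF r u] sol(3,4)[OF r w] small[OF r] r m \<open>i < d\<close> by auto
  have exp_map_eq: "exp_map M x u = \<gamma> 1" if u: "exp_curve M x u \<gamma>" "\<And>i. i < d \<Longrightarrow> \<bar>dcoord c x u i\<bar> \<le> r0" for u \<gamma>
    unfolding exp_map_def
  proof (rule the_equality)
    show "\<exists>\<gamma>'. exp_curve M x u \<gamma>' \<and> \<gamma>' 1 = \<gamma> 1"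
      using u by blast
    fix y assume "\<exists>\<gamma>'. exp_curve M x u \<gamma>' \<and> \<gamma>' 1 = y"
    then obtain \<eta> where \<eta>: "exp_curve M x u \<eta>" "\<eta> 1 = y"
      by blast
    have "coord c (\<eta> 1) i = coord c (\<gamma> 1) i" if "i < d" for i
      using diff[OF r0 order_refl u(2) \<eta>(1) u(2,1), of 0 i] that by simp
    moreover have dom: "\<eta> 1 \<in> chart_dom c" "\<gamma> 1 \<in> chart_dom c"
      using sol(2)[OF r0 order_refl u(2)] \<eta>(1) u(1) by auto
    ultimately have "coord c (\<eta> 1) i = coord c (\<gamma> 1) i" for i
      using coord_ge_dim[OF c] by (cases "i < d") (auto simp: d_def)
    then have "coord c (\<eta> 1) = coord c (\<gamma> 1)"
      by blast
    then show "y = \<gamma> 1"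
      using inj_onD[OF coord_inj_on[OF c] _ dom] \<eta>(2) by simp
  qed
  \<comment> \<open>With \<open>P = 2 * r\<close> the two estimates have the constants
    \<open>K1 * P^2 = 4 * K1 * r^2\<close> and \<open>2 * K2 * P = 4 * K2 * r\<close>.\<close>
  define K where "K = 4 * K1 + 4 * K2"
  have K: "K \<ge> 0"
    using K_nonneg by (simp add: K_def)
  show thesis
  proof (rule that[OF r0 K], fold d_def)
    fix u \<gamma> assume "exp_curve M x u \<gamma>" "\<And>i. i < d \<Longrightarrow> \<bar>dcoord c x u i\<bar> \<le> r0"
    then show "exp_map M x u = \<gamma> 1"
      by (rule exp_map_eq)
  next
    fix u assume "u \<in> exp_dom M x" and u: "\<And>i. i < d \<Longrightarrow> \<bar>dcoord c x u i\<bar> \<le> r0"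
    then obtain \<gamma> where \<gamma>: "exp_curve M x u \<gamma>"
      by (auto simp: exp_dom_def)
    show "exp_map M x u \<in> chart_dom c"
      using exp_map_eq[OF \<gamma> u] sol(2)[OF r0 order_refl u \<gamma>] by simp
  next
    fix r u i
    assume r: "0 < r" "r \<le> r0" and u: "u \<in> exp_dom M x" "\<And>i. i < d \<Longrightarrow> \<bar>dcoord c x u i\<bar> \<le> r" and i: "i < d"
    obtain \<gamma> where \<gamma>: "exp_curve M x u \<gamma>"
      using u by (auto simp: exp_dom_def)
    have "\<bar>coord c (\<gamma> 1) i - coord c x i - dcoord c x u i\<bar> \<le> K1 * (2 * r)\<^sup>2"
      using solution_endpoint[OF sol(1)[OF r u(2) \<gamma>] _ i] sol(3,4)[OF r u(2) \<gamma>] i r by simp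
    also have "\<dots> \<le> K * r\<^sup>2"
      using K_nonneg by (simp add: K_def power_mult_distrib distrib_right)
    finally show "\<bar>coord c (exp_map M x u) i - coord c x i - dcoord c x u i\<bar> \<le> K * r\<^sup>2"
      using exp_map_eq[OF \<gamma> order_trans[OF u(2) r(2)]] by simp
  next
    fix r u w m i
    assume r: "0 < r" "r \<le> r0" and u: "u \<in> exp_dom M x" "\<And>i. i < d \<Longrightarrow> \<bar>dcoord c x u i\<bar> \<le> r"
      and w: "w \<in> exp_dom M x" "\<And>i. i < d \<Longrightarrow> \<bar>dcoord c x w i\<bar> \<le> r"
      and m: "\<And>i. i < d \<Longrightarrow> \<bar>dcoord c x u i - dcoord c x w i\<bar> \<le> m" and i: "i < d"
    obtain \<gamma> \<eta> where \<gamma>: "exp_curve M x u \<gamma>" and \<eta>: "exp_curve M x w \<eta>"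
      using u w by (auto simp: exp_dom_def)
    have "m \<ge> 0"
      using m[OF i] by linarith
    have "\<bar>(coord c (\<gamma> 1) i - coord c (\<eta> 1) i) - (dcoord c x u i - dcoord c x w i)\<bar> \<le> 2 * K2 * (2 * r) * m"
      using diff[OF r u(2) \<gamma> w(2) \<eta> m i] .
    also have "\<dots> \<le> K * r * m"
      using K_nonneg r \<open>m \<ge> 0\<close> by (auto simp: K_def distrib_right intro!: mult_right_mono)
    finally show "\<bar>(coord c (exp_map M x u) i - dcoord c x u i) - (coord c (exp_map M x w) i - dcoord c x w i)\<bar>
        \<le> K * r * m"
      using exp_map_eq[OF \<gamma> order_trans[OF u(2) r(2)]] exp_map_eq[OF \<eta> order_trans[OF w(2) r(2)]]
      by (simp add: algebra_simps)
  qed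
qed

end

text \<open>The derivative of order \<open>k\<close> picks up the factor \<open>\<tau> ^ k\<close>.
  The case \<open>\<tau> = 1\<close> is restriction to a smaller interval, and is used as such in
  \<open>unit_tangents_Un_closed\<close>.\<close>

lemma smooth_curve_scale:
  assumes sm: "smooth_curve M J \<gamma>" and I: "(\<lambda>s. \<tau> * s) ` I \<subseteq> J"
  shows "smooth_curve M I (\<lambda>s. \<gamma> (\<tau> * s))"
  unfolding smooth_curve_def
proof (intro conjI ballI allI impI)
  have "continuous_map (top_of_set I) (top_of_set J) (\<lambda>s. \<tau> * s)"
    using I by (auto simp: continuous_map_in_subtopology intro!: continuous_intros)
  moreover have "continuous_map (top_of_set J) (mtop M) \<gamma>"
    using sm by (simp add: smooth_curve_def)
  ultimately have "continuous_map (top_of_set I) (mtop M) (\<gamma> \<circ> (\<lambda>s. \<tau> * s))"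
    by (rule continuous_map_compose)
  then show "continuous_map (top_of_set I) (mtop M) (\<lambda>s. \<gamma> (\<tau> * s))"
    by (simp add: o_def)
  fix c i assume "c \<in> atlas M" "i < mdim M"
  define S where "S = {t \<in> J. \<gamma> t \<in> chart_dom c}"
  have "smooth_real_on S (\<lambda>t. coord c (\<gamma> t) i)"
    using sm \<open>c \<in> atlas M\<close> \<open>i < mdim M\<close> by (simp add: smooth_curve_def S_def)
  then obtain D where D: "\<And>t. t \<in> S \<Longrightarrow> D 0 t = coord c (\<gamma> t) i"
    "\<And>k t. t \<in> S \<Longrightarrow> (D k has_real_derivative D (Suc k) t) (at t within S)"
    unfolding smooth_real_on_def by blast
  have S: "(\<lambda>s. \<tau> * s) ` {s \<in> I. \<gamma> (\<tau> * s) \<in> chart_dom c} \<subseteq> S"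
    using I by (auto simp: S_def)
  show "smooth_real_on {s \<in> I. \<gamma> (\<tau> * s) \<in> chart_dom c} (\<lambda>s. coord c (\<gamma> (\<tau> * s)) i)"
    unfolding smooth_real_on_def
  proof (intro exI[of _ "\<lambda>k s. \<tau> ^ k * D k (\<tau> * s)"] conjI ballI allI)
    fix s k assume s: "s \<in> {s \<in> I. \<gamma> (\<tau> * s) \<in> chart_dom c}"
    then have "((\<lambda>s. D k (\<tau> * s)) has_real_derivative \<tau> * D (Suc k) (\<tau> * s))
      (at s within {s \<in> I. \<gamma> (\<tau> * s) \<in> chart_dom c})"
      using S by (intro has_derivative_scale[OF D(2) S]) auto
    from DERIV_cmult[OF this, of "\<tau> ^ k"]
    show "((\<lambda>s. \<tau> ^ k * D k (\<tau> * s)) has_real_derivative \<tau> ^ Suc k * D (Suc k) (\<tau> * s))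
        (at s within {s \<in> I. \<gamma> (\<tau> * s) \<in> chart_dom c})"
      by (simp add: mult_ac)
  qed (use D(1) S in auto)
qed

lemma has_velocity_scale:
  assumes v: "has_velocity M J \<gamma> 0 u" and I: "(\<lambda>s. \<tau> * s) ` I \<subseteq> J" and x: "\<gamma> 0 \<in> points M"
  shows "has_velocity M I (\<lambda>s. \<gamma> (\<tau> * s)) 0 (\<tau> *\<^sub>R u)"
  unfolding has_velocity_def
proof (intro conjI ballI impI allI)
  have u: "u \<in> tangent M (\<gamma> 0)"
    using v by (simp add: has_velocity_def)
  then show "\<tau> *\<^sub>R u \<in> tangent M (\<gamma> (\<tau> * 0))"
    using tangent_subspace[OF x] by (simp add: subspace_scale)
  fix c i assume c: "c \<in> atlas M" "\<gamma> (\<tau> * 0) \<in> chart_dom c" "i < mdim M"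
  then have "((\<lambda>t. coord c (\<gamma> t) i) has_real_derivative dcoord c (\<gamma> 0) u i) (at (\<tau> * 0) within J)"
    using v by (auto simp: has_velocity_def)
  from has_derivative_scale[OF this I]
  show "((\<lambda>s. coord c (\<gamma> (\<tau> * s)) i) has_real_derivative dcoord c (\<gamma> (\<tau> * 0)) (\<tau> *\<^sub>R u) i) (at 0 within I)"
    using c dcoord_scale[of c "\<gamma> 0" u \<tau> i] u by simp
qed

text \<open>Both terms of the geodesic equation are multiplied by the square of
  \<open>\<tau>\<close>. The interval becomes \<open>{a / \<tau><..<b / \<tau>}\<close>, which still
  reaches beyond 1 because \<open>\<tau> \<le> 1\<close>; thus a single geodesic describes
  \<open>exp_map\<close> along a whole segment from 0.\<close>

lemma exp_curve_scale:
  assumes ex: "exp_curve M x u \<gamma>" and \<tau>: "0 < \<tau>" "\<tau> \<le> 1" and x: "x \<in> points M"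
  shows "exp_curve M x (\<tau> *\<^sub>R u) (\<lambda>s. \<gamma> (\<tau> * s))"
proof -
  obtain a b where ab: "a < 0" "1 < b" "geodesic M {a<..<b} \<gamma>" "\<gamma> 0 = x" "has_velocity M {a<..<b} \<gamma> 0 u"
    using ex by (auto simp: exp_curve_def)
  define I where "I = {a / \<tau><..<b / \<tau>}"
  have I: "\<tau> * s \<in> {a<..<b} \<longleftrightarrow> s \<in> I" for s
    using \<tau> by (auto simp: I_def field_simps)
  then have I': "(\<lambda>s. \<tau> * s) ` I \<subseteq> {a<..<b}"
    by blast
  have sm: "smooth_curve M {a<..<b} \<gamma>"
    using ab by (simp add: geodesic_def)
  have "smooth_curve M I (\<lambda>s. \<gamma> (\<tau> * s))"
    using smooth_curve_scale[OF sm I'] .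
  moreover have "(\<Sum>k<mdim M. met_coeff M c l k (coord c (\<gamma> (\<tau> * t))) * deriv (deriv (\<lambda>s. coord c (\<gamma> (\<tau> * s)) k)) t)
           + (\<Sum>i<mdim M. \<Sum>j<mdim M.
                christoffel M c l i j (coord c (\<gamma> (\<tau> * t))) * deriv (\<lambda>s. coord c (\<gamma> (\<tau> * s)) i) t *
                  deriv (\<lambda>s. coord c (\<gamma> (\<tau> * s)) j) t) = 0"
    if c: "c \<in> atlas M" and t: "t \<in> I" "\<gamma> (\<tau> * t) \<in> chart_dom c" and l: "l < mdim M" for c t l
  proof -
    define Y where "Y i t = coord c (\<gamma> t) i" for i t
    define S where "S = {t \<in> {a<..<b}. \<gamma> t \<in> chart_dom c}"
    note chart = geodesic_in_chart[OF c ab(3), folded S_def]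
    have openS: "open S"
      unfolding S_def using chart(1) chart_dom_open[OF c] .
    have Y: "(Y i has_real_derivative deriv (Y i) t) (at t)"
      "(deriv (Y i) has_real_derivative deriv (deriv (Y i)) t) (at t)" if "t \<in> S" "i < mdim M" for t i
      using chart(2,3)[OF that] unfolding Y_def by auto
    have Y1: "deriv (\<lambda>s. Y i (\<tau> * s)) s = \<tau> * deriv (Y i) (\<tau> * s)" if "\<tau> * s \<in> S" "i < mdim M" for s i
      by (rule DERIV_imp_deriv) (use has_derivative_scale[OF Y(1)[OF that], of UNIV] in simp)
    have Y2: "deriv (deriv (\<lambda>s. Y i (\<tau> * s))) t = \<tau> * (\<tau> * deriv (deriv (Y i)) (\<tau> * t))" if "\<tau> * t \<in> S" "i < mdim M" for i
    proof (rule DERIV_imp_deriv, rule has_field_derivative_transform_within_open)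
      show "((\<lambda>s. \<tau> * deriv (Y i) (\<tau> * s)) has_real_derivative \<tau> * (\<tau> * deriv (deriv (Y i)) (\<tau> * t))) (at t)"
        by (rule DERIV_cmult) (use has_derivative_scale[OF Y(2)[OF that], of UNIV] in simp)
      show "open ((\<lambda>s. \<tau> * s) -` S)"
        using openS by (intro open_vimage) (auto intro!: continuous_intros)
    qed (use that Y1 in auto)
    have tS: "\<tau> * t \<in> S"
      using t I by (simp add: S_def)
    have "(\<Sum>k<mdim M. met_coeff M c l k (coord c (\<gamma> (\<tau> * t))) * deriv (deriv (\<lambda>s. Y k (\<tau> * s))) t)
           + (\<Sum>i<mdim M. \<Sum>j<mdim M.
                christoffel M c l i j (coord c (\<gamma> (\<tau> * t))) * deriv (\<lambda>s. Y i (\<tau> * s)) t *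
                  deriv (\<lambda>s. Y j (\<tau> * s)) t)
      = \<tau> * \<tau> * ((\<Sum>k<mdim M. met_coeff M c l k (coord c (\<gamma> (\<tau> * t))) * deriv (deriv (Y k)) (\<tau> * t))
           + (\<Sum>i<mdim M. \<Sum>j<mdim M.
                christoffel M c l i j (coord c (\<gamma> (\<tau> * t))) * deriv (Y i) (\<tau> * t) * deriv (Y j) (\<tau> * t)))"
      by (simp only: distrib_left sum_distrib_left, intro arg_cong2[where f = "(+)"] sum.cong refl)
        (simp_all add: Y1[OF tS] Y2[OF tS] mult.assoc mult.left_commute)
    also have "\<dots> = 0"
      using chart(4)[OF tS l] unfolding Y_def by simp
    finally show ?thesis
      unfolding Y_def .
  qed
  ultimately have "geodesic M I (\<lambda>s. \<gamma> (\<tau> * s))"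
    by (simp add: geodesic_def Let_def)
  moreover have "has_velocity M I (\<lambda>s. \<gamma> (\<tau> * s)) 0 (\<tau> *\<^sub>R u)"
    using has_velocity_scale[OF ab(5) I'] ab(4) x by simp
  moreover have "a / \<tau> < 0" "1 < b / \<tau>"
    using ab \<tau> by (auto simp: field_simps)
  ultimately show ?thesis
    using ab(4) unfolding exp_curve_def I_def by auto
qed

end

section \<open>Exponential images of cones\<close>

lemma finite_abs_bounded:
  fixes f :: "nat \<Rightarrow> real"
  shows "\<exists>A>0. \<forall>i<d. \<bar>f i\<bar> \<le> A"
proof (intro exI[of _ "(\<Sum>i<d. \<bar>f i\<bar>) + 1"] conjI allI impI)
  show "\<bar>f i\<bar> \<le> (\<Sum>i<d. \<bar>f i\<bar>) + 1" if "i < d" for i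
    using member_le_sum[of i "{..<d}" "\<lambda>i. \<bar>f i\<bar>"] that by auto
qed (auto intro!: add_nonneg_pos sum_nonneg)

context riemannian_atlas
begin

text \<open>With \<open>u = t *\<^sub>R v + w\<close> and
  \<open>nrm w \<le> \<kappa> \<le> \<delta> / 4 * t\<close>, the product \<open>met M x u v\<close>
  is at least \<open>t - \<kappa>\<close> and \<open>nrm u\<close> at most
  \<open>t + \<kappa>\<close>; for \<open>\<delta> < 1\<close> the angle condition follows from
  \<open>2 * \<kappa> < \<delta> * t\<close>. So a thin cone in coordinates fits into the metric
  cone.\<close>

lemma cone_near:
  assumes c: "c \<in> atlas M" and x: "x \<in> chart_dom c" and v: "v \<in> unit_vectors M x" and "\<delta> > 0"
  shows "\<exists>\<epsilon>>0. \<exists>t0>0. \<forall>t u. 0 < t \<and> t < t0 \<and> u \<in> tangent M x \<and>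
    (\<forall>i<mdim M. \<bar>dcoord c x u i - t * dcoord c x v i\<bar> \<le> \<epsilon> * t) \<longrightarrow> u \<in> cone M x v \<delta>"
proof -
  have xp: "x \<in> points M"
    using chart_dom_points[OF c x] .
  interpret finite_inner_subspace "tangent M x" "met M x" "mdim M"
    using finite_inner_subspace[OF xp] .
  have vT: "v \<in> tangent M x" "met M x v v = 1" "nrm v = 1"
    using v by (auto simp: unit_vectors_def nrm_def)
  obtain C where C: "C \<ge> 0" "\<And>u e. \<lbrakk>u \<in> tangent M x; \<forall>i<mdim M. \<bar>dcoord c x u i\<bar> \<le> e\<rbrakk> \<Longrightarrow> nrm u \<le> C * e"
    using nrm_bounded[OF c x] by blast
  \<comment> \<open>The bound \<open>1 / 2\<close> gives \<open>\<kappa> \<le> t / 2\<close>, hence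
    \<open>t + \<kappa> < \<delta>\<close> for \<open>t < \<delta> / 2\<close>, and
    \<open>t - \<kappa> > 0\<close>, which settles the angle condition for
    \<open>\<delta> \<ge> 1\<close>; the bound \<open>\<delta> / 4\<close> is for
    \<open>\<delta> < 1\<close>.\<close>
  define \<mu> where "\<mu> = min (1 / 2) (\<delta> / 4)"
  define \<epsilon> where "\<epsilon> = \<mu> / (C + 1)"
  have \<mu>: "\<mu> > 0" "\<mu> \<le> 1 / 2" "\<mu> \<le> \<delta> / 4"
    using \<open>\<delta> > 0\<close> by (auto simp: \<mu>_def)
  have \<epsilon>: "\<epsilon> > 0"
    using C(1) \<mu> by (simp add: \<epsilon>_def)
  have "C * \<epsilon> \<le> \<mu>"
    using C(1) \<mu>(1) by (simp add: \<epsilon>_def field_simps)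
  then have \<kappa>: "C * \<epsilon> \<le> 1 / 2" "C * \<epsilon> \<le> \<delta> / 4" "0 \<le> C * \<epsilon>"
    using C(1) \<epsilon> \<mu> by auto
  have "u \<in> cone M x v \<delta>"
    if t: "0 < t" "t < \<delta> / 2" and u: "u \<in> tangent M x"
      and near: "\<forall>i<mdim M. \<bar>dcoord c x u i - t * dcoord c x v i\<bar> \<le> \<epsilon> * t" for t u
  proof -
    define w where "w = u - t *\<^sub>R v"
    have w: "w \<in> tangent M x"
      using u vT by (simp add: w_def)
    have uw: "u = t *\<^sub>R v + w"
      by (simp add: w_def)
    define \<kappa> where "\<kappa> = C * \<epsilon> * t"
    have \<kappa>t: "0 \<le> \<kappa>" "\<kappa> \<le> t / 2" "\<kappa> \<le> \<delta> / 4 * t"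
      using mult_right_mono[OF \<kappa>(1), of t] mult_right_mono[OF \<kappa>(2), of t] \<kappa>(3) t by (auto simp: \<kappa>_def)
    have nw: "nrm w \<le> \<kappa>"
      using C(2)[OF w, of "\<epsilon> * t"] near u vT
      by (simp add: w_def dcoord_diff[OF c x] dcoord_scale[OF c x] \<kappa>_def mult.assoc)
    have "met M x u v = t + met M x w v"
      using w vT by (simp add: uw expand)
    moreover have "\<bar>met M x w v\<bar> \<le> \<kappa>"
      using Cauchy_Schwarz[OF w vT(1)] nw vT(3) by simp
    ultimately have m: "t - \<kappa> \<le> met M x u v" "met M x u v \<le> t + \<kappa>"
      by linarith+
    have nu: "nrm u \<le> t + \<kappa>"
      using nrm_triangle[of "t *\<^sub>R v" w] nrm_scale[OF vT(1), of t] w vT nw t by (simp add: uw)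
    have "(1 - \<delta>) * nrm u < t - \<kappa>"
    proof (cases "\<delta> < 1")
      case True
      then have "(1 - \<delta>) * nrm u \<le> (1 - \<delta>) * (t + \<kappa>)"
        using nu by (intro mult_left_mono) auto
      also have "\<dots> = t + \<kappa> - \<delta> * t - \<delta> * \<kappa>"
        by (simp add: algebra_simps)
      also have "\<dots> < t - \<kappa>"
      proof -
        have "\<delta> * \<kappa> \<ge> 0" "\<delta> * t > 0"
          using \<kappa>t t \<open>\<delta> > 0\<close> by auto
        then show ?thesis
          using \<kappa>t(3) by simp
      qed
      finally show ?thesis .
    next
      case False
      then have "(1 - \<delta>) * nrm u \<le> 0"
        using u by (simp add: mult_nonpos_nonneg)
      then show ?thesis
        using \<kappa>t t by linarith
    qed
    then show ?thesis
      using m t \<kappa>t u vT(3) by (simp add: cone_def flip: nrm_eq_tnorm[OF xp])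
  qed
  then show ?thesis
    using \<epsilon> \<open>\<delta> > 0\<close> by (intro exI[of _ \<epsilon>] conjI exI[of _ "\<delta> / 2"]) auto
qed

text \<open>The points whose coordinates lie in a thin cone around \<open>v\<close> are exponentials: the
  inverse function theorem for \<open>exp\<^sub>x\<close>, in the quantitative form that \<open>exp\<^sub>x\<close> is a
  contractive perturbation of the identity.\<close>

lemma exp_cone_onto:
  assumes c: "c \<in> atlas M" and x: "x \<in> chart_dom c" and v: "v \<in> unit_vectors M x" and "\<delta> > 0"
    and dom: "cone M x v \<delta> \<subseteq> exp_dom M x"
  shows "\<exists>\<epsilon>>0. \<exists>t0>0. \<forall>t p. 0 < t \<and> t < t0 \<and> p \<in> chart_dom c \<and>
    (\<forall>i<mdim M. \<bar>coord c p i - coord c x i - t * dcoord c x v i\<bar> \<le> \<epsilon> * t) \<longrightarrow>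
      p \<in> exp_map M x ` cone M x v \<delta>"
proof -
  define d where "d = mdim M"
  define V where "V i = dcoord c x v i" for i
  have vT: "v \<in> tangent M x"
    using v by (simp add: unit_vectors_def)
  obtain \<epsilon>1 t1 where \<epsilon>1: "\<epsilon>1 > 0" and t1: "t1 > 0"
    and near: "\<And>t u. \<lbrakk>0 < t; t < t1; u \<in> tangent M x; \<forall>i<d. \<bar>dcoord c x u i - t * V i\<bar> \<le> \<epsilon>1 * t\<rbrakk>
      \<Longrightarrow> u \<in> cone M x v \<delta>"
    using cone_near[OF c x v \<open>\<delta> > 0\<close>] unfolding d_def V_def by blast
  show ?thesis
  proof (rule exp_map_estimates[OF c x, folded d_def])
    fix r0 K
    assume r0: "r0 > 0" and K: "K \<ge> 0"
      and "\<And>u \<gamma>. \<lbrakk>exp_curve M x u \<gamma>; \<And>i. i < d \<Longrightarrow> \<bar>dcoord c x u i\<bar> \<le> r0\<rbrakk> \<Longrightarrow> exp_map M x u = \<gamma> 1"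
      and est: "\<And>u. \<lbrakk>u \<in> exp_dom M x; \<And>i. i < d \<Longrightarrow> \<bar>dcoord c x u i\<bar> \<le> r0\<rbrakk> \<Longrightarrow> exp_map M x u \<in> chart_dom c"
      "\<And>r u i. \<lbrakk>0 < r; r \<le> r0; u \<in> exp_dom M x; \<And>i. i < d \<Longrightarrow> \<bar>dcoord c x u i\<bar> \<le> r; i < d\<rbrakk>
        \<Longrightarrow> \<bar>coord c (exp_map M x u) i - coord c x i - dcoord c x u i\<bar> \<le> K * r\<^sup>2"
      "\<And>r u w m i. \<lbrakk>0 < r; r \<le> r0; u \<in> exp_dom M x; \<And>i. i < d \<Longrightarrow> \<bar>dcoord c x u i\<bar> \<le> r;
          w \<in> exp_dom M x; \<And>i. i < d \<Longrightarrow> \<bar>dcoord c x w i\<bar> \<le> r;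
          \<And>i. i < d \<Longrightarrow> \<bar>dcoord c x u i - dcoord c x w i\<bar> \<le> m; i < d\<rbrakk>
        \<Longrightarrow> \<bar>(coord c (exp_map M x u) i - dcoord c x u i) - (coord c (exp_map M x w) i - dcoord c x w i)\<bar>
              \<le> K * r * m"
    define A where "A = (\<Sum>i<d. \<bar>V i\<bar>) + \<epsilon>1"
    have A: "A > 0" "\<And>i. i < d \<Longrightarrow> \<bar>V i\<bar> + \<epsilon>1 \<le> A"
      using \<epsilon>1 by (auto simp: A_def intro!: add_nonneg_pos sum_nonneg member_le_sum)
    \<comment> \<open>On the cube of radius \<open>\<epsilon>1 * t\<close> about
      \<open>t * V\<close> all coordinates are at most \<open>r = A * t\<close>. Besides
      \<open>t1\<close>, the bounds give \<open>r \<le> r0\<close>, the contraction constant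
      \<open>K * r \<le> 1 / 2\<close>, and an error of \<open>exp_map\<close> of at most
      \<open>K * r^2 \<le> \<epsilon>1 / 4 * t\<close>.\<close>
    define t0 where "t0 = Min {t1, r0 / A, 1 / (2 * (K * A + 1)), \<epsilon>1 / (4 * (K * A\<^sup>2 + 1))}"
    have KA: "K * A + 1 > 0" "K * A\<^sup>2 + 1 > 0"
      using K A(1) by (auto intro: add_nonneg_pos)
    have t0: "t0 > 0"
      using t1 r0 A(1) KA \<epsilon>1 by (simp add: t0_def)
    have t0_le: "t0 \<le> t1" "t0 \<le> r0 / A" "t0 \<le> 1 / (2 * (K * A + 1))" "t0 \<le> \<epsilon>1 / (4 * (K * A\<^sup>2 + 1))"
      by (auto simp: t0_def)
    have "p \<in> exp_map M x ` cone M x v \<delta>"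
      if t: "0 < t" "t < t0" and p: "p \<in> chart_dom c"
        and p_near: "\<forall>i<d. \<bar>coord c p i - coord c x i - t * V i\<bar> \<le> \<epsilon>1 / 4 * t" for t p
    proof -
      define r where "r = A * t"
      define a where "a i = t * V i" for i
      have r: "0 < r" "r \<le> r0" "K * r \<le> 1 / 2" "K * r\<^sup>2 \<le> \<epsilon>1 / 4 * t"
      proof -
        show "0 < r"
          using A t by (simp add: r_def)
        have "t \<le> r0 / A" "t \<le> 1 / (2 * (K * A + 1))" "t \<le> \<epsilon>1 / (4 * (K * A\<^sup>2 + 1))"
          using t t0_le by linarith+
        then have "t * A \<le> r0" "t * (2 * (K * A + 1)) \<le> 1" and q: "t * (4 * (K * A\<^sup>2 + 1)) \<le> \<epsilon>1"
          using A(1) KA by (simp_all add: pos_le_divide_eq)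
        then show "r \<le> r0" "K * r \<le> 1 / 2"
          using t by (simp_all add: r_def algebra_simps)
        have "4 * (K * A\<^sup>2) * t \<le> \<epsilon>1"
          using q t by (simp add: algebra_simps)
        then have "4 * (K * A\<^sup>2) * t * t \<le> \<epsilon>1 * t"
          using t by (intro mult_right_mono) auto
        then show "K * r\<^sup>2 \<le> \<epsilon>1 / 4 * t"
          by (simp add: r_def power2_eq_square algebra_simps)
      qed
      define u where "u z = tangent_vec c x z" for z
      have u: "u z \<in> cone M x v \<delta>" "u z \<in> exp_dom M x" "\<And>i. i < d \<Longrightarrow> dcoord c x (u z) i = z i" "\<And>i. i < d \<Longrightarrow> \<bar>dcoord c x (u z) i\<bar> \<le> r"
        if z: "z \<in> cube d a (\<epsilon>1 * t)" for z
      proof -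
        have uT: "u z \<in> tangent M x"
          using tangent_vec[OF c x] by (simp add: u_def)
        show dz: "dcoord c x (u z) i = z i" if "i < d" for i
          using dcoord_tangent_vec[OF c x] that by (simp add: u_def d_def)
        have za: "\<bar>z i - t * V i\<bar> \<le> \<epsilon>1 * t" if "i < d" for i
          using z that by (simp add: cube_def a_def)
        then show "u z \<in> cone M x v \<delta>"
          using near[OF t(1) _ uT] t t0_le dz by simp
        then show "u z \<in> exp_dom M x"
          using dom by blast
        have "\<bar>z i\<bar> \<le> r" if "i < d" for i
        proof -
          have "\<bar>z i\<bar> \<le> \<bar>t * V i\<bar> + \<epsilon>1 * t"
            using za[OF that] by linarith
          also have "\<dots> = (\<bar>V i\<bar> + \<epsilon>1) * t"
            using t by (simp add: abs_mult algebra_simps)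
          also have "\<dots> \<le> A * t"
            using A(2)[OF that] t by (intro mult_right_mono) auto
          finally show ?thesis
            by (simp add: r_def)
        qed
        then show "\<bar>dcoord c x (u z) i\<bar> \<le> r" if "i < d" for i
          using dz that by simp
      qed
      have aR: "a \<in> cube d a (\<epsilon>1 * t)"
        using dcoord_ge_dim[OF c x vT] t \<epsilon>1 by (simp add: cube_def a_def V_def d_def)
      \<comment> \<open>Here \<open>E z\<close> is the coordinate tuple of
        \<open>exp_map M x (u z)\<close>. Half the radius of the cube is available for the distance
        of \<open>p\<close> from \<open>E a\<close>: one quarter is the deviation of
        \<open>p\<close> from the ray, the other the error of \<open>exp_map\<close> at the
        centre.\<close>
      have "\<exists>z\<in>cube d a (\<epsilon>1 * t). \<forall>i<d. coord c (exp_map M x (u z)) i = coord c p i"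
      proof (rule perturbed_identity_onto)
        fix z w and m :: real and i
        assume z: "z \<in> cube d a (\<epsilon>1 * t)" "w \<in> cube d a (\<epsilon>1 * t)" and m: "m \<ge> 0" "\<forall>j<d. \<bar>z j - w j\<bar> \<le> m" and i: "i < d"
        have "\<bar>dcoord c x (u z) i - dcoord c x (u w) i\<bar> \<le> m" if "i < d" for i
          using u(3)[OF z(1) that] u(3)[OF z(2) that] m that by simp
        then have "\<bar>(coord c (exp_map M x (u z)) i - dcoord c x (u z) i) -
              (coord c (exp_map M x (u w)) i - dcoord c x (u w) i)\<bar> \<le> K * r * m"
          using est(3)[OF r(1,2) u(2)[OF z(1)] u(4)[OF z(1)] u(2)[OF z(2)] u(4)[OF z(2)] _ i] by blast
        also have "\<dots> \<le> 1 / 2 * m"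
          using r(3) m(1) by (rule mult_right_mono)
        finally show "\<bar>(coord c (exp_map M x (u z)) i - z i) - (coord c (exp_map M x (u w)) i - w i)\<bar> \<le> m / 2"
          using u(3)[OF z(1) i] u(3)[OF z(2) i] by simp
      next
        fix i assume i: "i < d"
        have "\<bar>coord c (exp_map M x (u a)) i - coord c x i - a i\<bar> \<le> \<epsilon>1 / 4 * t"
          using est(2)[OF r(1,2) u(2)[OF aR] u(4)[OF aR] i] u(3)[OF aR i] r(4) by simp
        moreover have "\<bar>coord c p i - coord c x i - a i\<bar> \<le> \<epsilon>1 / 4 * t"
          using p_near i by (simp add: a_def)
        ultimately show "\<bar>coord c p i - coord c (exp_map M x (u a)) i\<bar> \<le> \<epsilon>1 * t / 2"
          by linarith
      qed (use aR t \<epsilon>1 in \<open>auto simp: cube_def\<close>)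
      then obtain z where z: "z \<in> cube d a (\<epsilon>1 * t)" "\<forall>i<d. coord c (exp_map M x (u z)) i = coord c p i"
        by blast
      have e: "exp_map M x (u z) \<in> chart_dom c"
        using est(1)[OF u(2)[OF z(1)] order_trans[OF u(4)[OF z(1)] r(2)]] .
      have "coord c (exp_map M x (u z)) i = coord c p i" for i
        using z(2) coord_ge_dim[OF c e] coord_ge_dim[OF c p] by (cases "i < d") (auto simp: d_def)
      then have "coord c (exp_map M x (u z)) = coord c p"
        by blast
      then have "exp_map M x (u z) = p"
        using inj_onD[OF coord_inj_on[OF c]] e p by blast
      then show ?thesis
        using u(1)[OF z(1)] by blast
    qed
    then show ?thesis
      using t0 \<epsilon>1 unfolding d_def V_def by (intro exI[of _ "\<epsilon>1 / 4"] conjI exI[of _ t0]) auto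
  qed
qed

text \<open>By differentiability at 0, for small \<open>s > 0\<close> the coordinates of
  \<open>\<gamma> s\<close> differ from those of \<open>x\<close> plus \<open>s\<close> times those
  of \<open>v\<close> by at most \<open>e * s\<close>; this is the region covered by
  \<open>exp_cone_onto\<close>.\<close>

lemma curve_meets_exp_cone:
  assumes x: "x \<in> points M" and v: "v \<in> unit_vectors M x" and "\<delta> > 0" and dom: "cone M x v \<delta> \<subseteq> exp_dom M x"
    and \<gamma>: "\<epsilon> > 0" "smooth_curve M {0..<\<epsilon>} \<gamma>" "\<gamma> 0 = x" "has_velocity M {0..<\<epsilon>} \<gamma> 0 v"
  shows "\<exists>s\<in>{0..<\<epsilon>}. \<gamma> s \<in> exp_map M x ` cone M x v \<delta>"
proof -
  obtain c where c: "c \<in> atlas M" "x \<in> chart_dom c"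
    using x chart_cover by blast
  obtain e t0 where e: "e > 0" and t0: "t0 > 0"
    and onto: "\<And>t p. \<lbrakk>0 < t; t < t0; p \<in> chart_dom c;
      \<forall>i<mdim M. \<bar>coord c p i - coord c x i - t * dcoord c x v i\<bar> \<le> e * t\<rbrakk> \<Longrightarrow>
      p \<in> exp_map M x ` cone M x v \<delta>"
    using exp_cone_onto[OF c v \<open>\<delta> > 0\<close> dom] by blast
  have "\<forall>i\<in>{..<mdim M}. \<forall>\<^sub>F s in at 0 within {0..<\<epsilon>}.
      dist ((coord c (\<gamma> s) i - coord c (\<gamma> 0) i) / (s - 0)) (dcoord c x v i) < e"
  proof
    fix i assume "i \<in> {..<mdim M}"
    then have "((\<lambda>s. coord c (\<gamma> s) i) has_real_derivative dcoord c x v i) (at 0 within {0..<\<epsilon>})"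
      using \<gamma>(3,4) c by (auto simp: has_velocity_def)
    then have "((\<lambda>s. (coord c (\<gamma> s) i - coord c (\<gamma> 0) i) / (s - 0)) \<longlongrightarrow> dcoord c x v i) (at 0 within {0..<\<epsilon>})"
      by (simp add: has_field_derivative_iff)
    then show "\<forall>\<^sub>F s in at 0 within {0..<\<epsilon>}.
      dist ((coord c (\<gamma> s) i - coord c (\<gamma> 0) i) / (s - 0)) (dcoord c x v i) < e"
      using e by (rule tendstoD)
  qed
  then have "\<forall>\<^sub>F s in at 0 within {0..<\<epsilon>}. \<forall>i\<in>{..<mdim M}.
      dist ((coord c (\<gamma> s) i - coord c (\<gamma> 0) i) / (s - 0)) (dcoord c x v i) < e"
    by (simp add: eventually_ball_finite)
  then obtain \<eta> where \<eta>: "\<eta> > 0" "\<And>s i. \<lbrakk>s \<in> {0..<\<epsilon>}; s \<noteq> 0; dist s 0 < \<eta>; i < mdim M\<rbrakk> \<Longrightarrow>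
      dist ((coord c (\<gamma> s) i - coord c (\<gamma> 0) i) / (s - 0)) (dcoord c x v i) < e"
    by (auto simp: eventually_at)
  have "openin (top_of_set {0..<\<epsilon>}) {s \<in> topspace (top_of_set {0..<\<epsilon>}). \<gamma> s \<in> chart_dom c}"
    using \<gamma>(2) chart_dom_open[OF c(1)] unfolding smooth_curve_def
    by (intro openin_continuous_map_preimage[of _ "mtop M"]) auto
  then obtain W where W: "open W" "{s \<in> {0..<\<epsilon>}. \<gamma> s \<in> chart_dom c} = {0..<\<epsilon>} \<inter> W"
    by (auto simp: openin_open)
  then have "0 \<in> W"
    using \<gamma>(1,3) c by auto
  then obtain \<eta>' where \<eta>': "\<eta>' > 0" "ball 0 \<eta>' \<subseteq> W"
    using W by (meson openE)
  define s where "s = Min {\<epsilon>, t0, \<eta>, \<eta>'} / 2"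
  have "Min {\<epsilon>, t0, \<eta>, \<eta>'} > 0"
    using \<gamma>(1) t0 \<eta>(1) \<eta>'(1) by simp
  then have s: "0 < s" "s < \<epsilon>" "s < t0" "s < \<eta>" "s < \<eta>'"
    unfolding s_def by (auto simp: min_def split: if_splits)
  have "s \<in> {s \<in> {0..<\<epsilon>}. \<gamma> s \<in> chart_dom c}"
    using s \<eta>'(2) unfolding W(2) by (auto simp: subset_eq dist_real_def)
  moreover have "\<bar>coord c (\<gamma> s) i - coord c x i - s * dcoord c x v i\<bar> \<le> e * s" if "i < mdim M" for i
  proof -
    have "\<bar>(coord c (\<gamma> s) i - coord c x i) / s - dcoord c x v i\<bar> < e"
      using \<eta>(2)[of s i] s that \<gamma>(3) by (simp add: dist_real_def)
    then have "\<bar>(coord c (\<gamma> s) i - coord c x i) / s - dcoord c x v i\<bar> * s \<le> e * s"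
      using s by (intro mult_right_mono) auto
    also have "\<bar>(coord c (\<gamma> s) i - coord c x i) / s - dcoord c x v i\<bar> * s =
        \<bar>((coord c (\<gamma> s) i - coord c x i) / s - dcoord c x v i) * s\<bar>"
      using s by (simp add: abs_mult)
    also have "((coord c (\<gamma> s) i - coord c x i) / s - dcoord c x v i) * s = coord c (\<gamma> s) i - coord c x i - s * dcoord c x v i"
      using s by (simp add: field_simps)
    finally show ?thesis .
  qed
  ultimately show ?thesis
    using onto[OF s(1,3)] s(1,2) by (intro bexI[of _ s]) auto
qed

lemma exp_cone_interior:
  assumes x: "x \<in> points M" and v: "v \<in> unit_vectors M x" and "\<delta> > 0" and dom: "cone M x v \<delta> \<subseteq> exp_dom M x"
  shows "mtop M interior_of (exp_map M x ` cone M x v \<delta>) \<noteq> {}"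
proof -
  obtain c where c: "c \<in> atlas M" "x \<in> chart_dom c"
    using x chart_cover by blast
  obtain e t0 where e: "e > 0" and t0: "t0 > 0"
    and onto: "\<And>t p. \<lbrakk>0 < t; t < t0; p \<in> chart_dom c;
      \<forall>i<mdim M. \<bar>coord c p i - coord c x i - t * dcoord c x v i\<bar> \<le> e * t\<rbrakk> \<Longrightarrow>
      p \<in> exp_map M x ` cone M x v \<delta>"
    using exp_cone_onto[OF c v \<open>\<delta> > 0\<close> dom] by blast
  obtain \<rho> where \<rho>: "\<rho> > 0" "cube (mdim M) (coord c x) \<rho> \<subseteq> coord c ` chart_dom c"
    using cube_subset_openin[OF chart_image_open[OF c(1)]] c(2) by blast
  obtain A where A: "A > 0" "\<And>i. i < mdim M \<Longrightarrow> \<bar>dcoord c x v i\<bar> \<le> A"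
    using finite_abs_bounded[of "mdim M" "dcoord c x v"] by blast
  \<comment> \<open>The bound \<open>\<rho> / A\<close> keeps the point \<open>y\<close> on the
    coordinate ray inside the chart image, so that the open cube \<open>W\<close> about it is
    nonempty.\<close>
  define t where "t = min (t0 / 2) (\<rho> / A)"
  have t: "0 < t" "t < t0" "t \<le> \<rho> / A"
    using t0 \<rho>(1) A(1) by (auto simp: t_def)
  define y where "y i = coord c x i + t * dcoord c x v i" for i
  define W where "W = {p \<in> chart_dom c. \<forall>i<mdim M. \<bar>coord c p i - y i\<bar> < e * t}"
  have "v \<in> tangent M x"
    using v by (simp add: unit_vectors_def)
  have "\<bar>t * dcoord c x v i\<bar> \<le> \<rho>" if "i < mdim M" for i
  proof -
    have "\<bar>t * dcoord c x v i\<bar> \<le> t * A"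
      using t A(2)[OF that] by (simp add: abs_mult)
    also have "\<dots> \<le> \<rho>"
      using t(3) A(1) by (simp add: pos_le_divide_eq)
    finally show ?thesis .
  qed
  then have "y \<in> cube (mdim M) (coord c x) \<rho>"
    using coord_ge_dim[OF c] dcoord_ge_dim[OF c \<open>v \<in> tangent M x\<close>] by (auto simp: cube_def y_def)
  then obtain p where "p \<in> chart_dom c" "coord c p = y"
    using \<rho>(2) by blast
  then have "p \<in> W"
    using e t by (simp add: W_def)
  moreover have "openin (mtop M) W"
    unfolding W_def by (rule open_chart_cube[OF c(1)])
  moreover have "W \<subseteq> exp_map M x ` cone M x v \<delta>"
    using onto[OF t(1,2)] by (fastforce simp: W_def y_def algebra_simps less_imp_le)
  ultimately show ?thesis
    using interior_of_maximal by blast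
qed

text \<open>Near 0, but without 0, the ray in direction \<open>v'\<close> lies in the cone, so the
  radial geodesic runs in \<open>X\<close>. The geodesic is taken for the short vector
  \<open>s *\<^sub>R v'\<close>, for which \<open>dom\<close> provides one, and is then slowed down
  by the factor \<open>1 / s\<close>.\<close>

lemma cone_directions:
  assumes x: "x \<in> X" "x \<in> points M" and v: "v \<in> unit_vectors M x" and "\<delta> > 0"
    and dom: "cone M x v \<delta> \<subseteq> exp_dom M x" and X: "exp_map M x ` cone M x v \<delta> \<subseteq> X"
    and v': "v' \<in> unit_vectors M x" "met M x v' v > 1 - \<delta>"
  shows "v' \<in> unit_tangents M x X"
proof -
  obtain c where c: "c \<in> atlas M" "x \<in> chart_dom c"
    using x chart_cover by blast
  interpret finite_inner_subspace "tangent M x" "met M x" "mdim M"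
    using finite_inner_subspace[OF x(2)] .
  have vT: "v \<in> tangent M x" "nrm v = 1" "v' \<in> tangent M x" "nrm v' = 1"
    using v v' by (auto simp: unit_vectors_def nrm_def)
  show ?thesis
  proof (rule exp_map_estimates[OF c])
    fix r0 K :: real
    assume r0: "r0 > 0"
      and exp: "\<And>u \<gamma>. \<lbrakk>exp_curve M x u \<gamma>; \<And>i. i < mdim M \<Longrightarrow> \<bar>dcoord c x u i\<bar> \<le> r0\<rbrakk> \<Longrightarrow> exp_map M x u = \<gamma> 1"
    obtain A where A: "A > 0" "\<And>i. i < mdim M \<Longrightarrow> \<bar>dcoord c x v' i\<bar> \<le> A"
      using finite_abs_bounded[of "mdim M" "dcoord c x v'"] by blast
    define s where "s = min (\<delta> / 2) (r0 / A)"
    have s: "0 < s" "s < \<delta>" "s \<le> r0 / A"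
      using r0 A(1) \<open>\<delta> > 0\<close> by (auto simp: s_def)
    have in_cone: "t *\<^sub>R v' \<in> cone M x v \<delta>" if t: "0 < t" "t \<le> s" for t
    proof -
      have "met M x v' v \<le> 1"
        using Cauchy_Schwarz[OF vT(3,1)] vT by simp
      then have "t * met M x v' v \<le> t"
        using t by (simp add: mult_left_le)
      then have "t * met M x v' v < \<delta>"
        using t s by linarith
      moreover have "t * (1 - \<delta>) < t * met M x v' v"
        using t v'(2) by simp
      ultimately show ?thesis
        using t s vT nrm_scale[OF vT(3), of t]
        by (simp add: cone_def scale_left mult.commute flip: nrm_eq_tnorm[OF x(2)])
    qed
    obtain \<gamma> where \<gamma>: "exp_curve M x (s *\<^sub>R v') \<gamma>"
      using in_cone[of s] s dom by (auto simp: exp_dom_def)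
    then obtain a b where ab: "a < 0" "1 < b" "geodesic M {a<..<b} \<gamma>" "\<gamma> 0 = x" "has_velocity M {a<..<b} \<gamma> 0 (s *\<^sub>R v')"
      by (auto simp: exp_curve_def)
    define \<eta> where "\<eta> = (\<lambda>t. \<gamma> (1 / s * t))"
    have sub: "(\<lambda>t. 1 / s * t) ` {0..<s} \<subseteq> {a<..<b}"
    proof (rule image_subsetI)
      fix t assume "t \<in> {0..<s}"
      then have "0 \<le> 1 / s * t" "1 / s * t < 1"
        using s by (auto simp: field_simps)
      then show "1 / s * t \<in> {a<..<b}"
        using ab by simp
    qed
    have "smooth_curve M {0..<s} \<eta>"
      unfolding \<eta>_def using ab(3) by (intro smooth_curve_scale[OF _ sub]) (simp add: geodesic_def)
    moreover have "has_velocity M {0..<s} \<eta> 0 v'"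
      using has_velocity_scale[OF ab(5) sub] x ab(4) s by (simp add: \<eta>_def)
    moreover have "\<eta> t \<in> X" if t: "t \<in> {0..<s}" for t
    \<comment> \<open>The zero vector is not in the cone, because the first inequality of
      \<open>cone\<close> is strict; at time 0 the assumption \<open>x \<in> X\<close> is used
      instead.\<close>
    proof (cases "t = 0")
      case True
      then show ?thesis
        using ab(4) x by (simp add: \<eta>_def)
    next
      case False
      define \<tau> where "\<tau> = t / s"
      have \<tau>: "0 < \<tau>" "\<tau> \<le> 1" "\<tau> * s = t"
        using False t s by (auto simp: \<tau>_def)
      have "exp_curve M x (\<tau> *\<^sub>R (s *\<^sub>R v')) (\<lambda>\<sigma>. \<gamma> (\<tau> * \<sigma>))"
        using \<gamma> \<tau>(1,2) x(2) by (rule exp_curve_scale)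
      then have "exp_curve M x (t *\<^sub>R v') (\<lambda>\<sigma>. \<gamma> (\<tau> * \<sigma>))"
        using \<tau>(3) by simp
      moreover have "\<forall>i<mdim M. \<bar>dcoord c x (t *\<^sub>R v') i\<bar> \<le> r0"
      proof (intro allI impI)
        fix i assume "i < mdim M"
        then have "\<bar>dcoord c x (t *\<^sub>R v') i\<bar> \<le> t * A"
          using A(2)[of i] t by (simp add: dcoord_scale[OF c vT(3)] abs_mult mult_left_mono)
        also have "\<dots> \<le> s * A"
          using t A(1) by (intro mult_right_mono) auto
        also have "\<dots> \<le> r0"
          using s(3) A(1) by (simp add: pos_le_divide_eq)
        finally show "\<bar>dcoord c x (t *\<^sub>R v') i\<bar> \<le> r0" .
      qed
      ultimately have "exp_map M x (t *\<^sub>R v') = \<gamma> \<tau>"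
        using exp[of "t *\<^sub>R v'" "\<lambda>\<sigma>. \<gamma> (\<tau> * \<sigma>)"] by simp
      moreover have "exp_map M x (t *\<^sub>R v') \<in> X"
        using in_cone[of t] t False X by auto
      ultimately show ?thesis
        by (simp add: \<eta>_def \<tau>_def)
    qed
    moreover have "\<eta> 0 = x"
      using ab(4) by (simp add: \<eta>_def)
    ultimately show ?thesis
      using v'(1) s(1) unfolding unit_tangents_def by blast
  qed
qed

end

section \<open>The unit sphere of a tangent space\<close>

text \<open>\<open>smooth_fun\<close> asks for all iterated partial derivatives; a family closed
  under differentiation reduces this to an induction over the list of indices. Equality of
  \<open>g\<close> with a member is asked only on \<open>V\<close>, since the formula for the metric
  coefficients of the sphere is derived only there.\<close>

lemma smooth_fun_if_closed_under_deriv: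
  assumes V: "openin (Euclidean_space d) V"
    and cont: "\<And>f. f \<in> F \<Longrightarrow> continuous_map (subtopology (Euclidean_space d) V) euclideanreal f"
    and deriv: "\<And>f i. \<lbrakk>f \<in> F; i < d\<rbrakk> \<Longrightarrow>
      \<exists>f'\<in>F. \<forall>y\<in>V. ((\<lambda>t. f (y(i := t))) has_real_derivative f' y) (at (y i))"
    and f: "f \<in> F" and g: "\<And>y. y \<in> V \<Longrightarrow> g y = f y"
  shows "smooth_fun d V g"
proof -
  \<comment> \<open>A partial derivative at \<open>y\<close> sees only points near \<open>y\<close>,
    and these belong to the open set \<open>V\<close>.\<close>
  have transfer: "((\<lambda>t. g (y(i := t))) has_real_derivative D) (at (y i))"
    if f: "((\<lambda>t. f (y(i := t))) has_real_derivative D) (at (y i))"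
      and eq: "\<And>y. y \<in> V \<Longrightarrow> g y = f y" and y: "y \<in> V" "i < d" for f g :: "(nat \<Rightarrow> real) \<Rightarrow> real" and y i D
  proof -
    obtain r where r: "r > 0" "cube d y r \<subseteq> V"
      using cube_subset_openin[OF V y(1)] by blast
    have "\<forall>i\<ge>d. y i = 0"
      using openin_subset[OF V] y(1) by (auto simp: topspace_Euclidean_space)
    then have "y(i := t) \<in> V" if "t \<in> ball (y i) r" for t
      using r y that by (intro subsetD[OF r(2)]) (auto simp: cube_def dist_real_def abs_minus_commute)
    then show ?thesis
      using eq by (intro has_field_derivative_transform_within_open[OF f open_ball[of "y i" r]]) (use r in auto)
  qed
  have *: "\<exists>f\<in>F. \<forall>y\<in>V. part_derivs is g y = f y" if "set is \<subseteq> {..<d}" for "is"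
    using that
  proof (induction "is")
    case Nil
    then show ?case
      using f g by (auto simp: part_derivs_def)
  next
    case (Cons i "is")
    have i: "i < d" and "set is \<subseteq> {..<d}"
      using Cons.prems by auto
    then obtain f1 where f1: "f1 \<in> F" "\<forall>y\<in>V. part_derivs is g y = f1 y"
      using Cons.IH by blast
    then obtain f2 where f2: "f2 \<in> F" "\<forall>y\<in>V. ((\<lambda>t. f1 (y(i := t))) has_real_derivative f2 y) (at (y i))"
      using deriv[OF f1(1) i] by blast
    have "part_derivs (i # is) g y = f2 y" if "y \<in> V" for y
    proof -
      have "((\<lambda>t. part_derivs is g (y(i := t))) has_real_derivative f2 y) (at (y i))"
        by (rule transfer[OF bspec[OF f2(2) that] _ that i]) (use f1(2) in blast)
      then show ?thesis
        by (simp add: part_derivs_def part_deriv_def DERIV_imp_deriv)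
    qed
    then show ?case
      using f2 by blast
  qed
  show ?thesis
    unfolding smooth_fun_def
  proof (intro allI impI conjI ballI)
    fix "is" assume "set is \<subseteq> {..<d}"
    then obtain f1 where f1: "f1 \<in> F" "\<forall>y\<in>V. part_derivs is g y = f1 y"
      using * by blast
    then show "continuous_map (subtopology (Euclidean_space d) V) euclideanreal (part_derivs is g)"
      using cont[OF f1(1)] by (auto elim!: continuous_map_eq)
    fix y i assume y: "y \<in> V" "i < d"
    then obtain f2 where f2: "f2 \<in> F" "\<forall>y\<in>V. ((\<lambda>t. f1 (y(i := t))) has_real_derivative f2 y) (at (y i))"
      using deriv[OF f1(1)] by blast
    have "((\<lambda>t. part_derivs is g (y(i := t))) has_real_derivative f2 y) (at (y i))"
      by (intro transfer[OF bspec[OF f2(2) y(1)] _ y]) (use f1(2) in blast)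
    then show "(\<lambda>t. part_derivs is g (y(i := t))) field_differentiable at (y i)"
      by (auto simp: field_differentiable_def)
  qed
qed

definition open_unit_ball :: "nat \<Rightarrow> (nat \<Rightarrow> real) set" where
  "open_unit_ball n = {y. (\<forall>i\<ge>n. y i = 0) \<and> (\<Sum>i<n. (y i)\<^sup>2) < 1}"

lemma continuous_map_Euclidean_space_component [continuous_intros]:
  "continuous_map (Euclidean_space n) euclideanreal (\<lambda>y. y i)"
  unfolding Euclidean_space_def
  by (intro continuous_map_from_subtopology continuous_map_product_projection) simp

lemma open_unit_ball_openin: "openin (Euclidean_space n) (open_unit_ball n)"
proof -
  have "openin (Euclidean_space n) {y \<in> topspace (Euclidean_space n). (\<Sum>i<n. (y i)\<^sup>2) \<in> {..<1}}"
    by (rule openin_continuous_map_preimage[of _ euclideanreal]) (auto intro!: continuous_intros)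
  then show ?thesis
    by (simp add: open_unit_ball_def topspace_Euclidean_space)
qed

text \<open>Polynomials in the coordinates and in \<open>q = inverse (1 - |y|^2)\<close>. The class
  is closed under partial derivatives because that of \<open>q\<close> is
  \<open>2 * y k * (q * q)\<close>, and it contains the metric coefficients of the sphere in a
  hemisphere chart.\<close>

inductive_set ball_rational :: "nat \<Rightarrow> ((nat \<Rightarrow> real) \<Rightarrow> real) set" for n where
  const: "(\<lambda>y. a) \<in> ball_rational n"
| component: "(\<lambda>y. y i) \<in> ball_rational n"
| add: "\<lbrakk>f \<in> ball_rational n; g \<in> ball_rational n\<rbrakk> \<Longrightarrow> (\<lambda>y. f y + g y) \<in> ball_rational n"
| mult: "\<lbrakk>f \<in> ball_rational n; g \<in> ball_rational n\<rbrakk> \<Longrightarrow> (\<lambda>y. f y * g y) \<in> ball_rational n"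
| inverse: "(\<lambda>y. inverse (1 - (\<Sum>i<n. (y i)\<^sup>2))) \<in> ball_rational n"

lemma ball_rational_smooth:
  assumes "f \<in> ball_rational n" "\<And>y. y \<in> open_unit_ball n \<Longrightarrow> g y = f y"
  shows "smooth_fun n (open_unit_ball n) g"
proof (rule smooth_fun_if_closed_under_deriv[OF open_unit_ball_openin _ _ assms])
  fix f assume "f \<in> ball_rational n"
  then show "continuous_map (subtopology (Euclidean_space n) (open_unit_ball n)) euclideanreal f"
    by induction (auto intro!: continuous_intros continuous_map_from_subtopology[OF continuous_map_Euclidean_space_component]
        simp: open_unit_ball_def)
next
  fix f k assume "f \<in> ball_rational n" and k: "k < n"
  then show "\<exists>f'\<in>ball_rational n. \<forall>y\<in>open_unit_ball n.
      ((\<lambda>t. f (y(k := t))) has_real_derivative f' y) (at (y k))"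
  proof induction
    case (const a)
    show ?case
      by (rule bexI[OF _ ball_rational.const[of 0]]) auto
  next
    case (component i)
    show ?case
      by (rule bexI[OF _ ball_rational.const[of "if i = k then 1 else 0"]]) auto
  next
    case (add f g)
    then obtain f' g' where f': "f' \<in> ball_rational n" "g' \<in> ball_rational n"
      "\<And>y. y \<in> open_unit_ball n \<Longrightarrow> ((\<lambda>t. f (y(k := t))) has_real_derivative f' y) (at (y k))"
      "\<And>y. y \<in> open_unit_ball n \<Longrightarrow> ((\<lambda>t. g (y(k := t))) has_real_derivative g' y) (at (y k))"
      by blast
    show ?case
      by (intro bexI[OF _ ball_rational.add[OF f'(1,2)]] ballI DERIV_add f'(3,4))
  next
    case (mult f g)
    then obtain f' g' where f': "f' \<in> ball_rational n" "g' \<in> ball_rational n"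
      "\<And>y. y \<in> open_unit_ball n \<Longrightarrow> ((\<lambda>t. f (y(k := t))) has_real_derivative f' y) (at (y k))"
      "\<And>y. y \<in> open_unit_ball n \<Longrightarrow> ((\<lambda>t. g (y(k := t))) has_real_derivative g' y) (at (y k))"
      by blast
    have "((\<lambda>t. f (y(k := t)) * g (y(k := t))) has_real_derivative f' y * g y + g' y * f y) (at (y k))"
      if "y \<in> open_unit_ball n" for y
      using DERIV_mult[OF f'(3,4)[OF that]] by simp
    then show ?case
      by (intro bexI[of _ "\<lambda>y. f' y * g y + g' y * f y"] ballI ball_rational.intros f' mult.hyps)
  next
    case inverse
    define q :: "(nat \<Rightarrow> real) \<Rightarrow> real" where "q y = inverse (1 - (\<Sum>i<n. (y i)\<^sup>2))" for y
    have q: "q \<in> ball_rational n"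
      unfolding q_def by (rule ball_rational.inverse)
    have "((\<lambda>t. q (y(k := t))) has_real_derivative 2 * y k * (q y * q y)) (at (y k))"
      if "y \<in> open_unit_ball n" for y
    proof -
      have "((\<lambda>t. ((y(k := t)) i)\<^sup>2) has_real_derivative (if i = k then 2 * y k else 0)) (at (y k))" for i
        by (cases "i = k") (auto intro!: derivative_eq_intros)
      then have "((\<lambda>t. \<Sum>i<n. ((y(k := t)) i)\<^sup>2) has_real_derivative (\<Sum>i<n. if i = k then 2 * y k else 0)) (at (y k))"
        by (rule DERIV_sum)
      then have "((\<lambda>t. 1 - (\<Sum>i<n. ((y(k := t)) i)\<^sup>2)) has_real_derivative
          0 - (\<Sum>i<n. if i = k then 2 * y k else 0)) (at (y k))"
        by (intro DERIV_diff DERIV_const)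
      moreover have "0 - (\<Sum>i<n. if i = k then 2 * y k else 0) = - (2 * y k)"
        using k by simp
      ultimately have s: "((\<lambda>t. 1 - (\<Sum>i<n. ((y(k := t)) i)\<^sup>2)) has_real_derivative - (2 * y k)) (at (y k))"
        by simp
      have nz: "1 - (\<Sum>i<n. ((y(k := y k)) i)\<^sup>2) \<noteq> 0"
        using that by (simp add: open_unit_ball_def)
      show ?thesis
        using DERIV_inverse'[OF s nz] unfolding q_def by (simp add: mult_ac)
    qed
    then show ?case
      unfolding q_def[symmetric]
      by (intro bexI[of _ "\<lambda>y. 2 * y k * (q y * q y)"] ballI ball_rational.mult ball_rational.const
          ball_rational.component q)
  qed
qed

section \<open>The metric topology of the unit sphere and its hemisphere charts\<close>

context riemannian_atlas
begin

context
  fixes x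
  assumes x: "x \<in> points M"
begin

interpretation finite_inner_subspace "tangent M x" "met M x" "mdim M"
  using finite_inner_subspace[OF x] .

abbreviation (input) sphere_dist :: "'v \<Rightarrow> 'v \<Rightarrow> real" where
  "sphere_dist \<equiv> \<lambda>v w. if v \<in> unit_vectors M x \<and> w \<in> unit_vectors M x then tnorm M x (v - w) else 0"

lemma unit_vectorsD: "v \<in> unit_vectors M x \<Longrightarrow> v \<in> tangent M x" "v \<in> unit_vectors M x \<Longrightarrow> met M x v v = 1"
  by (auto simp: unit_vectors_def)

lemma sphere_metric: "Metric_space (unit_vectors M x) sphere_dist"
proof
  fix v w z
  note T = unit_vectorsD(1) closed
  show "0 \<le> sphere_dist v w" "sphere_dist v w = sphere_dist w v"
    using nrm_nonneg[of "v - w"] nrm_minus_commute[of v w] T by (auto simp: nrm_eq_tnorm x)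
  show "sphere_dist v w = 0 \<longleftrightarrow> v = w" if "v \<in> unit_vectors M x" "w \<in> unit_vectors M x"
    using nrm_eq_0_iff[of "v - w"] that T by (auto simp: nrm_eq_tnorm x)
  show "sphere_dist v z \<le> sphere_dist v w + sphere_dist w z"
    if "v \<in> unit_vectors M x" "w \<in> unit_vectors M x" "z \<in> unit_vectors M x"
    using nrm_triangle[of "v - w" "w - z"] that T by (auto simp: nrm_eq_tnorm x)
qed

interpretation sphere: Metric_space "unit_vectors M x" sphere_dist
  by (rule sphere_metric)

lemma mtop_unit_sphere: "mtop (unit_sphere M x) = sphere.mtopology"
  by (simp add: unit_sphere_def)

lemma points_unit_sphere [simp]: "points (unit_sphere M x) = unit_vectors M x"
  by (simp add: mtop_unit_sphere)

lemma Hausdorff_unit_sphere: "Hausdorff_space (mtop (unit_sphere M x))"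
  by (simp add: mtop_unit_sphere sphere.Hausdorff_space_mtopology)

lemma met_continuous:
  assumes w: "w \<in> tangent M x"
  shows "continuous_map (mtop (unit_sphere M x)) euclideanreal (\<lambda>v. met M x v w)"
  unfolding continuous_map_def
proof (intro conjI allI impI)
  fix S :: "real set" assume "openin euclideanreal S"
  show "openin (mtop (unit_sphere M x)) {v \<in> points (unit_sphere M x). met M x v w \<in> S}"
    unfolding mtop_unit_sphere sphere.openin_mtopology
  proof (intro conjI allI impI)
    fix v assume v: "v \<in> {v \<in> topspace sphere.mtopology. met M x v w \<in> S}"
    then obtain e where e: "e > 0" "ball (met M x v w) e \<subseteq> S"
      using \<open>openin euclideanreal S\<close> by (auto elim: openE)
    \<comment> \<open>By Cauchy-Schwarz the function has Lipschitz constant \<open>nrm w\<close>;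
      the 1 avoids a division by zero for \<open>w = 0\<close>.\<close>
    define r where "r = e / (nrm w + 1)"
    have n: "nrm w + 1 > 0"
      using nrm_nonneg[OF w] by linarith
    have "met M x v' w \<in> S" if v': "v' \<in> sphere.mball v r" for v'
    proof -
      have vT: "v \<in> unit_vectors M x" "v' \<in> unit_vectors M x" "v \<in> tangent M x" "v' \<in> tangent M x"
        using v v' unit_vectorsD by auto
      have d: "nrm (v - v') < r"
        using v' vT by (simp add: nrm_eq_tnorm x)
      have "\<bar>met M x v w - met M x v' w\<bar> \<le> nrm (v - v') * nrm w"
        using Cauchy_Schwarz[of "v - v'" w] vT w by (simp add: expand)
      also have "\<dots> \<le> nrm (v - v') * (nrm w + 1)"
        using vT by (intro mult_left_mono) auto
      also have "\<dots> < r * (nrm w + 1)"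
        using d n by (intro mult_strict_right_mono)
      also have "\<dots> = e"
        using n by (simp add: r_def)
      finally show ?thesis
        using e(2) by (auto simp: subset_eq dist_real_def)
    qed
    then show "\<exists>r>0. sphere.mball v r \<subseteq> {v \<in> topspace sphere.mtopology. met M x v w \<in> S}"
      using e(1) n by (intro exI[of _ r]) (auto simp: r_def)
  qed auto
qed auto

text \<open>The set \<open>{p}\<close> is orthonormal; it is completed to a basis, and the other
  \<open>mdim M - 1\<close> vectors are enumerated.\<close>

lemma frame_exists:
  assumes p: "p \<in> unit_vectors M x"
  shows "\<exists>b. sphere_frame M x p b"
proof -
  have "orthonormal {p}"
    using p by (simp add: orthonormal_def unit_vectors_def)
  then obtain S where S: "p \<in> S" "orthonormal S" "card S = mdim M"
    using orthonormal_extend by blast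
  then have fin: "finite (S - {p})" "card (S - {p}) = mdim M - 1"
    by (auto simp: orthonormal_def)
  then obtain b where b: "bij_betw b {..<mdim M - 1} (S - {p})"
    using ex_bij_betw_nat_finite[OF fin(1)] by (auto simp: atLeast0LessThan)
  have "b i \<in> S" "b i \<noteq> p" if "i < mdim M - 1" for i
    using bij_betwE[OF b] that by auto
  moreover have "b i = b j \<longleftrightarrow> i = j" if "i < mdim M - 1" "j < mdim M - 1" for i j
    using bij_betw_imp_inj_on[OF b] that by (auto dest: inj_onD)
  ultimately have "sphere_frame M x p b"
    using S p unfolding sphere_frame_def orthonormal_def by (auto simp: subset_eq)
  then show ?thesis
    by blast
qed

context
  fixes p b
  assumes frame: "sphere_frame M x p b"
begin

abbreviation (input) n :: nat where "n \<equiv> mdim M - 1"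

lemma frame_pole: "p \<in> unit_vectors M x" "p \<in> tangent M x" "met M x p p = 1"
  using frame by (auto simp: sphere_frame_def unit_vectors_def)

lemma frame_basis:
  assumes "i < n"
  shows "b i \<in> tangent M x" "met M x (b i) p = 0" "met M x p (b i) = 0"
    "j < n \<Longrightarrow> met M x (b i) (b j) = (if i = j then 1 else 0)"
proof -
  show 1: "b i \<in> tangent M x" "met M x (b i) p = 0" "j < n \<Longrightarrow> met M x (b i) (b j) = (if i = j then 1 else 0)"
    using frame assms by (auto simp: sphere_frame_def)
  then show "met M x p (b i) = 0"
    using sym[of p "b i"] frame_pole by simp
qed

lemma frame_sum:
  shows "(\<Sum>i<n. y i *\<^sub>R b i) \<in> tangent M x"
    and "w \<in> tangent M x \<Longrightarrow> met M x (\<Sum>i<n. y i *\<^sub>R b i) w = (\<Sum>i<n. y i * met M x (b i) w)"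
proof -
  have "y i *\<^sub>R b i \<in> tangent M x" if "i \<in> {..<n}" for i
    using frame_basis(1)[of i] that by auto
  then show "(\<Sum>i<n. y i *\<^sub>R b i) \<in> tangent M x"
    by blast
  show "met M x (\<Sum>i<n. y i *\<^sub>R b i) w = (\<Sum>i<n. y i * met M x (b i) w)" if "w \<in> tangent M x"
    using frame_basis(1) that by (subst sum_left) (auto simp: scale_left)
qed

lemma frame_expand:
  assumes u: "u \<in> tangent M x"
  shows "u = met M x u p *\<^sub>R p + (\<Sum>i<n. met M x u (b i) *\<^sub>R b i)"
proof -
  have inj: "inj_on b {..<n}"
  proof (rule inj_onI)
    fix i j assume "i \<in> {..<n}" "j \<in> {..<n}" "b i = b j"
    then show "i = j"
      using frame_basis(4)[of i i] frame_basis(4)[of i j] by (auto split: if_splits)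
  qed
  have pb: "p \<notin> b ` {..<n}"
    using frame_basis(2) frame_pole(3) by force
  then have "p \<noteq> b i" "b i \<noteq> p" if "i < n" for i
    using that by auto
  then have on: "orthonormal (insert p (b ` {..<n}))"
    using frame_pole frame_basis inj by (auto simp: orthonormal_def inj_on_def)
  \<comment> \<open>The orthonormal set contains \<open>p\<close>, so the dimension is positive and
    the truncated subtraction in \<open>n\<close> is exact.\<close>
  have "mdim M \<noteq> 0"
    using orthonormal_card[OF on] pb by auto
  then have "card (insert p (b ` {..<n})) = mdim M"
    using pb inj by (simp add: card_image)
  from orthonormal_complete[OF on this u] show ?thesis
    using pb inj by (simp add: sum.reindex)
qed

lemma frame_inner:
  assumes u: "u \<in> tangent M x" and w: "w \<in> tangent M x"
  shows "met M x u w = met M x u p * met M x w p + (\<Sum>i<n. met M x u (b i) * met M x w (b i))"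
proof -
  have "met M x u w = met M x (met M x u p *\<^sub>R p + (\<Sum>i<n. met M x u (b i) *\<^sub>R b i)) w"
    using frame_expand[OF u] by simp
  also have "\<dots> = met M x u p * met M x p w + (\<Sum>i<n. met M x u (b i) * met M x (b i) w)"
    using frame_pole frame_sum w by (simp add: add_left scale_left)
  also have "\<dots> = met M x u p * met M x w p + (\<Sum>i<n. met M x u (b i) * met M x w (b i))"
    using frame_pole frame_basis w by (simp add: sym[of w])
  finally show ?thesis .
qed

lemma frame_ext:
  assumes "u \<in> tangent M x" "w \<in> tangent M x" "met M x u p = met M x w p" "\<And>i. i < n \<Longrightarrow> met M x u (b i) = met M x w (b i)"
  shows "u = w"
  using frame_expand[OF assms(1)] frame_expand[OF assms(2)] assms(3,4) by simp

definition frame_vec :: "real \<Rightarrow> (nat \<Rightarrow> real) \<Rightarrow> 'v" where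
  "frame_vec a y = a *\<^sub>R p + (\<Sum>i<n. y i *\<^sub>R b i)"

lemma frame_vec: "frame_vec a y \<in> tangent M x" "met M x (frame_vec a y) p = a"
  "j < n \<Longrightarrow> met M x (frame_vec a y) (b j) = y j"
proof -
  show "frame_vec a y \<in> tangent M x"
    using frame_pole frame_sum by (auto simp: frame_vec_def)
  have "met M x (frame_vec a y) p = a + (\<Sum>i<n. y i * met M x (b i) p)"
    using frame_pole frame_sum by (simp add: frame_vec_def add_left scale_left)
  then show "met M x (frame_vec a y) p = a"
    using frame_basis by simp
  assume j: "j < n"
  have "met M x (frame_vec a y) (b j) = (\<Sum>i<n. y i * met M x (b i) (b j))"
    using frame_pole frame_basis[OF j] frame_sum by (simp add: frame_vec_def add_left scale_left)
  also have "\<dots> = (\<Sum>i<n. if i = j then y i else 0)"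
    using frame_basis j by (intro sum.cong) auto
  finally show "met M x (frame_vec a y) (b j) = y j"
    using j by simp
qed

abbreviation (input) H :: "('v, 'v) chart" where "H \<equiv> hemisphere_chart M x p b"

text \<open>The inverse of the projection: the component along \<open>p\<close> is recovered from
  the unit length, with the positive root because the chart is the hemisphere on the side of
  \<open>p\<close>.\<close>

definition hemisphere_param :: "(nat \<Rightarrow> real) \<Rightarrow> 'v" where
  "hemisphere_param y = frame_vec (sqrt (1 - (\<Sum>i<n. (y i)\<^sup>2))) y"

lemma hemisphere_dom: "v \<in> chart_dom H \<longleftrightarrow> v \<in> unit_vectors M x \<and> met M x v p > 0"
  by (simp add: hemisphere_chart_def)

lemma hemisphere_coord: "coord H v i = (if i < n then met M x v (b i) else 0)"
  by (simp add: hemisphere_chart_def)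

lemma hemisphere_param:
  assumes y: "y \<in> open_unit_ball n"
  shows "hemisphere_param y \<in> chart_dom H" "coord H (hemisphere_param y) = y"
proof -
  have y': "(\<Sum>i<n. (y i)\<^sup>2) < 1" "\<And>i. i \<ge> n \<Longrightarrow> y i = 0"
    using y by (auto simp: open_unit_ball_def)
  have "met M x (hemisphere_param y) (hemisphere_param y) = (1 - (\<Sum>i<n. (y i)\<^sup>2)) + (\<Sum>i<n. y i * y i)"
    using y'(1) unfolding hemisphere_param_def
    by (subst frame_inner) (auto simp: frame_vec)
  then show "hemisphere_param y \<in> chart_dom H"
    using y' by (simp add: hemisphere_dom unit_vectors_def hemisphere_param_def frame_vec power2_eq_square)
  show "coord H (hemisphere_param y) = y"
    using y'(2) by (auto simp: hemisphere_coord hemisphere_param_def frame_vec)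
qed

lemma hemisphere_coord_in_ball:
  assumes v: "v \<in> chart_dom H"
  shows "coord H v \<in> open_unit_ball n" "hemisphere_param (coord H v) = v"
    "met M x v p = sqrt (1 - (\<Sum>i<n. (coord H v i)\<^sup>2))"
proof -
  have v': "v \<in> tangent M x" "met M x v v = 1" "met M x v p > 0"
    using v by (auto simp: hemisphere_dom unit_vectors_def)
  have "1 = (met M x v p)\<^sup>2 + (\<Sum>i<n. (coord H v i)\<^sup>2)"
    using frame_inner[OF v'(1,1)] v'(2) by (simp add: hemisphere_coord power2_eq_square)
  then have e: "(met M x v p)\<^sup>2 = 1 - (\<Sum>i<n. (coord H v i)\<^sup>2)"
    by simp
  show c: "met M x v p = sqrt (1 - (\<Sum>i<n. (coord H v i)\<^sup>2))"
    unfolding e[symmetric] using v'(3) by simp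
  have "(met M x v p)\<^sup>2 > 0"
    using v'(3) by simp
  then show "coord H v \<in> open_unit_ball n"
    using e by (simp add: open_unit_ball_def hemisphere_coord)
  show "hemisphere_param (coord H v) = v"
    unfolding hemisphere_param_def c[symmetric]
    by (rule frame_ext) (auto simp: frame_vec v' hemisphere_coord)
qed

lemma hemisphere_image: "coord H ` chart_dom H = open_unit_ball n"
  using hemisphere_param hemisphere_coord_in_ball(1) by force

lemma hemisphere_open: "openin (mtop (unit_sphere M x)) (chart_dom H)"
proof -
  have "openin (mtop (unit_sphere M x)) {v \<in> points (unit_sphere M x). met M x v p \<in> {0<..}}"
    using met_continuous[OF frame_pole(2)] by (rule openin_continuous_map_preimage) auto
  then show ?thesis
    by (simp add: hemisphere_chart_def)
qed

lemma hemisphere_homeo: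
  "homeomorphic_maps (subtopology (mtop (unit_sphere M x)) (chart_dom H))
     (subtopology (Euclidean_space n) (open_unit_ball n)) (coord H) hemisphere_param"
proof -
  have dom: "chart_dom H \<subseteq> unit_vectors M x"
    by (auto simp: hemisphere_dom)
  have ball: "open_unit_ball n \<subseteq> topspace (Euclidean_space n)"
    by (auto simp: open_unit_ball_def topspace_Euclidean_space)
  have "continuous_map (mtop (unit_sphere M x)) (Euclidean_space n) (\<lambda>v i. if i < n then met M x v (b i) else 0)"
    using met_continuous frame_basis by (subst continuous_map_componentwise_Euclidean_space) auto
  then have "continuous_map (subtopology (mtop (unit_sphere M x)) (chart_dom H)) (Euclidean_space n) (coord H)"
    by (simp add: hemisphere_chart_def continuous_map_from_subtopology)
  then have 1: "continuous_map (subtopology (mtop (unit_sphere M x)) (chart_dom H))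
      (subtopology (Euclidean_space n) (open_unit_ball n)) (coord H)"
    using hemisphere_coord_in_ball(1) by (auto simp: continuous_map_in_subtopology)
  have "continuous_map (subtopology (Euclidean_space n) (open_unit_ball n)) sphere.mtopology hemisphere_param"
    unfolding sphere.continuous_map_to_metric
  proof (intro ballI allI impI)
    fix y and e :: real assume y: "y \<in> topspace (subtopology (Euclidean_space n) (open_unit_ball n))" and e: "e > 0"
    define S where "S z = sqrt (1 - (\<Sum>i<n. (z i)\<^sup>2))" for z :: "nat \<Rightarrow> real"
    \<comment> \<open>The squared distance is computed in the frame, so continuity of
      \<open>hemisphere_param\<close> reduces to that of an explicit real function.\<close>
    define D where "D z = (S z - S y)\<^sup>2 + (\<Sum>i<n. (z i - y i)\<^sup>2)" for z
    have D: "(nrm (hemisphere_param y - hemisphere_param z))\<^sup>2 = D z" for z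
    proof -
      let ?u = "hemisphere_param y - hemisphere_param z"
      have T: "hemisphere_param y \<in> tangent M x" "hemisphere_param z \<in> tangent M x" "?u \<in> tangent M x"
        by (auto simp: hemisphere_param_def frame_vec)
      have "met M x ?u p = S y - S z" "\<And>i. i < n \<Longrightarrow> met M x ?u (b i) = y i - z i"
        using T frame_pole frame_basis by (auto simp: diff_left) (auto simp: hemisphere_param_def frame_vec S_def)
      then show ?thesis
        unfolding nrm_sq[OF T(3)] frame_inner[OF T(3,3)]
        by (simp add: D_def power2_commute[of "S z"] power2_commute[of "z _"]) (simp add: power2_eq_square)
    qed
    have cont: "continuous_map (subtopology (Euclidean_space n) (open_unit_ball n)) euclideanreal D"
      unfolding D_def S_def by (intro continuous_intros continuous_map_from_subtopology) auto
    let ?W = "{z \<in> topspace (subtopology (Euclidean_space n) (open_unit_ball n)). D z \<in> {..<e\<^sup>2}}"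
    have "openin (subtopology (Euclidean_space n) (open_unit_ball n)) ?W"
      using cont by (rule openin_continuous_map_preimage) auto
    moreover have "y \<in> ?W"
      using y e by (simp add: D_def)
    moreover have "hemisphere_param z \<in> sphere.mball (hemisphere_param y) e" if z: "z \<in> ?W" for z
    proof -
      have u: "hemisphere_param y \<in> unit_vectors M x" "hemisphere_param z \<in> unit_vectors M x"
        using y z hemisphere_param(1) dom by auto
      have "(nrm (hemisphere_param y - hemisphere_param z))\<^sup>2 < e\<^sup>2"
        using z D by simp
      then have "nrm (hemisphere_param y - hemisphere_param z) < e"
        using e by (auto intro: power2_less_imp_less)
      then show ?thesis
        using u by (simp add: nrm_eq_tnorm x)
    qed
    ultimately show "\<exists>U. openin (subtopology (Euclidean_space n) (open_unit_ball n)) U \<and> y \<in> U \<and>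
        (\<forall>z\<in>U. hemisphere_param z \<in> sphere.mball (hemisphere_param y) e)"
      by blast
  qed
  then have 2: "continuous_map (subtopology (Euclidean_space n) (open_unit_ball n))
      (subtopology (mtop (unit_sphere M x)) (chart_dom H)) hemisphere_param"
    using hemisphere_param(1) by (auto simp: continuous_map_in_subtopology mtop_unit_sphere)
  show ?thesis
    unfolding homeomorphic_maps_def using 1 2 hemisphere_param(2) hemisphere_coord_in_ball(2) by auto
qed

lemma hemisphere_inv:
  assumes "y \<in> open_unit_ball n"
  shows "chart_inv H y = hemisphere_param y"
proof -
  have "inj_on (coord H) (chart_dom H)"
    by (rule inj_on_inverseI) (rule hemisphere_coord_in_ball(2))
  then show ?thesis
    unfolding chart_inv_def using hemisphere_param[OF assms] inv_into_f_f by metis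
qed

lemma hemisphere_dcoord: "dcoord H v w i = (if i < n then met M x w (b i) else 0)"
  by (simp add: hemisphere_chart_def)

text \<open>The components along the \<open>b i\<close> agree by assumption; orthogonality to
  \<open>v\<close> then determines the component along \<open>p\<close>, because
  \<open>met M x v p > 0\<close>.\<close>

lemma hemisphere_dcoord_inj:
  assumes v: "v \<in> chart_dom H" and w: "w \<in> tangent (unit_sphere M x) v" "w' \<in> tangent (unit_sphere M x) v"
    and eq: "dcoord H v w = dcoord H v w'"
  shows "w = w'"
proof (rule frame_ext)
  have wT: "w \<in> tangent M x" "w' \<in> tangent M x" "met M x v w = 0" "met M x v w' = 0" "v \<in> tangent M x" "met M x v p > 0"
    using w v by (auto simp: unit_sphere_def hemisphere_dom unit_vectors_def)
  show "w \<in> tangent M x" "w' \<in> tangent M x"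
    by fact+
  show e: "met M x w (b i) = met M x w' (b i)" if "i < n" for i
    using fun_cong[OF eq, of i] that by (simp add: hemisphere_dcoord)
  have "(\<Sum>i<n. met M x v (b i) * met M x w (b i)) = (\<Sum>i<n. met M x v (b i) * met M x w' (b i))"
    using e by simp
  then have "met M x v p * met M x w p = met M x v p * met M x w' p"
    using frame_inner[OF wT(5,1)] frame_inner[OF wT(5,2)] wT(3,4) by linarith
  then show "met M x w p = met M x w' p"
    using wT(6) by simp
qed

text \<open>The coefficient along \<open>p\<close> is the one that orthogonality to \<open>v\<close>
  forces.\<close>

definition hemisphere_tangent :: "'v \<Rightarrow> (nat \<Rightarrow> real) \<Rightarrow> 'v" where
  "hemisphere_tangent v y = frame_vec (- (\<Sum>i<n. met M x v (b i) * y i) / met M x v p) y"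

lemma hemisphere_tangent:
  assumes v: "v \<in> chart_dom H"
  shows "hemisphere_tangent v y \<in> tangent (unit_sphere M x) v"
    and "(\<And>i. i \<ge> n \<Longrightarrow> y i = 0) \<Longrightarrow> dcoord H v (hemisphere_tangent v y) = y"
proof -
  have vT: "v \<in> tangent M x" "met M x v p > 0"
    using v by (auto simp: hemisphere_dom unit_vectors_def)
  have "met M x v (hemisphere_tangent v y) = 0"
    using vT by (subst frame_inner) (auto simp: hemisphere_tangent_def frame_vec)
  then show "hemisphere_tangent v y \<in> tangent (unit_sphere M x) v"
    by (simp add: unit_sphere_def hemisphere_tangent_def frame_vec)
  show "(\<And>i. i \<ge> n \<Longrightarrow> y i = 0) \<Longrightarrow> dcoord H v (hemisphere_tangent v y) = y"
    by (auto simp: hemisphere_dcoord hemisphere_tangent_def frame_vec)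
qed

lemma hemisphere_dcoord_bij:
  assumes v: "v \<in> chart_dom H"
  shows "bij_betw (dcoord H v) (tangent (unit_sphere M x) v) (topspace (Euclidean_space n))"
proof (rule bij_betwI[where g = "hemisphere_tangent v"])
  show "dcoord H v \<in> tangent (unit_sphere M x) v \<rightarrow> topspace (Euclidean_space n)"
    by (auto simp: hemisphere_dcoord topspace_Euclidean_space)
  show "hemisphere_tangent v \<in> topspace (Euclidean_space n) \<rightarrow> tangent (unit_sphere M x) v"
    using hemisphere_tangent(1)[OF v] by auto
  show "dcoord H v (hemisphere_tangent v y) = y" if "y \<in> topspace (Euclidean_space n)" for y
    using hemisphere_tangent(2)[OF v] that by (simp add: topspace_Euclidean_space)
  then show "hemisphere_tangent v (dcoord H v w) = w" if "w \<in> tangent (unit_sphere M x) v" for w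
    using hemisphere_dcoord_inj[OF v hemisphere_tangent(1)[OF v] that]
    by (simp add: hemisphere_dcoord topspace_Euclidean_space)
qed

lemma hemisphere_coord_vec:
  assumes v: "v \<in> chart_dom H" and i: "i < n"
  shows "coord_vec (unit_sphere M x) H i v = frame_vec (- met M x v (b i) / met M x v p) (\<lambda>j. if j = i then 1 else 0)"
proof -
  let ?e = "\<lambda>j. if j = i then 1 else 0 :: real"
  have "hemisphere_tangent v ?e = frame_vec (- met M x v (b i) / met M x v p) ?e"
    using i by (simp add: hemisphere_tangent_def if_distrib cong: if_cong)
  moreover have "coord_vec (unit_sphere M x) H i v = hemisphere_tangent v ?e"
    unfolding coord_vec_def
  proof (rule inv_into_f_eq)
    show "inj_on (dcoord H v) (tangent (unit_sphere M x) v)"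
      using hemisphere_dcoord_bij[OF v] by (rule bij_betw_imp_inj_on)
  qed (use hemisphere_tangent[OF v] i in auto)
  ultimately show ?thesis
    by simp
qed

text \<open>The metric of a graph: with height \<open>s = sqrt (1 - |y|^2)\<close> over the
  hyperplane, the coordinate vectors are \<open>b i\<close> minus \<open>y i / s\<close> times
  \<open>p\<close>, and their inner products give the formula, which is visibly in
  \<open>ball_rational\<close>.\<close>

lemma hemisphere_met_coeff:
  assumes y: "y \<in> open_unit_ball n" and ij: "i < n" "j < n"
  shows "met_coeff (unit_sphere M x) H i j y =
    (if i = j then 1 else 0) + y i * (y j * inverse (1 - (\<Sum>i<n. (y i)\<^sup>2)))"
proof -
  define v where "v = hemisphere_param y"
  have v: "v \<in> chart_dom H"
    using hemisphere_param(1)[OF y] by (simp add: v_def)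
  define s where "s = sqrt (1 - (\<Sum>i<n. (y i)\<^sup>2))"
  have s: "met M x v p = s" "s * s = 1 - (\<Sum>i<n. (y i)\<^sup>2)"
    using y by (auto simp: v_def hemisphere_param_def frame_vec s_def open_unit_ball_def)
  have vb: "met M x v (b i) = y i" if "i < n" for i
    using that by (simp add: v_def hemisphere_param_def frame_vec)
  have "met_coeff (unit_sphere M x) H i j y =
      met M x (frame_vec (- y i / s) (\<lambda>k. if k = i then 1 else 0)) (frame_vec (- y j / s) (\<lambda>k. if k = j then 1 else 0))"
    using ij hemisphere_coord_vec[OF v]
    by (simp add: met_coeff_def Let_def hemisphere_inv[OF y] flip: v_def) (simp add: s(1) vb unit_sphere_def)
  also have "\<dots> = y i / s * (y j / s) + (\<Sum>k<n. (if k = i then 1 else 0) * (if k = j then 1 else 0))"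
    by (subst frame_inner) (auto simp: frame_vec)
  also have "(\<Sum>k<n. (if k = i then 1 else 0) * (if k = j then 1 else 0)) = (if i = j then 1 else 0 :: real)"
    using ij by (simp add: if_distrib[of "\<lambda>z. z * _"] cong: if_cong)
  also have "y i / s * (y j / s) = y i * (y j * inverse (1 - (\<Sum>i<n. (y i)\<^sup>2)))"
    unfolding s(2)[symmetric] by (simp add: divide_inverse)
  finally show ?thesis
    by simp
qed

lemma hemisphere_met_smooth:
  assumes "i < n" "j < n"
  shows "smooth_fun n (open_unit_ball n) (met_coeff (unit_sphere M x) H i j)"
  by (rule ball_rational_smooth[OF _ hemisphere_met_coeff[OF _ assms]]) (intro ball_rational.intros)

end

text \<open>This is what lets the induction descend: all results on \<open>exp_map\<close> and cones
  become available for the unit spheres, with their charts by projection.\<close>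

lemma riemannian_atlas_unit_sphere: "riemannian_atlas (unit_sphere M x)"
proof
  let ?N = "unit_sphere M x"
  have N: "mdim ?N = mdim M - 1" "atlas ?N = {hemisphere_chart M x p b | p b. sphere_frame M x p b}"
    "met ?N v = met M x" "tangent ?N v = {w \<in> tangent M x. met M x v w = 0}" for v
    by (simp_all add: unit_sphere_def)
  show "Hausdorff_space (mtop ?N)"
    by (rule Hausdorff_unit_sphere)
  show "(\<Union>c\<in>atlas ?N. chart_dom c) = points ?N"
  proof (intro equalityI subsetI)
    fix v assume "v \<in> points ?N"
    then have v: "v \<in> unit_vectors M x"
      by simp
    then obtain b where "sphere_frame M x v b"
      using frame_exists by blast
    moreover have "v \<in> chart_dom (hemisphere_chart M x v b)"
      using v by (simp add: hemisphere_chart_def unit_vectors_def)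
    ultimately show "v \<in> (\<Union>c\<in>atlas ?N. chart_dom c)"
      unfolding N by blast
  qed (auto simp: N hemisphere_chart_def)
  fix c assume "c \<in> atlas ?N"
  then obtain p b where f: "sphere_frame M x p b" and c: "c = hemisphere_chart M x p b"
    by (auto simp: N)
  show "openin (mtop ?N) (chart_dom c)"
    unfolding c by (rule hemisphere_open[OF f])
  show "openin (Euclidean_space (mdim ?N)) (coord c ` chart_dom c)"
    unfolding c N(1) hemisphere_image[OF f] by (rule open_unit_ball_openin)
  show "homeomorphic_map (subtopology (mtop ?N) (chart_dom c))
      (subtopology (Euclidean_space (mdim ?N)) (coord c ` chart_dom c)) (coord c)"
    unfolding c N(1) hemisphere_image[OF f] using hemisphere_homeo[OF f] homeomorphic_map_maps by blast
  show "bij_betw (dcoord c v) (tangent ?N v) (topspace (Euclidean_space (mdim ?N)))" if "v \<in> chart_dom c" for v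
    using hemisphere_dcoord_bij[OF f] that unfolding c N(1) by simp
  show "dcoord c v (r *\<^sub>R u + s *\<^sub>R w) i = r * dcoord c v u i + s * dcoord c v w i"
    if "u \<in> tangent ?N v" "w \<in> tangent ?N v" for v u w r s i
    using that frame_basis(1)[OF f] unfolding c hemisphere_dcoord[OF f] by (auto simp: N linear)
  show "smooth_fun (mdim ?N) (coord c ` chart_dom c) (met_coeff ?N c i j)" if "i < mdim ?N" "j < mdim ?N" for i j
    using hemisphere_met_smooth[OF f] that unfolding c N(1) hemisphere_image[OF f] by simp
next
  fix v assume "v \<in> points (unit_sphere M x)"
  then have "v \<in> tangent M x"
    using unit_vectorsD by simp
  then show "subspace (tangent (unit_sphere M x) v)"
    by (auto simp: unit_sphere_def subspace_def expand)
next
  fix v u w z and r s :: real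
  assume "u \<in> tangent (unit_sphere M x) v" "w \<in> tangent (unit_sphere M x) v"
  then have T: "u \<in> tangent M x" "w \<in> tangent M x"
    by (auto simp: unit_sphere_def)
  show "met (unit_sphere M x) v u w = met (unit_sphere M x) v w u"
    using sym[OF T] by (simp add: unit_sphere_def)
  show "u \<noteq> 0 \<Longrightarrow> met (unit_sphere M x) v u u > 0"
    using pos[OF T(1)] by (simp add: unit_sphere_def)
  show "met (unit_sphere M x) v (r *\<^sub>R u + s *\<^sub>R w) z = r * met (unit_sphere M x) v u z + s * met (unit_sphere M x) v w z"
    if "z \<in> tangent (unit_sphere M x) v"
    using that linear[OF T] by (simp add: unit_sphere_def)
qed

end

end

section \<open>Tangent directions of a union\<close>

lemma dense_meets_openin:
  assumes "T closure_of S = topspace T" "openin T W" "W \<noteq> {}"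
  shows "\<exists>v\<in>W. v \<in> S"
proof -
  obtain v where "v \<in> W"
    using assms(3) by blast
  then have "v \<in> T closure_of S"
    using assms(1,2) openin_subset by blast
  then show ?thesis
    using assms(2) \<open>v \<in> W\<close> unfolding in_closure_of by blast
qed

text \<open>Two dense open sets have a dense intersection, which a nonempty open
  \<open>W - C\<close> would have to meet. The case \<open>C = {}\<close> is used to show that
  \<open>W\<close> is empty.\<close>

lemma openin_subset_closed_if_dense:
  assumes "openin T W" "openin T D" "openin T E" "T closure_of D = topspace T" "T closure_of E = topspace T"
    and "closedin T C" "W \<inter> D \<inter> E \<subseteq> C"
  shows "W \<subseteq> C"
proof (rule ccontr)
  assume "\<not> W \<subseteq> C"
  then have "openin T (W - C)" "W - C \<noteq> {}"
    using assms(1,6) by (auto intro: openin_diff)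
  then obtain v where "v \<in> (W - C) \<inter> D" "openin T ((W - C) \<inter> D)"
    using dense_meets_openin[OF assms(4), of "W - C"] assms(2) by auto
  then obtain w where "w \<in> (W - C) \<inter> D" "w \<in> E"
    using dense_meets_openin[OF assms(5)] by blast
  then show False
    using assms(7) by blast
qed

lemma unit_tangents_mono: "X \<subseteq> Y \<Longrightarrow> unit_tangents M x X \<subseteq> unit_tangents M x Y"
  unfolding unit_tangents_def by blast

context riemannian_atlas
begin

text \<open>In dimension 0 all coordinates vanish, so that an injective chart has a one-point
  domain.\<close>

lemma openin_if_dim_0:
  assumes "mdim M = 0" "S \<subseteq> points M"
  shows "openin (mtop M) S"
proof (subst openin_subopen, intro ballI)
  fix p assume "p \<in> S"
  then obtain c where c: "c \<in> atlas M" "p \<in> chart_dom c"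
    using assms(2) chart_cover by blast
  have "q = p" if "q \<in> chart_dom c" for q
  proof (rule inj_onD[OF coord_inj_on[OF c(1)] _ that c(2)])
    show "coord c q = coord c p"
      using coord_ge_dim[OF c(1)] that c(2) assms(1) by auto
  qed
  then have "chart_dom c = {p}"
    using c(2) by blast
  then show "\<exists>W. openin (mtop M) W \<and> p \<in> W \<and> W \<subseteq> S"
    using chart_dom_open[OF c(1)] \<open>p \<in> S\<close> by auto
qed

text \<open>A curve in \<open>X \<union> Y\<close> that starts outside the closed set
  \<open>Y\<close> avoids it for a short time; shortened, it is a curve in \<open>X\<close>.\<close>

lemma unit_tangents_Un_closed:
  assumes Y: "closedin (mtop M) Y" and x: "x \<in> points M" "x \<notin> Y"
  shows "unit_tangents M x (X \<union> Y) = unit_tangents M x X"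
proof
  show "unit_tangents M x (X \<union> Y) \<subseteq> unit_tangents M x X"
  proof
    fix v assume "v \<in> unit_tangents M x (X \<union> Y)"
    then obtain e \<gamma> where v: "v \<in> unit_vectors M x" and \<gamma>: "e > 0" "smooth_curve M {0..<e} \<gamma>"
      "\<gamma> ` {0..<e} \<subseteq> X \<union> Y" "\<gamma> 0 = x" "has_velocity M {0..<e} \<gamma> 0 v"
      unfolding unit_tangents_def by blast
    have "openin (top_of_set {0..<e}) {s \<in> topspace (top_of_set {0..<e}). \<gamma> s \<in> points M - Y}"
      using \<gamma>(2) Y unfolding smooth_curve_def
      by (intro openin_continuous_map_preimage[of _ "mtop M"]) auto
    then obtain W where W: "open W" "{s \<in> {0..<e}. \<gamma> s \<in> points M - Y} = {0..<e} \<inter> W"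
      by (auto simp: openin_open)
    then have "0 \<in> W"
      using \<gamma>(1,4) x by auto
    then obtain r where r: "r > 0" "ball 0 r \<subseteq> W"
      using W by (meson openE)
    define e' where "e' = min e r"
    have sub: "(\<lambda>s. 1 * s) ` {0..<e'} \<subseteq> {0..<e}"
      by (auto simp: e'_def)
    have "\<gamma> s \<in> X" if "s \<in> {0..<e'}" for s
    proof -
      have s: "s \<in> {0..<e}" "s \<in> W"
        using that r(2) by (auto simp: e'_def subset_eq dist_real_def)
      then have "s \<in> {s \<in> {0..<e}. \<gamma> s \<in> points M - Y}"
        unfolding W(2) by blast
      then show ?thesis
        using \<gamma>(3) s(1) by blast
    qed
    moreover have "smooth_curve M {0..<e'} \<gamma>" "has_velocity M {0..<e'} \<gamma> 0 v"
      using smooth_curve_scale[OF \<gamma>(2) sub] has_velocity_scale[OF \<gamma>(5) sub] x(1) \<gamma>(4) by auto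
    moreover have "e' > 0"
      using r \<gamma>(1) by (simp add: e'_def)
    ultimately show "v \<in> unit_tangents M x X"
      using v \<gamma>(4) unfolding unit_tangents_def by blast
  qed
qed (simp add: unit_tangents_mono)

context
  fixes x
  assumes x: "x \<in> points M"
begin

abbreviation (input) sphere_top :: "'v topology" where "sphere_top \<equiv> mtop (unit_sphere M x)"

definition conically_dense :: "'p set \<Rightarrow> bool" where
  "conically_dense X \<longleftrightarrow>
     sphere_top closure_of (sphere_top interior_of conical_dirs M X x) = topspace sphere_top"

text \<open>The unit vectors \<open>w\<close> with \<open>met M x w v > 1 - \<delta>\<close> form a
  neighbourhood of \<open>v\<close>, and \<open>cone_directions\<close> applies to all of
  them.\<close>

lemma unit_tangents_interior:
  assumes "x \<in> X" "v \<in> unit_vectors M x" "\<delta> > 0" "cone M x v \<delta> \<subseteq> exp_dom M x" "exp_map M x ` cone M x v \<delta> \<subseteq> X"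
  shows "v \<in> sphere_top interior_of unit_tangents M x X"
proof -
  let ?W = "{w \<in> points (unit_sphere M x). met M x w v \<in> {1 - \<delta><..}}"
  have "v \<in> tangent M x" "met M x v v = 1"
    using assms(2) by (auto simp: unit_vectors_def)
  then have "openin sphere_top ?W"
    using met_continuous[OF x] by (intro openin_continuous_map_preimage[of _ euclideanreal]) auto
  moreover have "v \<in> ?W"
    using assms(2,3) \<open>met M x v v = 1\<close> points_unit_sphere[OF x] by auto
  moreover have "?W \<subseteq> unit_tangents M x X"
    using cone_directions[OF assms(1) x assms(2-5)] points_unit_sphere[OF x] by auto
  ultimately show ?thesis
    unfolding interior_of_def by blast
qed

lemma not_tangent_if_cone_outside:
  assumes "v \<in> unit_tangents M x X" "\<delta> > 0" "cone M x v \<delta> \<subseteq> exp_dom M x"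
  shows "\<not> exp_map M x ` cone M x v \<delta> \<subseteq> points M - X"
proof -
  obtain e \<gamma> where v: "v \<in> unit_vectors M x" and \<gamma>: "e > 0" "smooth_curve M {0..<e} \<gamma>"
      "\<gamma> ` {0..<e} \<subseteq> X" "\<gamma> 0 = x" "has_velocity M {0..<e} \<gamma> 0 v"
    using assms(1) unfolding unit_tangents_def by blast
  then show ?thesis
    using curve_meets_exp_cone[OF x v assms(2,3) \<gamma>(1,2,4,5)] by blast
qed

lemma tangent_conical_dir:
  assumes "v \<in> unit_tangents M x X" "v \<in> conical_dirs M X x"
  obtains \<delta> where "\<delta> > 0" "cone M x v \<delta> \<subseteq> exp_dom M x" "exp_map M x ` cone M x v \<delta> \<subseteq> X"
proof -
  obtain \<delta> where \<delta>: "\<delta> > 0" "cone M x v \<delta> \<subseteq> exp_dom M x"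
    "exp_map M x ` cone M x v \<delta> \<subseteq> X \<or> exp_map M x ` cone M x v \<delta> \<subseteq> points M - X"
    using assms(2) unfolding conical_dirs_def by blast
  with not_tangent_if_cone_outside[OF assms(1) \<delta>(1,2)] show ?thesis
    using that by blast
qed

lemma cone_mono:
  assumes "v \<in> unit_vectors M x" "\<delta> \<le> \<delta>'"
  shows "cone M x v \<delta> \<subseteq> cone M x v \<delta>'"
proof
  fix u assume u: "u \<in> cone M x v \<delta>"
  interpret finite_inner_subspace "tangent M x" "met M x" "mdim M"
    using finite_inner_subspace[OF x] .
  have "0 \<le> tnorm M x u * tnorm M x v"
    using u assms(1) by (auto simp: cone_def unit_vectors_def nrm_eq_tnorm[OF x, symmetric])
  then have "(1 - \<delta>') * (tnorm M x u * tnorm M x v) \<le> (1 - \<delta>) * (tnorm M x u * tnorm M x v)"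
    using assms(2) by (intro mult_right_mono) auto
  then show "u \<in> cone M x v \<delta>'"
    using u assms(2) unfolding cone_def by (auto simp: mult.assoc)
qed

text \<open>The inclusion from left to right would fail for arbitrary sets in place of tangent
  directions. If \<open>v\<close> is tangent to the union and conical for \<open>X\<close> and for
  \<open>Y\<close>, the two cones cannot both lie outside, since a common smaller cone would miss
  the union; a cone lying inside makes \<open>v\<close> interior to the directions tangent to
  \<open>X\<close> or to \<open>Y\<close>. By density, and since the right side is closed, this
  suffices.\<close>

lemma ci_unit_tangents_Un:
  assumes X: "x \<in> X" "conically_dense X" and Y: "x \<in> Y" "conically_dense Y"
  shows "ci sphere_top (unit_tangents M x (X \<union> Y)) =
    ci sphere_top (unit_tangents M x X) \<union> ci sphere_top (unit_tangents M x Y)"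
proof
  let ?int = "\<lambda>Z. sphere_top interior_of unit_tangents M x Z"
  let ?C = "ci sphere_top (unit_tangents M x X) \<union> ci sphere_top (unit_tangents M x Y)"
  have C: "closedin sphere_top ?C"
    by (simp add: ci_def closedin_Un)
  have int_C: "?int X \<subseteq> ?C" "?int Y \<subseteq> ?C"
    unfolding ci_def by (simp_all add: closure_of_subset interior_of_subset_topspace le_supI1 le_supI2)
  have "?int (X \<union> Y) \<subseteq> ?C"
  proof (rule openin_subset_closed_if_dense[OF _ _ _ _ _ C])
    show "?int (X \<union> Y) \<inter> sphere_top interior_of conical_dirs M X x \<inter> sphere_top interior_of conical_dirs M Y x \<subseteq> ?C"
    proof
      fix v assume "v \<in> ?int (X \<union> Y) \<inter> sphere_top interior_of conical_dirs M X x \<inter> sphere_top interior_of conical_dirs M Y x"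
      then have v: "v \<in> unit_tangents M x (X \<union> Y)" "v \<in> conical_dirs M X x" "v \<in> conical_dirs M Y x"
        by (auto dest: subsetD[OF interior_of_subset])
      have vU: "v \<in> unit_vectors M x"
        using v(2) by (simp add: conical_dirs_def)
      obtain \<delta>1 \<delta>2 where \<delta>: "\<delta>1 > 0" "cone M x v \<delta>1 \<subseteq> exp_dom M x" "\<delta>2 > 0" "cone M x v \<delta>2 \<subseteq> exp_dom M x"
        "exp_map M x ` cone M x v \<delta>1 \<subseteq> X \<or> exp_map M x ` cone M x v \<delta>1 \<subseteq> points M - X"
        "exp_map M x ` cone M x v \<delta>2 \<subseteq> Y \<or> exp_map M x ` cone M x v \<delta>2 \<subseteq> points M - Y"
        using v(2,3) unfolding conical_dirs_def by blast
      have "\<not> (exp_map M x ` cone M x v \<delta>1 \<subseteq> points M - X \<and> exp_map M x ` cone M x v \<delta>2 \<subseteq> points M - Y)"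
      proof
        assume *: "exp_map M x ` cone M x v \<delta>1 \<subseteq> points M - X \<and> exp_map M x ` cone M x v \<delta>2 \<subseteq> points M - Y"
        have sub: "cone M x v (min \<delta>1 \<delta>2) \<subseteq> cone M x v \<delta>1" "cone M x v (min \<delta>1 \<delta>2) \<subseteq> cone M x v \<delta>2"
          by (intro cone_mono[OF vU]; simp)+
        have "exp_map M x ` cone M x v (min \<delta>1 \<delta>2) \<subseteq> points M - (X \<union> Y)"
          using * sub by blast
        moreover have "min \<delta>1 \<delta>2 > 0" "cone M x v (min \<delta>1 \<delta>2) \<subseteq> exp_dom M x"
          using \<delta> sub by auto
        ultimately show False
          using not_tangent_if_cone_outside[OF v(1)] by blast
      qed
      then have "v \<in> ?int X \<or> v \<in> ?int Y"
        using unit_tangents_interior[OF X(1) vU \<delta>(1,2)] unit_tangents_interior[OF Y(1) vU \<delta>(3,4)] \<delta>(5,6) by blast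
      then show "v \<in> ?C"
        using int_C by blast
    qed
  qed (use X(2) Y(2) in \<open>simp_all add: conically_dense_def\<close>)
  then show "ci sphere_top (unit_tangents M x (X \<union> Y)) \<subseteq> ?C"
    unfolding ci_def[of _ "unit_tangents M x (X \<union> Y)"] using C by (rule closure_of_minimal)
  show "?C \<subseteq> ci sphere_top (unit_tangents M x (X \<union> Y))"
    unfolding ci_def by (intro Un_least closure_of_mono interior_of_mono unit_tangents_mono) auto
qed

lemma ci_unit_tangents_Int:
  assumes X: "x \<in> X" "conically_dense X" and Y: "x \<in> Y" "conically_dense Y"
    and XY: "mtop M interior_of (X \<inter> Y) = {}"
  shows "sphere_top interior_of (ci sphere_top (unit_tangents M x X) \<inter> ci sphere_top (unit_tangents M x Y)) = {}"
proof (rule ccontr)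
  let ?int = "\<lambda>Z. sphere_top interior_of unit_tangents M x Z"
  define W where "W = sphere_top interior_of (ci sphere_top (unit_tangents M x X) \<inter> ci sphere_top (unit_tangents M x Y))"
  assume "\<not> ?thesis"
  then obtain w where w: "w \<in> W"
    by (auto simp: W_def)
  have W: "openin sphere_top W" "W \<subseteq> sphere_top closure_of ?int X" "W \<subseteq> sphere_top closure_of ?int Y"
    using interior_of_subset unfolding W_def ci_def by fastforce+
  \<comment> \<open>The open set \<open>W\<close> lies in the closures of two open sets: it meets
    the first, and the open intersection \<open>W1\<close> meets the second.\<close>
  define W1 where "W1 = W \<inter> ?int X"
  have W1: "openin sphere_top W1" "W1 \<noteq> {}"
    using W(1,2) w unfolding W1_def in_closure_of[of w] by (auto simp: in_closure_of subset_eq)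
  define W2 where "W2 = W1 \<inter> ?int Y"
  have W2: "openin sphere_top W2" "W2 \<noteq> {}"
  proof -
    obtain v where v: "v \<in> W1"
      using W1 by blast
    then have "v \<in> sphere_top closure_of ?int Y"
      using W(3) by (auto simp: W1_def)
    then show "W2 \<noteq> {}"
      using W1(1) v unfolding in_closure_of W2_def by blast
  qed (use W1 in \<open>auto simp: W2_def\<close>)
  \<comment> \<open>A direction in \<open>W2\<close> conical for both sets would put the exponential
    image of a common cone into \<open>X \<inter> Y\<close>, although such an image has interior
    points. Since those directions would be dense in \<open>W2\<close>, it is empty.\<close>
  have "W2 \<subseteq> {}"
  proof (rule openin_subset_closed_if_dense[OF W2(1)])
    show "W2 \<inter> sphere_top interior_of conical_dirs M X x \<inter> sphere_top interior_of conical_dirs M Y x \<subseteq> {}"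
    proof
      fix v assume "v \<in> W2 \<inter> sphere_top interior_of conical_dirs M X x \<inter> sphere_top interior_of conical_dirs M Y x"
      then have v: "v \<in> unit_tangents M x X" "v \<in> unit_tangents M x Y" "v \<in> conical_dirs M X x" "v \<in> conical_dirs M Y x"
        unfolding W2_def W1_def by (auto dest: subsetD[OF interior_of_subset])
      have vU: "v \<in> unit_vectors M x"
        using v(3) by (simp add: conical_dirs_def)
      obtain \<delta>1 where \<delta>1: "\<delta>1 > 0" "cone M x v \<delta>1 \<subseteq> exp_dom M x" "exp_map M x ` cone M x v \<delta>1 \<subseteq> X"
        using tangent_conical_dir[OF v(1,3)] .
      obtain \<delta>2 where \<delta>2: "\<delta>2 > 0" "cone M x v \<delta>2 \<subseteq> exp_dom M x" "exp_map M x ` cone M x v \<delta>2 \<subseteq> Y"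
        using tangent_conical_dir[OF v(2,4)] .
      have sub: "cone M x v (min \<delta>1 \<delta>2) \<subseteq> cone M x v \<delta>1" "cone M x v (min \<delta>1 \<delta>2) \<subseteq> cone M x v \<delta>2"
        by (intro cone_mono[OF vU]; simp)+
      then have "exp_map M x ` cone M x v (min \<delta>1 \<delta>2) \<subseteq> X \<inter> Y"
        using \<delta>1(3) \<delta>2(3) by blast
      then have "mtop M interior_of (exp_map M x ` cone M x v (min \<delta>1 \<delta>2)) = {}"
        using interior_of_mono[of _ "X \<inter> Y" "mtop M"] XY by blast
      moreover have "min \<delta>1 \<delta>2 > 0" "cone M x v (min \<delta>1 \<delta>2) \<subseteq> exp_dom M x"
        using \<delta>1 \<delta>2 sub by auto
      ultimately show "v \<in> {}"
        using exp_cone_interior[OF x vU] by blast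
    qed
  qed (use X(2) Y(2) in \<open>simp_all add: conically_dense_def\<close>)
  then show False
    using W2(2) by blast
qed

end

end

section \<open>The rasped representation of a union\<close>

text \<open>The induction hypothesis is an assumption about manifolds with points of type
  \<open>'v\<close>, so that the step serves both inside the induction over spheres and for the
  final passage from \<open>'p\<close> to \<open>'v\<close>.\<close>

lemma rasp_Un_Suc:
  fixes M :: "('p, 'v::real_vector) rmanifold"
  assumes IH: "\<And>(N :: ('v, 'v) rmanifold) A B. \<lbrakk>riemannian_atlas N; mdim N = d; A \<in> SS d N; B \<in> SS d N;
      mtop N interior_of (A \<inter> B) = {}\<rbrakk> \<Longrightarrow> rasp d N (A \<union> B) = rasp d N A \<union> rasp d N B \<and> rasp d N A \<inter> rasp d N B = {}"
    and "riemannian_atlas M" and dim: "mdim M = Suc d" and X: "X \<in> SS (Suc d) M" and Y: "Y \<in> SS (Suc d) M"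
    and XY: "mtop M interior_of (X \<inter> Y) = {}"
  shows "rasp (Suc d) M (X \<union> Y) = rasp (Suc d) M X \<union> rasp (Suc d) M Y \<and> rasp (Suc d) M X \<inter> rasp (Suc d) M Y = {}"
proof -
  interpret riemannian_atlas M
    by fact
  \<comment> \<open>The fibre of the rasped representation over \<open>x\<close>. A tuple is tested
    only on its base point and the fibre over it, so the fibres are compared separately for
    \<open>x\<close> in one of the sets and for \<open>x\<close> in both.\<close>
  define F where "F Z x = rasp d (unit_sphere M x) (ci (mtop (unit_sphere M x)) (unit_tangents M x Z))" for Z x
  have rasp: "rasp (Suc d) M Z = {(x, v # vs) | x v vs. x \<in> Z \<and> (v, vs) \<in> F Z x}" for Z
    by (simp add: rasp_rec(2) rasp_step_def F_def)
  have SS: "Z \<subseteq> points M" "closedin (mtop M) Z" "x \<in> Z \<Longrightarrow> conically_dense x Z"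
    "x \<in> Z \<Longrightarrow> ci (mtop (unit_sphere M x)) (unit_tangents M x Z) \<in> SS d (unit_sphere M x)"
    if "Z \<in> SS (Suc d) M" for Z x
  proof -
    have Z: "Z \<subseteq> points M" "Z = ci (mtop M) Z"
      "\<forall>x\<in>Z. let U = mtop (unit_sphere M x) in U closure_of (U interior_of conical_dirs M Z x) = topspace U"
      "\<forall>x\<in>Z. ci (mtop (unit_sphere M x)) (unit_tangents M x Z) \<in> SS d (unit_sphere M x)"
      using that by (simp_all add: SS_rec(2) SS_step_def)
    then show "Z \<subseteq> points M" "x \<in> Z \<Longrightarrow> conically_dense x Z"
      "x \<in> Z \<Longrightarrow> ci (mtop (unit_sphere M x)) (unit_tangents M x Z) \<in> SS d (unit_sphere M x)"
      using conically_dense_def[of x Z] by (auto simp: Let_def)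
    show "closedin (mtop M) Z"
      by (subst Z(2)) (simp add: ci_def)
  qed
  have only_X: "F (X \<union> Y) x = F X x" if "x \<in> X" "x \<notin> Y" for x
    using unit_tangents_Un_closed[OF SS(2)[OF Y], of x X] SS(1)[OF X] that by (auto simp: F_def)
  have only_Y: "F (X \<union> Y) x = F Y x" if "x \<in> Y" "x \<notin> X" for x
    using unit_tangents_Un_closed[OF SS(2)[OF X], of x Y] SS(1)[OF Y] that by (auto simp: F_def Un_commute)
  have both: "F (X \<union> Y) x = F X x \<union> F Y x \<and> F X x \<inter> F Y x = {}" if x: "x \<in> X" "x \<in> Y" for x
  proof -
    have xp: "x \<in> points M"
      using SS(1)[OF X] x by blast
    have "mdim (unit_sphere M x) = d"
      using dim by (simp add: unit_sphere_def)
    with riemannian_atlas_unit_sphere[OF xp] show ?thesis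
      unfolding F_def ci_unit_tangents_Un[OF xp x(1) SS(3)[OF X x(1)] x(2) SS(3)[OF Y x(2)]]
      using SS(4)[OF X x(1)] SS(4)[OF Y x(2)]
        ci_unit_tangents_Int[OF xp x(1) SS(3)[OF X x(1)] x(2) SS(3)[OF Y x(2)] XY]
      by (rule IH)
  qed
  show ?thesis
  proof
    show "rasp (Suc d) M (X \<union> Y) = rasp (Suc d) M X \<union> rasp (Suc d) M Y"
    proof (rule set_eqI)
      fix t :: "'p \<times> 'v list"
      show "t \<in> rasp (Suc d) M (X \<union> Y) \<longleftrightarrow> t \<in> rasp (Suc d) M X \<union> rasp (Suc d) M Y"
        using only_X[of "fst t"] only_Y[of "fst t"] both[of "fst t"] unfolding rasp
        by (cases "fst t \<in> X"; cases "fst t \<in> Y") auto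
    qed
    show "rasp (Suc d) M X \<inter> rasp (Suc d) M Y = {}"
      using both unfolding rasp by fast
  qed
qed

text \<open>Every subset is open in dimension 0, so a set without interior points is empty.\<close>

lemma rasp_Un_0:
  assumes "riemannian_atlas M" "mdim M = 0" "X \<in> SS 0 M" "mtop M interior_of (X \<inter> Y) = {}"
  shows "rasp 0 M (X \<union> Y) = rasp 0 M X \<union> rasp 0 M Y \<and> rasp 0 M X \<inter> rasp 0 M Y = {}"
proof -
  have "X \<inter> Y \<subseteq> points M"
    using assms(3) by (auto simp: SS_rec)
  then have "X \<inter> Y = {}"
    using riemannian_atlas.openin_if_dim_0[OF assms(1,2)] assms(4) by (metis interior_of_openin)
  then show ?thesis
    by (auto simp: rasp_rec)
qed

lemma rasp_Un_sphere:
  fixes N :: "('v::real_vector, 'v) rmanifold"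
  assumes "riemannian_atlas N" "mdim N = d" "A \<in> SS d N" "B \<in> SS d N" "mtop N interior_of (A \<inter> B) = {}"
  shows "rasp d N (A \<union> B) = rasp d N A \<union> rasp d N B \<and> rasp d N A \<inter> rasp d N B = {}"
  using assms
proof (induction d arbitrary: N A B)
  case 0
  then show ?case
    using rasp_Un_0 by blast
next
  case (Suc d)
  from rasp_Un_Suc[OF Suc.IH Suc.prems] show ?case .
qed

theorem corollary4p5:
  fixes M :: "('p, 'v::real_vector) rmanifold" and d :: nat and X Y :: "'p set"
  assumes "riemannian_manifold M" and "mdim M = d"
    and "X \<in> SS d M" and "Y \<in> SS d M"
    and "mtop M interior_of (X \<inter> Y) = {}"
  shows "rasp d M (X \<union> Y) = rasp d M X \<union> rasp d M Y \<and> rasp d M X \<inter> rasp d M Y = {}"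
proof -
  have M: "riemannian_atlas M"
    using assms(1) by (rule riemannian_manifold.riemannian_atlas)
  show ?thesis
  proof (cases d)
    case 0
    then show ?thesis
      using rasp_Un_0[OF M] assms by blast
  next
    case (Suc d')
    show ?thesis
      unfolding Suc
    proof (rule rasp_Un_Suc[OF _ M])
      show "rasp d' N (A \<union> B) = rasp d' N A \<union> rasp d' N B \<and> rasp d' N A \<inter> rasp d' N B = {}"
        if "riemannian_atlas N" "mdim N = d'" "A \<in> SS d' N" "B \<in> SS d' N" "mtop N interior_of (A \<inter> B) = {}"
        for N :: "('v, 'v) rmanifold" and A B
        using that by (rule rasp_Un_sphere)
    qed (use assms Suc in auto)
  qed
qed

end
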